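(* Let $G=\mathbb{Z}^n$ act on $L^2(\mathbb{R}^n)$ by $(\nu_g\zeta)(x)=\zeta(x-g)$. Let $\mathcal{K}\subset L^2(\mathbb{R}^n)$ be a closed subspace, and suppose that $\zeta_1,\dots,\zeta_d$ and $\tilde\zeta_1,\dots,\tilde\zeta_d$ are compactly supported functions in $L^2(\mathbb{R}^n)$ that form dual $G$-frames for $\mathcal{K}$. Then there exist an integer $r\ge 0$ and compactly supported functions $\eta_1,\dots,\eta_r$ and $\tilde\eta_1,\dots,\tilde\eta_r$ in $\mathcal{K}$ that form bi-orthogonal $G$-frames for $\mathcal{K}$.
   Context: Inner products are linear in the first variable. A function in $L^2(\mathbb{R}^n)$ is compactly supported if it vanishes a.e. outside some compact set. A countable family $\{\xi_i\}_{i\in I}$ of vectors in a Hilbert space $\mathcal{K}$ is a frame for $\mathcal{K}$ if there are $A,B>0$ with $A\|\zeta\|^2\le\sum_{i\in I}|\langle\zeta,\xi_i\rangle|^2\le B\|\zeta\|^2$ for all $\zeta\in\mathcal{K}$. Two frames $\{\xi_i\}_{i\in I}$ and $\{\tilde\xi_i\}_{i\in I}$ for $\mathcal{K}$ are dual if $\zeta=\sum_i\langle\zeta,\xi_i\rangle\tilde\xi_i=\sum_i\langle\zeta,\tilde\xi_i\rangle\xi_i$ for all $\zeta\in\mathcal{K}$. Dual frames are bi-orthogonal if $\langle\xi_i,\tilde\xi_j\rangle=\delta_{i,j}$ for all $i,j\in I$. Families $\zeta_1,\dots,\zeta_d$ and $\tilde\zeta_1,\dots,\tilde\zeta_d$ of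 vectors in $\mathcal{K}$ form dual (respectively bi-orthogonal) $G$-frames for $\mathcal{K}$ if the families $\{\nu_g\zeta_i\}_{g\in G,\,1\le i\le d}$ and $\{\nu_g\tilde\zeta_i\}_{g\in G,\,1\le i\le d}$ (indexed by pairs $(g,i)$) lie in $\mathcal{K}$ and form dual (respectively bi-orthogonal dual) frames for $\mathcal{K}$. Empty families ($r=0$) are allowed; they occur for $\mathcal{K}=\{0\}$. *)

theory Defs
  imports "HOL-Analysis.Analysis"
begin

section \<open>Square-integrable functions\<close>

definition square_integrable :: "('a::euclidean_space \<Rightarrow> complex) \<Rightarrow> bool" where
  "square_integrable f \<longleftrightarrow>
     f \<in> borel_measurable lborel \<and> integrable lborel (\<lambda>x. (cmod (f x))\<^sup>2)"

lemma square_integrable_mult_cnj: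
  assumes "square_integrable f" "square_integrable g"
  shows "integrable lborel (\<lambda>x. f x * cnj (g x))"
proof -
  have [measurable]: "f \<in> borel_measurable borel" "g \<in> borel_measurable borel"
    using assms by (auto simp: square_integrable_def)
  have "integrable lborel (\<lambda>x. (cmod (f x))\<^sup>2 + (cmod (g x))\<^sup>2)"
    using assms by (auto simp: square_integrable_def)
  then show ?thesis
  proof (rule Bochner_Integration.integrable_bound)
    show "AE x in lborel. norm (f x * cnj (g x)) \<le> norm ((cmod (f x))\<^sup>2 + (cmod (g x))\<^sup>2)"
    proof (rule AE_I2)
      fix x
      have "2 * cmod (f x) * cmod (g x) \<le> (cmod (f x))\<^sup>2 + (cmod (g x))\<^sup>2"
        by (rule sum_squares_bound)
      moreover have "0 \<le> cmod (f x) * cmod (g x)" by simp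
      ultimately have "cmod (f x) * cmod (g x) \<le> (cmod (f x))\<^sup>2 + (cmod (g x))\<^sup>2"
        by linarith
      then show "norm (f x * cnj (g x)) \<le> norm ((cmod (f x))\<^sup>2 + (cmod (g x))\<^sup>2)"
        by (simp add: norm_mult)
    qed
  next
    have "(\<lambda>x. cnj (g x)) \<in> borel_measurable borel"
      by (rule borel_measurable_continuous_on[OF continuous_on_cnj[OF continuous_on_id]]) measurable
    then show "(\<lambda>x. f x * cnj (g x)) \<in> borel_measurable lborel"
      by simp
  qed
qed

lemma square_integrable_zero: "square_integrable (\<lambda>x. 0)"
  by (simp add: square_integrable_def)

lemma square_integrable_cmult:
  assumes "square_integrable f"
  shows "square_integrable (\<lambda>x. c * f x)"
  using assms by (auto simp: square_integrable_def norm_mult power_mult_distrib)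

lemma square_integrable_add:
  assumes "square_integrable f" "square_integrable g"
  shows "square_integrable (\<lambda>x. f x + g x)"
proof -
  have [measurable]: "f \<in> borel_measurable borel" "g \<in> borel_measurable borel"
    using assms by (auto simp: square_integrable_def)
  have "integrable lborel (\<lambda>x. 2 * (cmod (f x))\<^sup>2 + 2 * (cmod (g x))\<^sup>2)"
    using assms by (auto simp: square_integrable_def)
  then have "integrable lborel (\<lambda>x. (cmod (f x + g x))\<^sup>2)"
  proof (rule Bochner_Integration.integrable_bound)
    show "AE x in lborel. norm ((cmod (f x + g x))\<^sup>2)
            \<le> norm (2 * (cmod (f x))\<^sup>2 + 2 * (cmod (g x))\<^sup>2)"
    proof (rule AE_I2)
      fix x
      have "(cmod (f x + g x))\<^sup>2 \<le> (cmod (f x) + cmod (g x))\<^sup>2"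
        by (intro power_mono norm_triangle_ineq) auto
      also have "\<dots> \<le> 2 * (cmod (f x))\<^sup>2 + 2 * (cmod (g x))\<^sup>2"
        using sum_squares_bound[of "cmod (f x)" "cmod (g x)"] by (simp add: power2_sum)
      finally show "norm ((cmod (f x + g x))\<^sup>2)
          \<le> norm (2 * (cmod (f x))\<^sup>2 + 2 * (cmod (g x))\<^sup>2)" by simp
    qed
  qed auto
  then show ?thesis
    by (simp add: square_integrable_def)
qed

lemma AE_lborel_translate:
  fixes a :: "'a::euclidean_space"
  assumes "AE x in lborel. P x"
  shows "AE x in lborel. P (x - a)"
proof -
  from assms obtain N where N: "{x. \<not> P x} \<subseteq> N" "N \<in> sets lborel" "emeasure lborel N = 0"
    by (auto elim!: AE_E)
  then have "AE x in lborel. x \<notin> N"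
    by (intro AE_not_in) (auto simp: null_sets_def)
  then have "AE x in distr lborel borel ((+) (- a)). x \<notin> N"
    unfolding lborel_distr_plus .
  then have "AE x in lborel. - a + x \<notin> N"
    using N(2) by (subst (asm) AE_distr_iff) (auto simp: Compl_eq[symmetric])
  then show ?thesis
    using N(1) by (auto elim!: eventually_mono)
qed

lemma square_integrable_translate:
  fixes a :: "'a::euclidean_space"
  assumes "square_integrable f"
  shows "square_integrable (\<lambda>x. f (x - a))"
proof -
  have [measurable]: "f \<in> borel_measurable borel"
    using assms by (auto simp: square_integrable_def)
  have "integrable (distr lborel borel ((+) (- a))) (\<lambda>x. (cmod (f x))\<^sup>2)"
    using assms by (simp add: square_integrable_def lborel_distr_plus)
  then have "integrable lborel (\<lambda>x. (cmod (f (- a + x)))\<^sup>2)"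
    by (subst (asm) integrable_distr_eq) auto
  then show ?thesis
    by (simp add: square_integrable_def)
qed

section \<open>The Hilbert space \<open>L\<^sup>2\<close>\<close>

text \<open>
  Elements are almost-everywhere classes of Borel representatives. Every Lebesgue measurable
  function agrees almost everywhere with a Borel one, so this is the usual space.
\<close>

definition ae_equal :: "('a::euclidean_space \<Rightarrow> complex) \<Rightarrow> ('a \<Rightarrow> complex) \<Rightarrow> bool" where
  "ae_equal f g \<longleftrightarrow>
     square_integrable f \<and> square_integrable g \<and> (AE x in lborel. f x = g x)"

quotient_type (overloaded) 'a l2 = "'a::euclidean_space \<Rightarrow> complex" / partial: ae_equal
proof (rule part_equivpI)
  show "\<exists>f :: 'a \<Rightarrow> complex. ae_equal f f"
    using square_integrable_zero by (auto simp: ae_equal_def)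
  show "symp (ae_equal :: ('a \<Rightarrow> complex) \<Rightarrow> _)"
    by (auto simp: symp_def ae_equal_def elim: eventually_mono)
  show "transp (ae_equal :: ('a \<Rightarrow> complex) \<Rightarrow> _)"
    unfolding transp_def ae_equal_def by (auto elim: eventually_elim2)
qed

lift_definition scale_l2 :: "complex \<Rightarrow> 'a::euclidean_space l2 \<Rightarrow> 'a l2" (infixr "*\<^sub>C" 75)
  is "\<lambda>c f x. c * f x"
  by (auto simp: ae_equal_def square_integrable_cmult elim: eventually_mono)

lift_definition cinner_l2 :: "'a::euclidean_space l2 \<Rightarrow> 'a l2 \<Rightarrow> complex"
  is "\<lambda>f g. \<integral>x. f x * cnj (g x) \<partial>lborel"
proof -
  fix f f' g g' :: "'a \<Rightarrow> complex"
  assume *: "ae_equal f f'" "ae_equal g g'"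
  then have "AE x in lborel. f x * cnj (g x) = f' x * cnj (g' x)"
    unfolding ae_equal_def by (auto elim: eventually_elim2)
  with * show "(\<integral>x. f x * cnj (g x) \<partial>lborel) = (\<integral>x. f' x * cnj (g' x) \<partial>lborel)"
    by (intro integral_cong_AE borel_measurable_integrable square_integrable_mult_cnj)
       (simp_all add: ae_equal_def)
qed

text \<open>
  The library only has real inner product spaces. The real inner product is the real part of
  \<^const>\<open>cinner_l2\<close>; it induces the \<open>L\<^sup>2\<close> norm, hence the \<open>L\<^sup>2\<close> topology used by \<^const>\<open>closed\<close> and
  \<^const>\<open>has_sum\<close>.
\<close>

instantiation l2 :: (euclidean_space) real_inner
begin

lift_definition zero_l2 :: "'a l2" is "\<lambda>x. 0"
  by (simp add: ae_equal_def square_integrable_zero)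

lift_definition plus_l2 :: "'a l2 \<Rightarrow> 'a l2 \<Rightarrow> 'a l2" is "\<lambda>f g x. f x + g x"
  unfolding ae_equal_def by (auto simp: square_integrable_add elim: eventually_elim2)

definition uminus_l2 :: "'a l2 \<Rightarrow> 'a l2" where "uminus_l2 f = (-1) *\<^sub>C f"

definition minus_l2 :: "'a l2 \<Rightarrow> 'a l2 \<Rightarrow> 'a l2" where "minus_l2 f g = f + (- g)"

definition scaleR_l2 :: "real \<Rightarrow> 'a l2 \<Rightarrow> 'a l2" where
  "scaleR_l2 r f = complex_of_real r *\<^sub>C f"

definition inner_l2 :: "'a l2 \<Rightarrow> 'a l2 \<Rightarrow> real" where
  "inner_l2 f g = Re (cinner_l2 f g)"

definition norm_l2 :: "'a l2 \<Rightarrow> real" where "norm_l2 f = sqrt (inner f f)"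

definition sgn_l2 :: "'a l2 \<Rightarrow> 'a l2" where "sgn_l2 f = inverse (norm f) *\<^sub>R f"

definition dist_l2 :: "'a l2 \<Rightarrow> 'a l2 \<Rightarrow> real" where "dist_l2 f g = norm (f - g)"

definition uniformity_l2 :: "('a l2 \<times> 'a l2) filter" where
  "uniformity_l2 = (INF e\<in>{0<..}. principal {(f, g). dist f g < e})"

definition open_l2 :: "'a l2 set \<Rightarrow> bool" where
  "open_l2 U \<longleftrightarrow> (\<forall>f\<in>U. eventually (\<lambda>(f', g). f' = f \<longrightarrow> g \<in> U) uniformity)"

instance
proof
  fix f g h :: "'a l2" and a b :: real
  show "f + g + h = f + (g + h)"
    by transfer (auto simp: ae_equal_def square_integrable_add add.assoc)
  show "f + g = g + f"
    by transfer (auto simp: ae_equal_def square_integrable_add add.commute)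
  show "0 + f = f"
    by transfer (auto simp: ae_equal_def)
  show "- f + f = 0"
    unfolding uminus_l2_def by transfer (auto simp: ae_equal_def square_integrable_zero)
  show "f - g = f + - g"
    by (rule minus_l2_def)
  show "a *\<^sub>R (f + g) = a *\<^sub>R f + a *\<^sub>R g" unfolding scaleR_l2_def
    by transfer
       (auto simp: ae_equal_def square_integrable_add square_integrable_cmult distrib_left)
  show "(a + b) *\<^sub>R f = a *\<^sub>R f + b *\<^sub>R f" unfolding scaleR_l2_def of_real_add
    by transfer (auto simp: ae_equal_def distrib_right
        intro!: square_integrable_add square_integrable_cmult
        simp flip: distrib_right)
  show "a *\<^sub>R b *\<^sub>R f = (a * b) *\<^sub>R f" unfolding scaleR_l2_def of_real_mult
    by transfer (auto simp: ae_equal_def square_integrable_cmult mult.assoc)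
  show "1 *\<^sub>R f = f" unfolding scaleR_l2_def of_real_1
    by transfer (auto simp: ae_equal_def)
  show "sgn f = inverse (norm f) *\<^sub>R f"
    by (rule sgn_l2_def)
  show "dist f g = norm (f - g)"
    by (rule dist_l2_def)
  show "(uniformity :: ('a l2 \<times> 'a l2) filter) = (INF e\<in>{0<..}. principal {(x, y). dist x y < e})"
    by (rule uniformity_l2_def)
  show "open U \<longleftrightarrow> (\<forall>x\<in>U. \<forall>\<^sub>F (x', y) in uniformity. x' = x \<longrightarrow> y \<in> U)" for U :: "'a l2 set"
    by (rule open_l2_def)
  show "inner f g = inner g f"
    unfolding inner_l2_def
  proof transfer
    fix f g :: "'a \<Rightarrow> complex"
    have "(\<integral>x. f x * cnj (g x) \<partial>lborel) = (\<integral>x. cnj (g x * cnj (f x)) \<partial>lborel)"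
      by (simp add: mult.commute)
    also have "\<dots> = cnj (\<integral>x. g x * cnj (f x) \<partial>lborel)"
      by (rule Bochner_Integration.integral_cnj)
    finally show "Re (\<integral>x. f x * cnj (g x) \<partial>lborel) = Re (\<integral>x. g x * cnj (f x) \<partial>lborel)"
      by simp
  qed
  show "inner (f + g) h = inner f h + inner g h"
    unfolding inner_l2_def
    by transfer (simp add: ae_equal_def distrib_right square_integrable_mult_cnj)
  show "inner (a *\<^sub>R f) g = a * inner f g"
    unfolding inner_l2_def scaleR_l2_def
    by transfer (simp add: mult.assoc)
  have sq: "(\<integral>x. F x * cnj (F x) \<partial>lborel) = complex_of_real (\<integral>x. (cmod (F x))\<^sup>2 \<partial>lborel)"
    for F :: "'a \<Rightarrow> complex"
    unfolding integral_complex_of_real[symmetric]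
    by (simp only: complex_norm_square[symmetric] of_real_power)
  show "0 \<le> inner f f"
    unfolding inner_l2_def by transfer (simp add: sq)
  show "inner f f = 0 \<longleftrightarrow> f = 0"
    unfolding inner_l2_def
  proof transfer
    fix F :: "'a \<Rightarrow> complex"
    assume "ae_equal F F"
    then have F: "square_integrable F" by (simp add: ae_equal_def)
    then have "(\<integral>x. (cmod (F x))\<^sup>2 \<partial>lborel) = 0 \<longleftrightarrow> (AE x in lborel. (cmod (F x))\<^sup>2 = 0)"
      by (intro integral_nonneg_eq_0_iff_AE) (auto simp: square_integrable_def)
    with F show "Re (\<integral>x. F x * cnj (F x) \<partial>lborel) = 0 \<longleftrightarrow> ae_equal F (\<lambda>x. 0)"
      by (simp add: sq ae_equal_def square_integrable_zero)
  qed
  show "norm f = sqrt (inner f f)"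
    by (rule norm_l2_def)
qed

end

lemma vector_space_scale_l2: "vector_space (scale_l2 :: complex \<Rightarrow> 'a::euclidean_space l2 \<Rightarrow> 'a l2)"
proof
  fix a b :: complex and f g :: "'a l2"
  show "a *\<^sub>C (f + g) = a *\<^sub>C f + a *\<^sub>C g"
    by transfer
       (auto simp: ae_equal_def square_integrable_add square_integrable_cmult distrib_left)
  show "(a + b) *\<^sub>C f = a *\<^sub>C f + b *\<^sub>C f"
    by transfer (auto simp: ae_equal_def distrib_right
        intro!: square_integrable_add square_integrable_cmult
        simp flip: distrib_right)
  show "a *\<^sub>C b *\<^sub>C f = (a * b) *\<^sub>C f"
    by transfer (auto simp: ae_equal_def square_integrable_cmult mult.assoc)
  show "1 *\<^sub>C f = f"
    by transfer (auto simp: ae_equal_def)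
qed

lift_definition compactly_supported :: "'a::euclidean_space l2 \<Rightarrow> bool"
  is "\<lambda>f. \<exists>S. compact S \<and> (AE x in lborel. x \<notin> S \<longrightarrow> f x = 0)"
proof -
  fix f g :: "'a \<Rightarrow> complex"
  assume "ae_equal f g"
  then have ae: "AE x in lborel. f x = g x" by (simp add: ae_equal_def)
  have "(AE x in lborel. x \<notin> S \<longrightarrow> f x = 0) \<longleftrightarrow> (AE x in lborel. x \<notin> S \<longrightarrow> g x = 0)" for S
    using ae by (intro eventually_subst) (auto elim: eventually_mono)
  then show "(\<exists>S. compact S \<and> (AE x in lborel. x \<notin> S \<longrightarrow> f x = 0)) \<longleftrightarrow>
             (\<exists>S. compact S \<and> (AE x in lborel. x \<notin> S \<longrightarrow> g x = 0))"
    by simp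
qed

lift_definition translate_l2 :: "'a::euclidean_space \<Rightarrow> 'a l2 \<Rightarrow> 'a l2"
  is "\<lambda>a f x. f (x - a)"
  unfolding ae_equal_def
  by (intro conjI square_integrable_translate AE_lborel_translate; elim conjE)

text \<open>The action of the group of integer vectors on \<open>L\<^sup>2\<close>.\<close>

definition \<nu> :: "int ^ 'n \<Rightarrow> (real ^ 'n) l2 \<Rightarrow> (real ^ 'n) l2" where
  "\<nu> g = translate_l2 (\<chi> k. real_of_int (g $ k))"

section \<open>Frames\<close>

text \<open>
  All sums are unconditional, as befits countable index sets without a given order. For a
  frame the expansions in the definition of duality converge unconditionally anyway.
\<close>

definition is_frame :: "'a::euclidean_space l2 set \<Rightarrow> 'i set \<Rightarrow> ('i \<Rightarrow> 'a l2) \<Rightarrow> bool" where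
  "is_frame K I \<xi> \<longleftrightarrow>
     countable I \<and> (\<forall>i\<in>I. \<xi> i \<in> K) \<and>
     (\<exists>A>0. \<exists>B>0. \<forall>\<zeta>\<in>K.
        (\<lambda>i. (cmod (cinner_l2 \<zeta> (\<xi> i)))\<^sup>2) summable_on I \<and>
        A * (norm \<zeta>)\<^sup>2 \<le> (\<Sum>\<^sub>\<infinity>i\<in>I. (cmod (cinner_l2 \<zeta> (\<xi> i)))\<^sup>2) \<and>
        (\<Sum>\<^sub>\<infinity>i\<in>I. (cmod (cinner_l2 \<zeta> (\<xi> i)))\<^sup>2) \<le> B * (norm \<zeta>)\<^sup>2)"

definition dual_frames ::
    "'a::euclidean_space l2 set \<Rightarrow> 'i set \<Rightarrow> ('i \<Rightarrow> 'a l2) \<Rightarrow> ('i \<Rightarrow> 'a l2) \<Rightarrow> bool" where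
  "dual_frames K I \<xi> \<xi>' \<longleftrightarrow>
     is_frame K I \<xi> \<and> is_frame K I \<xi>' \<and>
     (\<forall>\<zeta>\<in>K. ((\<lambda>i. cinner_l2 \<zeta> (\<xi> i) *\<^sub>C \<xi>' i) has_sum \<zeta>) I \<and>
            ((\<lambda>i. cinner_l2 \<zeta> (\<xi>' i) *\<^sub>C \<xi> i) has_sum \<zeta>) I)"

definition biorthogonal_dual_frames ::
    "'a::euclidean_space l2 set \<Rightarrow> 'i set \<Rightarrow> ('i \<Rightarrow> 'a l2) \<Rightarrow> ('i \<Rightarrow> 'a l2) \<Rightarrow> bool" where
  "biorthogonal_dual_frames K I \<xi> \<xi>' \<longleftrightarrow>
     dual_frames K I \<xi> \<xi>' \<and>
     (\<forall>i\<in>I. \<forall>j\<in>I. cinner_l2 (\<xi> i) (\<xi>' j) = (if i = j then 1 else 0))"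

text \<open>
  In the following, only the values of \<open>\<zeta>\<close> and \<open>\<zeta>'\<close> on \<open>{1..d}\<close> matter; \<open>d = 0\<close> gives the
  empty families.
\<close>

definition translates :: "(nat \<Rightarrow> (real ^ 'n) l2) \<Rightarrow> (int ^ 'n) \<times> nat \<Rightarrow> (real ^ 'n) l2" where
  "translates \<zeta> = (\<lambda>(g, i). \<nu> g (\<zeta> i))"

definition dual_G_frames ::
    "(real ^ 'n) l2 set \<Rightarrow> nat \<Rightarrow> (nat \<Rightarrow> (real ^ 'n) l2) \<Rightarrow> (nat \<Rightarrow> (real ^ 'n) l2) \<Rightarrow> bool" where
  "dual_G_frames K d \<zeta> \<zeta>' \<longleftrightarrow>
     dual_frames K (UNIV \<times> {1..d}) (translates \<zeta>) (translates \<zeta>')"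

definition biorthogonal_G_frames ::
    "(real ^ 'n) l2 set \<Rightarrow> nat \<Rightarrow> (nat \<Rightarrow> (real ^ 'n) l2) \<Rightarrow> (nat \<Rightarrow> (real ^ 'n) l2) \<Rightarrow> bool" where
  "biorthogonal_G_frames K d \<zeta> \<zeta>' \<longleftrightarrow>
     biorthogonal_dual_frames K (UNIV \<times> {1..d}) (translates \<zeta>) (translates \<zeta>')"

end

theory Submission
  imports Defs "HOL-Library.Function_Algebras" "HOL-Library.Poly_Mapping"
    "HOL-Computational_Algebra.Fraction_Field"
begin

text \<open>
  Since the \<open>\<zeta>\<^sub>i\<close> and \<open>\<zeta>'\<^sub>j\<close> are compactly supported, \<open>\<langle>\<zeta>\<^sub>i, \<nu>\<^sub>g \<zeta>'\<^sub>j\<rangle>\<close> vanishes for all but finitely many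
  integer vectors \<open>g\<close>. These numbers are therefore the coefficients of a \<open>d \<times> d\<close> matrix \<open>P\<close> over the
  group ring \<open>\<complex>[\<int>\<^sup>n]\<close>, the ring of Laurent polynomials. Duality of the frames says that \<open>P\<close> fixes the
  column of the \<open>\<zeta>\<^sub>i\<close>, and hence that \<open>P\<close> is idempotent. Suppose that \<open>P = B C\<close> with \<open>C B = 1\<close> of size
  \<open>r\<close>. Then \<open>\<eta>\<^sub>k = \<Sum>\<^sub>j C\<^sub>k\<^sub>j \<zeta>\<^sub>j\<close> and \<open>\<eta>'\<^sub>k = \<Sum>\<^sub>j B\<^sub>j\<^sub>k\<^sup>* \<zeta>'\<^sub>j\<close>, where ring elements act by combinations of
  translations, are compactly supported and lie in \<open>K\<close>, and \<open>C P B = 1\<close> says that their translates are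
  bi-orthogonal. They form Bessel families, being finite combinations of translates of frame vectors,
  and \<open>\<zeta>\<^sub>i = \<Sum>\<^sub>k B\<^sub>i\<^sub>k \<eta>\<^sub>k\<close> shows that they span \<open>K\<close>. For bi-orthogonal Bessel families with dense spans the
  frame expansions are trivial on the spans and extend to \<open>K\<close> by boundedness
  (\<open>biorthogonal_dual_framesI\<close>).

  So everything rests on the factorisation of idempotent matrices over the Laurent polynomials
  (\<open>idempotent_splits\<close>): finitely generated projective modules are free. This is Swan's version of the
  theorem of Quillen and Suslin. The proof below has two halves.

  \<^item> Every submodule of a free module of finite rank has a finite free resolution
    (\<open>finite_resolutions_group_ring\<close>). The variables are adjoined one at a time. A module \<open>E\<close> over
    \<open>A[x, x\<^sup>-\<^sup>1]\<close> is generated by its elements \<open>E\<^sub>N\<close> of degree between \<open>0\<close> and \<open>N\<close> when \<open>N\<close> is large, and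
    the relations between these are those that identify \<open>x \<cdot> u\<close> with the shift of \<open>u\<close>; so there is
    an exact sequence \<open>0 \<rightarrow> E\<^sub>N\<^sub>-\<^sub>1[x, x\<^sup>-\<^sup>1] \<rightarrow> E\<^sub>N[x, x\<^sup>-\<^sup>1] \<rightarrow> E \<rightarrow> 0\<close>, in which the two other modules are resolved
    over \<open>A\<close>. A projective module with a finite free resolution is stably free.

  \<^item> Every unimodular vector can be completed to a basis (\<open>unimodular_completable_group_ring\<close>), so that
    free summands can be cancelled one by one. After a generic choice of the distinguished variable
    \<open>x\<close> an entry of the vector is monic in \<open>x\<close> with invertible constant coefficient. Over a local ring
    a monic entry allows a reduction by elementary operations (\<open>local_unimodular_monic\<close>), and
    Vaserstein's argument passes from the localisations to the ring itself
    (\<open>monic_unimodular_equiv_constant\<close>).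

  All rings are subrings of an ambient ring, and all modules are sets of finitely supported sequences
  over it. This makes it possible to speak of localisations and of a growing number of variables
  without changing types.
\<close>

section \<open>Submodules of free modules\<close>

locale subring =
  fixes A :: "'r::comm_ring_1 set"
  assumes zero [simp, intro]: "0 \<in> A" and one [simp, intro]: "1 \<in> A"
    and add [intro]: "a \<in> A \<Longrightarrow> b \<in> A \<Longrightarrow> a + b \<in> A"
    and mult [intro]: "a \<in> A \<Longrightarrow> b \<in> A \<Longrightarrow> a * b \<in> A"
    and uminus [intro]: "a \<in> A \<Longrightarrow> - a \<in> A"
begin

lemma diff [intro]: "a \<in> A \<Longrightarrow> b \<in> A \<Longrightarrow> a - b \<in> A"
  using add[of a "- b"] uminus[of b] by simp

lemma sum_mem [intro]: "(\<And>i. i \<in> I \<Longrightarrow> f i \<in> A) \<Longrightarrow> sum f I \<in> A"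
  by (induction I rule: infinite_finite_induct) auto

lemma power_mem [intro]: "a \<in> A \<Longrightarrow> a ^ n \<in> A"
  by (induction n) auto

end

definition smul :: "'r::comm_ring_1 \<Rightarrow> (nat \<Rightarrow> 'r) \<Rightarrow> nat \<Rightarrow> 'r" (infixr "\<odot>" 75) where
  "c \<odot> v = (\<lambda>i. c * v i)"

lemma smul_apply: "(c \<odot> v) i = c * v i"
  by (simp add: smul_def)

text \<open>
  Pointwise evaluation is kept out of the simplifier, so that vectors are treated as elements of a
  module until their coordinates are needed.
\<close>

lemmas vec_simps = smul_apply plus_fun_apply zero_fun_apply minus_apply uminus_apply
declare plus_fun_apply [simp del] zero_fun_apply [simp del] minus_apply [simp del] uminus_apply [simp del]

lemma smul_simps [simp]:
  "0 \<odot> v = 0" "1 \<odot> v = v" "c \<odot> 0 = 0" "c \<odot> d \<odot> v = (c * d) \<odot> v" "(- 1) \<odot> v = - v"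
  by (auto simp: fun_eq_iff vec_simps mult.assoc)

lemma smul_distribs:
  "c \<odot> (v + w) = c \<odot> v + c \<odot> w" "(c + d) \<odot> v = c \<odot> v + d \<odot> v"
  "c \<odot> (v - w) = c \<odot> v - c \<odot> w" "(c - d) \<odot> v = c \<odot> v - d \<odot> v"
  by (auto simp: fun_eq_iff vec_simps algebra_simps)

lemma sum_apply: "(sum f I) i = (\<Sum>k\<in>I. f k i)" for f :: "'k \<Rightarrow> 'a \<Rightarrow> 'b::comm_monoid_add"
  by (induction I rule: infinite_finite_induct) (auto simp: vec_simps)

lemma smul_sum: "c \<odot> sum f I = (\<Sum>k\<in>I. c \<odot> f k)"
  by (auto simp: fun_eq_iff vec_simps sum_apply sum_distrib_left)

text \<open>The free module \<open>A\<^sup>n\<close>. Vectors are padded with zeros, which gives all of them the same type and makes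
  \<open>A\<^sup>n\<close> a subset of \<open>A\<^sup>n\<^sup>+\<^sup>m\<close>.\<close>

definition free_mod :: "'r::comm_ring_1 set \<Rightarrow> nat \<Rightarrow> (nat \<Rightarrow> 'r) set" where
  "free_mod A n = {v. (\<forall>i<n. v i \<in> A) \<and> (\<forall>i\<ge>n. v i = 0)}"

definition submod :: "'r::comm_ring_1 set \<Rightarrow> (nat \<Rightarrow> 'r) set \<Rightarrow> bool" where
  "submod A M \<longleftrightarrow> 0 \<in> M \<and> (\<forall>x\<in>M. \<forall>y\<in>M. x + y \<in> M) \<and> (\<forall>c\<in>A. \<forall>x\<in>M. c \<odot> x \<in> M)"

definition linear_over :: "'r::comm_ring_1 set \<Rightarrow> (nat \<Rightarrow> 'r) set \<Rightarrow> ((nat \<Rightarrow> 'r) \<Rightarrow> nat \<Rightarrow> 'r) \<Rightarrow> bool" where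
  "linear_over A M f \<longleftrightarrow> (\<forall>x\<in>M. \<forall>y\<in>M. f (x + y) = f x + f y) \<and> (\<forall>c\<in>A. \<forall>x\<in>M. f (c \<odot> x) = c \<odot> f x)"

definition unit_vec :: "nat \<Rightarrow> nat \<Rightarrow> 'r::comm_ring_1" where
  "unit_vec k = (\<lambda>i. if i = k then 1 else 0)"

definition lcomb :: "nat \<Rightarrow> (nat \<Rightarrow> nat \<Rightarrow> 'r::comm_ring_1) \<Rightarrow> (nat \<Rightarrow> 'r) \<Rightarrow> nat \<Rightarrow> 'r" where
  "lcomb n l v = (\<Sum>i<n. v i \<odot> l i)"

lemma submodD:
  assumes "submod A M"
  shows "0 \<in> M" "x \<in> M \<Longrightarrow> y \<in> M \<Longrightarrow> x + y \<in> M" "c \<in> A \<Longrightarrow> x \<in> M \<Longrightarrow> c \<odot> x \<in> M"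
  using assms by (auto simp: submod_def)

lemma submod_sum: "submod A M \<Longrightarrow> (\<And>i. i \<in> I \<Longrightarrow> f i \<in> M) \<Longrightarrow> sum f I \<in> M"
  by (induction I rule: infinite_finite_induct) (auto simp: submodD)

lemma linD:
  assumes "linear_over A M f"
  shows "x \<in> M \<Longrightarrow> y \<in> M \<Longrightarrow> f (x + y) = f x + f y" "c \<in> A \<Longrightarrow> x \<in> M \<Longrightarrow> f (c \<odot> x) = c \<odot> f x"
  using assms by (auto simp: linear_over_def)

lemma lin_subset: "linear_over A M f \<Longrightarrow> N \<subseteq> M \<Longrightarrow> linear_over A N f"
  unfolding linear_over_def by blast

lemma lin_id: "linear_over A M (\<lambda>x. x)"
  by (simp add: linear_over_def)

lemma lin_comp: "linear_over A M f \<Longrightarrow> linear_over A N g \<Longrightarrow> f ` M \<subseteq> N \<Longrightarrow> linear_over A M (\<lambda>x. g (f x))"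
  unfolding linear_over_def by (simp add: image_subset_iff)

lemma lin_add: "linear_over A M f \<Longrightarrow> linear_over A M g \<Longrightarrow> linear_over A M (\<lambda>x. f x + g x)"
  unfolding linear_over_def by (simp add: smul_distribs)

lemma lin_lcomb: "linear_over A M (lcomb n l)"
  by (auto simp: linear_over_def lcomb_def vec_simps smul_distribs sum.distrib smul_sum)

lemma lcomb_mem: "submod A M \<Longrightarrow> (\<And>i. i < n \<Longrightarrow> v i \<in> A) \<Longrightarrow> (\<And>i. i < n \<Longrightarrow> l i \<in> M) \<Longrightarrow> lcomb n l v \<in> M"
  unfolding lcomb_def by (intro submod_sum) (auto simp: submodD)

context subring begin

lemma submod_diff: "submod A M \<Longrightarrow> x \<in> M \<Longrightarrow> y \<in> M \<Longrightarrow> x - y \<in> M"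
  using submodD(2)[of A M x "- y"] submodD(3)[of A M "- 1" y] by auto

lemma minus_one [simp]: "- 1 \<in> A"
  by (rule uminus) simp

lemma lin_diff: "linear_over A M f \<Longrightarrow> submod A M \<Longrightarrow> x \<in> M \<Longrightarrow> y \<in> M \<Longrightarrow> f (x - y) = f x - f y"
  using linD(1)[of A M f x "- y"] linD(2)[of A M f "- 1" y] submodD(3)[of A M "- 1" y] by simp

lemma lin_zero: "linear_over A M f \<Longrightarrow> submod A M \<Longrightarrow> f 0 = 0"
  using linD(2)[of A M f 0 0] submodD(1)[of A M] by simp

lemma submod_free: "submod A (free_mod A n)"
  by (auto simp: submod_def free_mod_def vec_simps)

lemma submod_image: "linear_over A M f \<Longrightarrow> submod A M \<Longrightarrow> submod A (f ` M)"
  unfolding submod_def[of A "f ` M"]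
  by (safe; metis imageI lin_zero linD submodD)

lemma submod_vimage:
  assumes f: "linear_over A M f" and M: "submod A M" and N: "submod A N"
  shows "submod A {x\<in>M. f x \<in> N}"
proof -
  note 1 = linD(1)[OF f] and 2 = linD(2)[OF f]
  show ?thesis
    unfolding submod_def using submodD[OF M] submodD[OF N] lin_zero[OF f M] by (simp add: 1 2)
qed

lemma submod_ker:
  assumes "linear_over A M f" "submod A M"
  shows "submod A {x\<in>M. f x = 0}"
  using submod_vimage[OF assms, of "{0}"] by (simp add: submod_def)

lemma inj_on_ker:
  assumes f: "linear_over A M f" and M: "submod A M" and ker: "\<And>x. x \<in> M \<Longrightarrow> f x = 0 \<Longrightarrow> x = 0"
  shows "inj_on f M"
proof (rule inj_onI)
  fix x y assume *: "x \<in> M" "y \<in> M" "f x = f y"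
  then have "f (x - y) = 0"
    using lin_diff[OF f M, of x y] by simp
  then show "x = y"
    using ker[OF submod_diff[OF M]] * by simp
qed

lemma lin_inv:
  assumes f: "linear_over A M f" and M: "submod A M" and "bij_betw f M N"
  shows "linear_over A N (inv_into M f)"
proof -
  have inj: "inj_on f M" and N: "N = f ` M"
    using assms(3) by (auto simp: bij_betw_def)
  have "inv_into M f (f x + f y) = inv_into M f (f x) + inv_into M f (f y)" if "x \<in> M" "y \<in> M" for x y
    using that inv_into_f_f[OF inj] submodD(2)[OF M] linD(1)[OF f, symmetric] by simp
  moreover have "inv_into M f (c \<odot> f x) = c \<odot> inv_into M f (f x)" if "x \<in> M" "c \<in> A" for x c
    using that inv_into_f_f[OF inj] submodD(3)[OF M] linD(2)[OF f, symmetric] by simp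
  ultimately show ?thesis by (auto simp: linear_over_def N)
qed

lemma unit_vec_free: "k < n \<Longrightarrow> unit_vec k \<in> free_mod A n"
  by (auto simp: free_mod_def unit_vec_def)

lemma free_expand: "v \<in> free_mod A n \<Longrightarrow> v = (\<Sum>i<n. v i \<odot> unit_vec i)"
  by (rule ext) (auto simp: vec_simps sum_apply unit_vec_def free_mod_def if_distrib cong: if_cong)

lemma lin_sum:
  assumes "linear_over A M f" "submod A M" "\<And>i. i \<in> I \<Longrightarrow> c i \<in> A \<and> x i \<in> M"
  shows "f (\<Sum>i\<in>I. c i \<odot> x i) = (\<Sum>i\<in>I. c i \<odot> f (x i))"
  using assms(3)
proof (induction I rule: infinite_finite_induct)
  case (insert i I)
  have "(\<Sum>i\<in>I. c i \<odot> x i) \<in> M"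
    by (intro submod_sum[OF assms(2)] submodD(3)[OF assms(2)]) (use insert in auto)
  moreover have "c i \<odot> x i \<in> M"
    using submodD(3)[OF assms(2)] insert.prems by blast
  moreover have "f (\<Sum>i\<in>I. c i \<odot> x i) = (\<Sum>i\<in>I. c i \<odot> f (x i))"
    using insert.IH insert.prems by blast
  moreover have "f (c i \<odot> x i) = c i \<odot> f (x i)"
    using linD(2)[OF assms(1)] insert.prems by blast
  ultimately show ?case
    using linD(1)[OF assms(1)] insert.hyps by (simp only: sum.insert not_False_eq_True)
qed (use lin_zero[OF assms(1,2)] in simp_all)

lemma lin_free_expand:
  assumes "linear_over A (free_mod A n) f" "v \<in> free_mod A n"
  shows "f v = lcomb n (\<lambda>i. f (unit_vec i)) v"
proof -
  have "f v = f (\<Sum>i<n. v i \<odot> unit_vec i)"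
    using free_expand[OF assms(2)] by simp
  also have "\<dots> = (\<Sum>i<n. v i \<odot> f (unit_vec i))"
    using assms(2) by (intro lin_sum[OF assms(1) submod_free]) (auto simp: free_mod_def unit_vec_def)
  finally show ?thesis by (simp add: lcomb_def)
qed

lemma lcomb_unit_vec: "k < n \<Longrightarrow> lcomb n l (unit_vec k) = l k"
  by (rule ext) (simp add: vec_simps lcomb_def sum_apply unit_vec_def if_distrib[of "\<lambda>c. c * _"] cong: if_cong)

end

section \<open>Finite free resolutions\<close>

text \<open>A free resolution of length \<open>j\<close>, read from the right: a cover by a free module of finite rank whose
  kernel has a resolution of length \<open>j - 1\<close>. Only the zero module has length zero, so length one means
  free. Lengths are upper bounds, by \<open>resolution_Suc\<close>.\<close>

primrec free_resolution :: "'r::comm_ring_1 set \<Rightarrow> nat \<Rightarrow> (nat \<Rightarrow> 'r) set \<Rightarrow> bool" where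
  "free_resolution A 0 M \<longleftrightarrow> M = {0}"
| "free_resolution A (Suc j) M \<longleftrightarrow> (\<exists>n f. linear_over A (free_mod A n) f \<and> f ` free_mod A n = M \<and>
     free_resolution A j {v\<in>free_mod A n. f v = 0})"

definition vtake :: "nat \<Rightarrow> (nat \<Rightarrow> 'r::comm_ring_1) \<Rightarrow> nat \<Rightarrow> 'r" where
  "vtake n v = (\<lambda>i. if i < n then v i else 0)"
definition vdrop :: "nat \<Rightarrow> (nat \<Rightarrow> 'r::comm_ring_1) \<Rightarrow> nat \<Rightarrow> 'r" where
  "vdrop n v = (\<lambda>i. v (i + n))"
definition vshift :: "nat \<Rightarrow> (nat \<Rightarrow> 'r::comm_ring_1) \<Rightarrow> nat \<Rightarrow> 'r" where
  "vshift n v = (\<lambda>i. if i < n then 0 else v (i - n))"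

lemma lin_vtake: "linear_over A M (vtake n)" and lin_vdrop: "linear_over A M (vdrop n)" and lin_vshift: "linear_over A M (vshift n)"
  by (auto simp: linear_over_def vtake_def vdrop_def vshift_def fun_eq_iff vec_simps)

lemma vtake_vshift: "vtake n v + vshift n (vdrop n v) = v"
  by (auto simp: vtake_def vdrop_def vshift_def fun_eq_iff vec_simps)

lemma vdrop_append: "v \<in> free_mod A n \<Longrightarrow> vdrop n (v + vshift n w) = w"
  and vtake_append: "v \<in> free_mod A n \<Longrightarrow> vtake n (v + vshift n w) = v"
  by (auto simp: vtake_def vdrop_def vshift_def fun_eq_iff vec_simps free_mod_def)

context subring begin

lemma vtake_free: "v \<in> free_mod A (n + m) \<Longrightarrow> vtake n v \<in> free_mod A n"
  and vdrop_free: "v \<in> free_mod A (n + m) \<Longrightarrow> vdrop n v \<in> free_mod A m"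
  and vshift_free: "w \<in> free_mod A m \<Longrightarrow> vshift n w \<in> free_mod A (n + m)"
  and free_mono: "v \<in> free_mod A n \<Longrightarrow> v \<in> free_mod A (n + m)"
  by (auto simp: vtake_def vdrop_def vshift_def free_mod_def not_less) (metis not_less zero)

lemma append_free: "v \<in> free_mod A n \<Longrightarrow> w \<in> free_mod A m \<Longrightarrow> v + vshift n w \<in> free_mod A (n + m)"
  by (intro submodD(2)[OF submod_free] free_mono vshift_free)

lemma free_0: "free_mod A 0 = {0}"
  by (auto simp: free_mod_def fun_eq_iff vec_simps)

lemma resolution_Suc: "free_resolution A j M \<Longrightarrow> free_resolution A (Suc j) M"
proof (induction j arbitrary: M)
  case 0
  then have "{v \<in> free_mod A 0. v = 0} = {0}" "(\<lambda>x. x) ` free_mod A 0 = M"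
    by (auto simp: free_0)
  then show ?case
    unfolding free_resolution.simps by (intro exI[of _ 0] exI[of _ "\<lambda>x. x"] conjI lin_id)
next
  case (Suc j)
  then show ?case unfolding free_resolution.simps(2)[of A "Suc j"] free_resolution.simps(2)[of A j M] by blast
qed

lemma resolution_mono: "free_resolution A j M \<Longrightarrow> j \<le> k \<Longrightarrow> free_resolution A k M"
  by (rule lift_Suc_mono_le[of "\<lambda>j. free_resolution A j M", unfolded le_bool_def, THEN mp]) (use resolution_Suc in auto)

lemma resolution_submod: "free_resolution A j M \<Longrightarrow> submod A M"
proof (cases j)
  case (Suc k)
  then show "free_resolution A j M \<Longrightarrow> submod A M"
    using submod_image[OF _ submod_free] by auto
qed (auto simp: submod_def)

lemma resolution_iso:
  assumes "free_resolution A j M" "linear_over A M \<phi>" "bij_betw \<phi> M N"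
  shows "free_resolution A j N"
proof (cases j)
  case 0
  then show ?thesis
    using assms lin_zero[OF assms(2) resolution_submod[OF assms(1)]] by (auto simp: bij_betw_def)
next
  case (Suc k)
  then obtain n f where f: "linear_over A (free_mod A n) f" "f ` free_mod A n = M"
      "free_resolution A k {v\<in>free_mod A n. f v = 0}"
    using assms(1) unfolding Suc free_resolution.simps by blast
  have *: "\<phi> x = 0 \<longleftrightarrow> x = 0" if "x \<in> M" for x
    using that lin_zero[OF assms(2) resolution_submod[OF assms(1)]] submodD(1)[OF resolution_submod[OF assms(1)]]
      inj_onD[of \<phi> M x 0] assms(3) unfolding bij_betw_def by metis
  have "{v\<in>free_mod A n. \<phi> (f v) = 0} = {v\<in>free_mod A n. f v = 0}"
    using f(2) * by auto
  moreover have "linear_over A (free_mod A n) (\<lambda>v. \<phi> (f v))"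
    by (rule lin_comp[OF f(1) assms(2)]) (simp add: f(2))
  moreover have "(\<lambda>v. \<phi> (f v)) ` free_mod A n = N"
    using f(2) assms(3) by (auto simp: bij_betw_def image_image)
  ultimately show ?thesis using f(3) Suc by (auto intro!: exI[of _ n] exI[of _ "\<lambda>v. \<phi> (f v)"])
qed

lemma free_lift:
  assumes "linear_over A (free_mod A n) g" "linear_over A L \<pi>" "submod A L" "g ` free_mod A n \<subseteq> \<pi> ` L"
  obtains h where "linear_over A UNIV h" "\<And>v. v \<in> free_mod A n \<Longrightarrow> h v \<in> L" "\<And>v. v \<in> free_mod A n \<Longrightarrow> \<pi> (h v) = g v"
proof -
  have "\<forall>i\<in>{..<n}. \<exists>l. l \<in> L \<and> \<pi> l = g (unit_vec i)"
    using assms(4) unit_vec_free[of _ n] by force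
  then obtain l where l: "\<And>i. i < n \<Longrightarrow> l i \<in> L \<and> \<pi> (l i) = g (unit_vec i)"
    by (metis lessThan_iff)
  show thesis
  proof
    show "linear_over A UNIV (lcomb n l)" by (rule lin_lcomb)
    fix v assume v: "v \<in> free_mod A n"
    then show "lcomb n l v \<in> L"
      using l assms(3) by (intro lcomb_mem) (auto simp: free_mod_def)
    have "\<pi> (lcomb n l v) = lcomb n (\<lambda>i. \<pi> (l i)) v"
      unfolding lcomb_def using l v by (intro lin_sum[OF assms(2,3)]) (auto simp: free_mod_def)
    also have "\<dots> = g v"
      using l unfolding lin_free_expand[OF assms(1) v] lcomb_def by (intro sum.cong) auto
    finally show "\<pi> (lcomb n l v) = g v" .
  qed
qed

text \<open>The horseshoe lemma: covers of the kernel and of the image combine to a cover of \<open>L\<close>, and the kernel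
  of the combined cover is again an extension, of the kernels of the two covers.\<close>

lemma resolution_extension:
  assumes "linear_over A L \<pi>" "submod A L" "\<pi> ` L = M" "free_resolution A j M" "free_resolution A j {x\<in>L. \<pi> x = 0}"
  shows "free_resolution A j L"
  using assms
proof (induction j arbitrary: L M \<pi>)
  case 0
  have "\<pi> x = 0" if "x \<in> L" for x
    using 0(3,4) that unfolding free_resolution.simps by blast
  then have "{x\<in>L. \<pi> x = 0} = L" by blast
  with 0(5) show ?case by (simp only: free_resolution.simps)
next
  case (Suc j)
  from Suc.prems(5) obtain n f where f: "linear_over A (free_mod A n) f" "f ` free_mod A n = {x\<in>L. \<pi> x = 0}"
      "free_resolution A j {v\<in>free_mod A n. f v = 0}"
    unfolding free_resolution.simps by blast
  from Suc.prems(4) obtain m g where g: "linear_over A (free_mod A m) g" "g ` free_mod A m = M"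
      "free_resolution A j {v\<in>free_mod A m. g v = 0}"
    unfolding free_resolution.simps by blast
  obtain g' where g': "linear_over A UNIV g'" "\<And>v. v \<in> free_mod A m \<Longrightarrow> g' v \<in> L"
      "\<And>v. v \<in> free_mod A m \<Longrightarrow> \<pi> (g' v) = g v"
    by (rule free_lift[OF g(1) Suc.prems(1,2)]) (use g(2) Suc.prems(3) in auto)
  define h where "h v = f (vtake n v) + g' (vdrop n v)" for v
  have fL: "f v \<in> L" "\<pi> (f v) = 0" if "v \<in> free_mod A n" for v
    using f(2) that by blast+
  have linh: "linear_over A (free_mod A (n + m)) h"
    unfolding h_def
    by (intro lin_add lin_comp[OF lin_vtake f(1)] lin_comp[OF lin_vdrop g'(1)]) (auto simp: vtake_free)
  have hL: "h v \<in> L" "\<pi> (h v) = g (vdrop n v)" if "v \<in> free_mod A (n + m)" for v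
  proof -
    note 1 = fL[OF vtake_free[OF that]] and 2 = g'(2,3)[OF vdrop_free[OF that]]
    show "h v \<in> L" unfolding h_def by (rule submodD(2)[OF Suc.prems(2) 1(1) 2(1)])
    show "\<pi> (h v) = g (vdrop n v)"
      unfolding h_def linD(1)[OF Suc.prems(1) 1(1) 2(1)] 1(2) 2(2) by simp
  qed
  have surj: "h ` free_mod A (n + m) = L"
  proof
    show "h ` free_mod A (n + m) \<subseteq> L" using hL by auto
    show "L \<subseteq> h ` free_mod A (n + m)"
    proof
      fix x assume x: "x \<in> L"
      then obtain b where b: "b \<in> free_mod A m" "\<pi> x = g b"
        using Suc.prems(3) g(2) by blast
      have "x - g' b \<in> L" "\<pi> (x - g' b) = 0"
        using b(2) g'(3)[OF b(1)] submod_diff[OF Suc.prems(2) x g'(2)[OF b(1)]]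
          lin_diff[OF Suc.prems(1,2) x g'(2)[OF b(1)]] by simp_all
      then obtain a where a: "a \<in> free_mod A n" "x - g' b = f a"
        using f(2) by blast
      then have "h (a + vshift n b) = x"
        by (simp add: h_def vtake_append[OF a(1)] vdrop_append[OF a(1)] flip: a(2))
      then show "x \<in> h ` free_mod A (n + m)"
        using append_free[OF a(1) b(1)] by blast
    qed
  qed
  let ?N = "{v \<in> free_mod A (n + m). h v = 0}"
  have "free_resolution A j ?N"
  proof (rule Suc.IH)
    show "linear_over A ?N (vdrop n)" by (rule lin_vdrop)
    show "submod A ?N" by (rule submod_ker[OF linh submod_free])
    show "vdrop n ` ?N = {v\<in>free_mod A m. g v = 0}"
    proof (intro equalityI subsetI)
      fix w assume "w \<in> vdrop n ` ?N"
      then obtain v where "v \<in> free_mod A (n + m)" "h v = 0" "w = vdrop n v" by blast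
      then show "w \<in> {v\<in>free_mod A m. g v = 0}"
        using vdrop_free[of v n m] hL(2)[of v] lin_zero[OF Suc.prems(1,2)] by simp
    next
      fix b assume b: "b \<in> {v\<in>free_mod A m. g v = 0}"
      then have "0 - g' b \<in> L" "\<pi> (0 - g' b) = 0"
        using g'(2,3)[of b] submod_diff[OF Suc.prems(2) submodD(1)[OF Suc.prems(2)], of "g' b"]
          lin_diff[OF Suc.prems(1,2) submodD(1)[OF Suc.prems(2)], of "g' b"] lin_zero[OF Suc.prems(1,2)]
        by simp_all
      then obtain a where a: "a \<in> free_mod A n" "0 - g' b = f a"
        using f(2) by blast
      then have "a + vshift n b \<in> ?N"
        using append_free[OF a(1), of b m] b by (simp add: h_def vtake_append[OF a(1)] vdrop_append[OF a(1)] flip: a(2))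
      then show "b \<in> vdrop n ` ?N"
        by (rule rev_image_eqI) (simp add: vdrop_append[OF a(1)])
    qed
    show "free_resolution A j {v\<in>free_mod A m. g v = 0}" by fact
    have "{x \<in> ?N. vdrop n x = 0} = {v\<in>free_mod A n. f v = 0}"
    proof (intro equalityI subsetI)
      fix x assume x: "x \<in> {x \<in> ?N. vdrop n x = 0}"
      then have "vtake n x = x" using vtake_vshift[of n x] linD(2)[OF lin_vshift[of A UNIV n], of 0 0] by simp
      moreover have "g' 0 = 0" using linD(2)[OF g'(1), of 0 0] by simp
      ultimately show "x \<in> {v\<in>free_mod A n. f v = 0}"
        using x vtake_free[of x n m] by (auto simp: h_def)
    next
      fix x assume x: "x \<in> {v\<in>free_mod A n. f v = 0}"
      then have "vtake n x = x" "vdrop n x = 0"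
        by (auto simp: free_mod_def vtake_def vdrop_def fun_eq_iff vec_simps)
      moreover have "g' 0 = 0" using linD(2)[OF g'(1), of 0 0] by simp
      ultimately show "x \<in> {x \<in> ?N. vdrop n x = 0}"
        using x free_mono by (auto simp: h_def)
    qed
    then show "free_resolution A j {x \<in> ?N. vdrop n x = 0}" using f(3) by simp
  qed
  then show ?case using linh surj unfolding free_resolution.simps by blast
qed

text \<open>A cover \<open>p\<close> of \<open>M\<close> is also one of \<open>E\<close>; its kernel over \<open>E\<close> is an extension of the kernel of \<open>\<pi>\<close> by
  the kernel of \<open>p\<close>.\<close>

lemma resolution_quotient:
  assumes "linear_over A M \<pi>" "\<pi> ` M = E" "free_resolution A j M" "free_resolution A j {x\<in>M. \<pi> x = 0}"
  shows "free_resolution A (Suc j) E"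
proof (cases j)
  case 0
  then have "E = {0}"
    using assms lin_zero[OF assms(1) resolution_submod[OF assms(3)]] by auto
  then show ?thesis using resolution_Suc[of 0 E] 0 by simp
next
  case (Suc k)
  then obtain n p where p: "linear_over A (free_mod A n) p" "p ` free_mod A n = M"
      "free_resolution A k {v\<in>free_mod A n. p v = 0}"
    using assms(3) unfolding Suc free_resolution.simps by blast
  let ?L = "{v\<in>free_mod A n. \<pi> (p v) = 0}"
  have lin: "linear_over A (free_mod A n) (\<lambda>v. \<pi> (p v))"
    by (rule lin_comp[OF p(1) assms(1)]) (simp add: p(2))
  have "free_resolution A j ?L"
  proof (rule resolution_extension)
    show "linear_over A ?L p" using p(1) by (rule lin_subset) auto
    show "submod A ?L" by (rule submod_ker[OF lin submod_free])
    show "p ` ?L = {x\<in>M. \<pi> x = 0}" using p(2) by auto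
    have "\<pi> 0 = 0" using lin_zero[OF assms(1) resolution_submod[OF assms(3)]] .
    then have "{x \<in> ?L. p x = 0} = {v\<in>free_mod A n. p v = 0}" by auto
    then show "free_resolution A j {x \<in> ?L. p x = 0}" using p(3) resolution_Suc Suc by simp
  qed fact
  moreover have "(\<lambda>v. \<pi> (p v)) ` free_mod A n = E"
    unfolding assms(2)[symmetric] p(2)[symmetric] by (simp add: image_image)
  ultimately show ?thesis
    using lin unfolding free_resolution.simps by blast
qed

end

section \<open>Projective modules with finite free resolutions\<close>

definition projective :: "'r::comm_ring_1 set \<Rightarrow> (nat \<Rightarrow> 'r) set \<Rightarrow> bool" where
  "projective A E \<longleftrightarrow> (\<exists>m u s. linear_over A (free_mod A m) u \<and> u ` free_mod A m = E \<and> linear_over A E s \<and>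
     s ` E \<subseteq> free_mod A m \<and> (\<forall>x\<in>E. u (s x) = x))"

text \<open>Every unimodular vector of \<open>A\<^sup>b\<close> is the image of the last basis vector under an automorphism. The
  last one is chosen because \<open>A\<^sup>b\<^sup>-\<^sup>1\<close> is spanned by the others.\<close>

definition unimodular_completable :: "'r::comm_ring_1 set \<Rightarrow> bool" where
  "unimodular_completable A \<longleftrightarrow> (\<forall>b v c. v \<in> free_mod A b \<longrightarrow> (\<forall>i<b. c i \<in> A) \<longrightarrow> (\<Sum>i<b. c i * v i) = 1 \<longrightarrow>
     (\<exists>\<theta>. linear_over A (free_mod A b) \<theta> \<and> bij_betw \<theta> (free_mod A b) (free_mod A b) \<and> \<theta> (unit_vec (b - 1)) = v))"

definition finite_resolutions :: "'r::comm_ring_1 set \<Rightarrow> bool" where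
  "finite_resolutions A \<longleftrightarrow> (\<forall>b M. submod A M \<longrightarrow> M \<subseteq> free_mod A b \<longrightarrow> (\<exists>j. free_resolution A j M))"

lemma lin_minus: "linear_over A M f \<Longrightarrow> linear_over A M g \<Longrightarrow> linear_over A M (\<lambda>x. f x - g x)"
  unfolding linear_over_def by (simp add: smul_distribs)

lemma vshift_0 [simp]: "vshift n 0 = 0" and vtake_0 [simp]: "vtake n 0 = 0" and vdrop_0 [simp]: "vdrop n 0 = 0"
  by (auto simp: vshift_def vtake_def vdrop_def fun_eq_iff vec_simps)

context subring begin

lemma projective_submod: "projective A E \<Longrightarrow> submod A E"
proof -
  assume "projective A E"
  then obtain m u where u: "linear_over A (free_mod A m) u" "u ` free_mod A m = E"
    unfolding projective_def by blast
  show "submod A E" using submod_image[OF u(1) submod_free] u(2) by simp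
qed

lemma projective_section:
  assumes "projective A E" "linear_over A (free_mod A n) f" "f ` free_mod A n = E"
  obtains \<sigma> where "linear_over A E \<sigma>" "\<forall>x\<in>E. \<sigma> x \<in> free_mod A n" "\<forall>x\<in>E. f (\<sigma> x) = x"
proof -
  obtain m u s where u: "linear_over A (free_mod A m) u" "u ` free_mod A m = E" and s: "linear_over A E s"
      "s ` E \<subseteq> free_mod A m" and us: "\<forall>x\<in>E. u (s x) = x"
    using assms(1) unfolding projective_def by (elim exE conjE) (rule that)
  obtain h where h: "linear_over A UNIV h" "\<And>v. v \<in> free_mod A m \<Longrightarrow> h v \<in> free_mod A n"
      "\<And>v. v \<in> free_mod A m \<Longrightarrow> f (h v) = u v"
    by (rule free_lift[OF u(1) assms(2) submod_free]) (use u(2) assms(3) in auto)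
  show thesis
  proof
    show "linear_over A E (\<lambda>x. h (s x))" by (rule lin_comp[OF s(1) h(1)]) simp
    have "h (s x) \<in> free_mod A n \<and> f (h (s x)) = x" if "x \<in> E" for x
    proof -
      have "s x \<in> free_mod A m" using that s(2) by blast
      then show ?thesis using h(2,3)[of "s x"] us that by simp
    qed
    then show "\<forall>x\<in>E. h (s x) \<in> free_mod A n" "\<forall>x\<in>E. f (h (s x)) = x" by simp_all
  qed
qed

lemma projective_kernel:
  assumes "projective A E" "linear_over A (free_mod A n) f" "f ` free_mod A n = E"
  shows "projective A {v\<in>free_mod A n. f v = 0}"
proof -
  obtain \<sigma> where \<sigma>: "linear_over A E \<sigma>" "\<forall>x\<in>E. \<sigma> x \<in> free_mod A n" "\<forall>x\<in>E. f (\<sigma> x) = x"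
    by (rule projective_section[OF assms])
  define u where "u v = v - \<sigma> (f v)" for v
  have fE: "f v \<in> E" if "v \<in> free_mod A n" for v using that assms(3) by blast
  have \<sigma>f: "\<sigma> (f v) \<in> free_mod A n" "f (\<sigma> (f v)) = f v" if "v \<in> free_mod A n" for v
    using fE[OF that] \<sigma>(2,3) by simp_all
  have 1: "linear_over A (free_mod A n) u"
    unfolding u_def by (intro lin_minus lin_id lin_comp[OF assms(2) \<sigma>(1)]) (use assms(3) in blast)
  have 2: "u v = v" if "v \<in> {v\<in>free_mod A n. f v = 0}" for v
    using that lin_zero[OF \<sigma>(1) projective_submod[OF assms(1)]] by (simp add: u_def)
  have 3: "u v \<in> {v\<in>free_mod A n. f v = 0}" if "v \<in> free_mod A n" for v
    using \<sigma>f[OF that] submod_diff[OF submod_free that] lin_diff[OF assms(2) submod_free that]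
    by (simp add: u_def)
  have 4: "u ` free_mod A n = {v\<in>free_mod A n. f v = 0}"
  proof
    show "u ` free_mod A n \<subseteq> {v\<in>free_mod A n. f v = 0}" using 3 by blast
    show "{v\<in>free_mod A n. f v = 0} \<subseteq> u ` free_mod A n"
      using 2 by (metis (no_types, lifting) imageI mem_Collect_eq subsetI)
  qed
  show ?thesis
    unfolding projective_def
    by (rule exI[of _ n], rule exI[of _ u], rule exI[of _ "\<lambda>x. x"]) (use 1 2 4 lin_id in auto)
qed

lemma resolution_1_iff: "free_resolution A (Suc 0) M \<longleftrightarrow> (\<exists>n f. linear_over A (free_mod A n) f \<and> bij_betw f (free_mod A n) M)"
proof
  assume "free_resolution A (Suc 0) M"
  then obtain n f where f: "linear_over A (free_mod A n) f" "f ` free_mod A n = M" "{v\<in>free_mod A n. f v = 0} = {0}"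
    unfolding free_resolution.simps by blast
  then have "inj_on f (free_mod A n)"
    by (intro inj_on_ker[OF f(1) submod_free]) blast
  with f show "\<exists>n f. linear_over A (free_mod A n) f \<and> bij_betw f (free_mod A n) M"
    unfolding bij_betw_def by blast
next
  assume "\<exists>n f. linear_over A (free_mod A n) f \<and> bij_betw f (free_mod A n) M"
  then obtain n f where f: "linear_over A (free_mod A n) f" "inj_on f (free_mod A n)" "f ` free_mod A n = M"
    unfolding bij_betw_def by blast
  have "{v\<in>free_mod A n. f v = 0} = {0}"
    using lin_zero[OF f(1) submod_free] submodD(1)[OF submod_free] inj_onD[OF f(2), of _ 0] by auto
  with f show "free_resolution A (Suc 0) M" unfolding free_resolution.simps by blast
qed

lemma resolution_2D:
  assumes "free_resolution A (Suc (Suc 0)) M"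
  obtains a b g h where "linear_over A (free_mod A b) g" "g ` free_mod A b = M"
    "linear_over A (free_mod A a) h" "bij_betw h (free_mod A a) {v\<in>free_mod A b. g v = 0}"
  using assms unfolding free_resolution.simps(2)[of A "Suc 0"] resolution_1_iff by (elim exE conjE) (rule that)

text \<open>Over a projective module each step of a resolution splits, so the kernel is projective as well, and
  a resolution can be shortened from its far end: if \<open>0 \<rightarrow> A\<^sup>a \<rightarrow> A\<^sup>b \<rightarrow> ker f \<rightarrow> 0\<close> is exact, then \<open>A\<^sup>b\<close> is the
  kernel of \<open>A\<^sup>n\<^sup>+\<^sup>a \<rightarrow> A\<^sup>n \<rightarrow> E\<close>.\<close>

lemma projective_stably_free: "projective A E \<Longrightarrow> free_resolution A j E \<Longrightarrow> free_resolution A (Suc (Suc 0)) E"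
proof (induction j arbitrary: E)
  case 0
  then show ?case using resolution_mono by blast
next
  case (Suc j)
  from Suc.prems(2) obtain n f where f: "linear_over A (free_mod A n) f" "f ` free_mod A n = E"
      "free_resolution A j {v\<in>free_mod A n. f v = 0}"
    unfolding free_resolution.simps by blast
  let ?K = "{v\<in>free_mod A n. f v = 0}"
  have K: "projective A ?K" by (rule projective_kernel[OF Suc.prems(1) f(1,2)])
  obtain a b g h where g: "linear_over A (free_mod A b) g" "g ` free_mod A b = ?K"
    and h: "linear_over A (free_mod A a) h" "bij_betw h (free_mod A a) {v\<in>free_mod A b. g v = 0}"
    by (rule resolution_2D[OF Suc.IH[OF K f(3)]])
  obtain s where s': "linear_over A ?K s" "\<forall>x\<in>?K. s x \<in> free_mod A b" "\<forall>x\<in>?K. g (s x) = x"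
    by (rule projective_section[OF K g])
  note s = s'(1) bspec[OF s'(2)] bspec[OF s'(3)]
  define f' where "f' v = f (vtake n v)" for v
  define hi where "hi = inv_into (free_mod A a) h"
  have hi_lin: "linear_over A {v\<in>free_mod A b. g v = 0} hi"
    unfolding hi_def by (rule lin_inv[OF h(1) submod_free h(2)])
  have hi_h: "hi (h y) = y" if "y \<in> free_mod A a" for y
    using that h(2) unfolding hi_def bij_betw_def by simp
  have h_hi: "hi x \<in> free_mod A a" "h (hi x) = x" if "x \<in> free_mod A b" "g x = 0" for x
    using that h(2) inv_into_into[of x h "free_mod A a"] f_inv_into_f[of x h "free_mod A a"]
    unfolding hi_def bij_betw_def by auto
  have hy: "h y \<in> free_mod A b" "g (h y) = 0" if "y \<in> free_mod A a" for y
    using that h(2) unfolding bij_betw_def by blast+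
  \<comment> \<open>the isomorphism of \<open>A\<^sup>b\<close> with \<open>ker f \<oplus> A\<^sup>a\<close> given by the section \<open>s\<close>\<close>
  define \<theta> where "\<theta> w = g w + vshift n (hi (w - s (g w)))" for w
  have gK: "g w \<in> ?K" if "w \<in> free_mod A b" for w using g(2) that by blast
  have ws: "w - s (g w) \<in> free_mod A b" "g (w - s (g w)) = 0" if "w \<in> free_mod A b" for w
    using s(2,3)[OF gK[OF that]] submod_diff[OF submod_free that] lin_diff[OF g(1) submod_free that] by auto
  have \<theta>_lin: "linear_over A (free_mod A b) \<theta>"
    unfolding \<theta>_def
  proof (intro lin_add g(1))
    have "linear_over A (free_mod A b) (\<lambda>w. w - s (g w))"
      by (intro lin_minus lin_id lin_comp[OF g(1) s(1)]) (simp add: g(2))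
    then have "linear_over A (free_mod A b) (\<lambda>w. hi (w - s (g w)))"
      by (rule lin_comp[OF _ hi_lin]) (use ws in blast)
    then show "linear_over A (free_mod A b) (\<lambda>w. vshift n (hi (w - s (g w))))"
      by (rule lin_comp[OF _ lin_vshift[of A UNIV]]) simp
  qed
  let ?N = "{v\<in>free_mod A (n + a). f' v = 0}"
  have tk: "vtake n (\<theta> w) = g w" "vdrop n (\<theta> w) = hi (w - s (g w))" if "w \<in> free_mod A b" for w
    using gK[OF that] unfolding \<theta>_def by (auto simp: vtake_append vdrop_append)
  have s0: "s 0 = 0" by (rule lin_zero[OF s(1) projective_submod[OF K]])
  have "bij_betw \<theta> (free_mod A b) ?N"
    unfolding bij_betw_def
  proof (intro conjI equalityI subsetI)
    show "inj_on \<theta> (free_mod A b)"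
    proof (rule inj_on_ker[OF \<theta>_lin submod_free])
      fix w assume w: "w \<in> free_mod A b" "\<theta> w = 0"
      then have "g w = 0" using tk(1)[OF w(1)] by simp
      then have "hi w = 0" using tk(2)[OF w(1)] w(2) s0 by simp
      then show "w = 0" using h_hi(2)[OF w(1) \<open>g w = 0\<close>] lin_zero[OF h(1) submod_free] by simp
    qed
    fix x assume "x \<in> \<theta> ` free_mod A b"
    then obtain w where w: "w \<in> free_mod A b" "x = \<theta> w" by blast
    have "g w \<in> free_mod A n" "f (g w) = 0" using gK[OF w(1)] by auto
    then show "x \<in> ?N"
      using append_free[of "g w" n "hi (w - s (g w))" a] h_hi(1)[OF ws[OF w(1)]] w
      by (auto simp: f'_def tk(1)[OF w(1)]) (simp add: \<theta>_def)
  next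
    fix v assume v: "v \<in> ?N"
    define k y where "k = vtake n v" and "y = vdrop n v"
    have k: "k \<in> ?K" and y: "y \<in> free_mod A a"
      using v vtake_free[of v n a] vdrop_free[of v n a] by (auto simp: k_def y_def f'_def)
    define w where "w = s k + h y"
    have w: "w \<in> free_mod A b" unfolding w_def
      by (rule submodD(2)[OF submod_free s(2)[OF k] hy(1)[OF y]])
    have "g w = k" unfolding w_def linD(1)[OF g(1) s(2)[OF k] hy(1)[OF y]] hy(2)[OF y] s(3)[OF k] by simp
    then have "\<theta> w = k + vshift n y" by (simp add: \<theta>_def w_def hi_h[OF y])
    then have "\<theta> w = v" by (simp add: k_def y_def vtake_vshift)
    then show "v \<in> \<theta> ` free_mod A b" using w by blast
  qed
  then have "free_resolution A (Suc 0) ?N" using \<theta>_lin resolution_1_iff by blast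
  moreover have "linear_over A (free_mod A (n + a)) f'"
    unfolding f'_def by (rule lin_comp[OF lin_vtake f(1)]) (auto simp: vtake_free)
  moreover have "f' ` free_mod A (n + a) = E"
  proof (intro equalityI subsetI)
    fix x assume "x \<in> f' ` free_mod A (n + a)"
    then show "x \<in> E" using f(2) vtake_free unfolding f'_def by blast
  next
    fix x assume "x \<in> E"
    then obtain v where v: "v \<in> free_mod A n" "x = f v" using f(2) by blast
    then have "vtake n v = v" by (auto simp: vtake_def free_mod_def fun_eq_iff)
    then show "x \<in> f' ` free_mod A (n + a)" using v free_mono[OF v(1)] unfolding f'_def by force
  qed
  ultimately show ?case unfolding free_resolution.simps(2)[of A "Suc 0"] by blast
qed

lemma split_last: "y \<in> free_mod A (Suc n) \<Longrightarrow> y = vtake n y + y n \<odot> unit_vec n"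
  by (auto simp: free_mod_def vtake_def unit_vec_def fun_eq_iff vec_simps)

lemma vtake_free': "y \<in> free_mod A (Suc n) \<Longrightarrow> vtake n y \<in> free_mod A n"
  using vtake_free[of y n 1] by simp

lemma free_Suc: "y \<in> free_mod A n \<Longrightarrow> y \<in> free_mod A (Suc n)"
  using free_mono[of y n 1] by simp

text \<open>In a split sequence \<open>0 \<rightarrow> A\<^sup>a \<rightarrow> A\<^sup>b \<rightarrow> E \<rightarrow> 0\<close> the image of a basis vector of \<open>A\<^sup>a\<close> is unimodular. Moving
  it to a basis vector of \<open>A\<^sup>b\<close> and dividing both modules by it lowers \<open>a\<close> and \<open>b\<close> by one.\<close>

lemma stably_free_cancel:
  assumes A: "unimodular_completable A" and E: "projective A E"
  shows "linear_over A (free_mod A b) g \<Longrightarrow> g ` free_mod A b = E \<Longrightarrow> linear_over A (free_mod A a) h \<Longrightarrow>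
    bij_betw h (free_mod A a) {v\<in>free_mod A b. g v = 0} \<Longrightarrow> free_resolution A (Suc 0) E"
proof (induction a arbitrary: b g h)
  case 0
  have "{v\<in>free_mod A b. g v = 0} = {0}"
    using 0(4) lin_zero[OF 0(3) submod_free] unfolding bij_betw_def free_0 by auto
  then show ?case using 0(1,2) unfolding free_resolution.simps by blast
next
  case (Suc a)
  note g = Suc.prems(1,2) and h = Suc.prems(3,4)
  obtain s where s': "linear_over A E s" "\<forall>x\<in>E. s x \<in> free_mod A b" "\<forall>x\<in>E. g (s x) = x"
    by (rule projective_section[OF E g])
  note s = s'(1) bspec[OF s'(2)] bspec[OF s'(3)]
  define hi where "hi = inv_into (free_mod A (Suc a)) h"
  have hi_lin: "linear_over A {v\<in>free_mod A b. g v = 0} hi"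
    unfolding hi_def by (rule lin_inv[OF h(1) submod_free h(2)])
  have hi_h: "hi (h y) = y" if "y \<in> free_mod A (Suc a)" for y
    using that h(2) unfolding hi_def bij_betw_def by simp
  have h_hi: "hi x \<in> free_mod A (Suc a)" "h (hi x) = x" if "x \<in> free_mod A b" "g x = 0" for x
    using that h(2) inv_into_into[of x h "free_mod A (Suc a)"] f_inv_into_f[of x h "free_mod A (Suc a)"]
    unfolding hi_def bij_betw_def by auto
  have hy: "h y \<in> free_mod A b" "g (h y) = 0" if "y \<in> free_mod A (Suc a)" for y
    using that h(2) unfolding bij_betw_def by blast+
  have gE: "g w \<in> E" if "w \<in> free_mod A b" for w using g(2) that by blast
  have ws: "w - s (g w) \<in> free_mod A b" "g (w - s (g w)) = 0" if "w \<in> free_mod A b" for w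
    using s(2,3)[OF gE[OF that]] submod_diff[OF submod_free that] lin_diff[OF g(1) submod_free that] by auto
  \<comment> \<open>the retraction of \<open>A\<^sup>b\<close> onto \<open>A\<^sup>a\<^sup>+\<^sup>1\<close>; its last coordinate is a linear form with value one at \<open>v\<close>\<close>
  define \<rho> where "\<rho> w = hi (w - s (g w))" for w
  have \<rho>_lin: "linear_over A (free_mod A b) \<rho>"
  proof -
    have "linear_over A (free_mod A b) (\<lambda>w. w - s (g w))"
      by (intro lin_minus lin_id lin_comp[OF g(1) s(1)]) (simp add: g(2))
    then show ?thesis unfolding \<rho>_def
      by (rule lin_comp[OF _ hi_lin]) (use ws in blast)
  qed
  have \<rho>_free: "\<rho> w \<in> free_mod A (Suc a)" if "w \<in> free_mod A b" for w
    unfolding \<rho>_def by (rule h_hi(1)[OF ws[OF that]])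
  define v where "v = h (unit_vec a)"
  have ua: "unit_vec a \<in> free_mod A (Suc a)" by (rule unit_vec_free) simp
  have v: "v \<in> free_mod A b" "g v = 0" unfolding v_def by (rule hy[OF ua])+
  have "s 0 = 0" by (rule lin_zero[OF s(1) projective_submod[OF E]])
  then have "\<rho> v = unit_vec a" using hi_h[OF ua] by (simp add: \<rho>_def v(2)) (simp add: v_def)
  moreover have "\<rho> v a = (\<Sum>i<b. v i * \<rho> (unit_vec i) a)"
    unfolding lin_free_expand[OF \<rho>_lin v(1)] by (simp add: lcomb_def sum_apply vec_simps)
  ultimately have sum1: "(\<Sum>i<b. \<rho> (unit_vec i) a * v i) = 1"
    by (simp add: unit_vec_def mult.commute)
  then have "b \<noteq> 0" by (intro notI) simp
  then obtain b' where b: "b = Suc b'" using not0_implies_Suc by blast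
  have cA: "\<rho> (unit_vec i) a \<in> A" if "i < b" for i
    using \<rho>_free[OF unit_vec_free[OF that]] by (simp add: free_mod_def)
  have "b - 1 = b'" using b by simp
  have "\<exists>\<theta>. linear_over A (free_mod A b) \<theta> \<and> bij_betw \<theta> (free_mod A b) (free_mod A b) \<and> \<theta> (unit_vec (b - 1)) = v"
    by (rule A[unfolded unimodular_completable_def, rule_format, OF v(1) _ sum1]) (rule cA)
  then obtain \<theta> where \<theta>: "linear_over A (free_mod A b) \<theta>" "bij_betw \<theta> (free_mod A b) (free_mod A b)" "\<theta> (unit_vec b') = v"
    unfolding \<open>b - 1 = b'\<close> by (elim exE conjE) (rule that)
  define \<theta>i where "\<theta>i = inv_into (free_mod A b) \<theta>"
  have \<theta>i_lin: "linear_over A (free_mod A b) \<theta>i"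
    unfolding \<theta>i_def by (rule lin_inv[OF \<theta>(1) submod_free \<theta>(2)])
  have \<theta>_free: "\<theta> y \<in> free_mod A b" and \<theta>i_\<theta>: "\<theta>i (\<theta> y) = y" if "y \<in> free_mod A b" for y
    using that \<theta>(2) unfolding \<theta>i_def bij_betw_def by auto
  have \<theta>i_free: "\<theta>i y \<in> free_mod A b" and \<theta>_\<theta>i: "\<theta> (\<theta>i y) = y" if "y \<in> free_mod A b" for y
    using that \<theta>(2) inv_into_into[of y \<theta> "free_mod A b"] f_inv_into_f[of y \<theta> "free_mod A b"]
    unfolding \<theta>i_def bij_betw_def by auto
  have ubb: "unit_vec b' \<in> free_mod A b" unfolding b by (rule unit_vec_free) simp
  have inb: "y \<in> free_mod A b" if "y \<in> free_mod A b'" for y using free_Suc[OF that] b by simp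
  have \<theta>_split: "\<theta> y = \<theta> (vtake b' y) + y b' \<odot> v" and tb: "vtake b' y \<in> free_mod A b'" and yA: "y b' \<in> A"
    if "y \<in> free_mod A b" for y
  proof -
    show tb: "vtake b' y \<in> free_mod A b'" using that vtake_free' unfolding b by blast
    show yA: "y b' \<in> A" using that by (auto simp: free_mod_def b)
    have "\<theta> y = \<theta> (vtake b' y + y b' \<odot> unit_vec b')" using split_last[of y b'] that b by simp
    also have "\<dots> = \<theta> (vtake b' y) + \<theta> (y b' \<odot> unit_vec b')"
      by (rule linD(1)[OF \<theta>(1) inb[OF tb] submodD(3)[OF submod_free yA ubb]])
    also have "\<theta> (y b' \<odot> unit_vec b') = y b' \<odot> v"
      using linD(2)[OF \<theta>(1) yA ubb] \<theta>(3) by simp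
    finally show "\<theta> y = \<theta> (vtake b' y) + y b' \<odot> v" .
  qed
  have g_v: "g (x + t \<odot> v) = g x" if "x \<in> free_mod A b" "t \<in> A" for x t
    using linD(1)[OF g(1) that(1) submodD(3)[OF submod_free that(2) v(1)]] linD(2)[OF g(1) that(2) v(1)] v(2)
    by simp
  define g' where "g' w = g (\<theta> w)" for w
  define h' where "h' z = vtake b' (\<theta>i (h z))" for z
  show ?case
  proof (rule Suc.IH)
    show "linear_over A (free_mod A b') g'"
      unfolding g'_def
      by (rule lin_comp[OF lin_subset[OF \<theta>(1)] g(1)]) (use inb \<theta>_free in auto)
    show "g' ` free_mod A b' = E"
    proof (intro equalityI subsetI)
      fix x assume "x \<in> g' ` free_mod A b'"
      then show "x \<in> E" using gE \<theta>_free inb unfolding g'_def by blast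
    next
      fix x assume "x \<in> E"
      then obtain y where y: "y \<in> free_mod A b" "x = g y" using g(2) by blast
      note yf = \<theta>i_free[OF y(1)]
      have "x = g (\<theta> (\<theta>i y))" using y \<theta>_\<theta>i by simp
      also have "\<dots> = g (\<theta> (vtake b' (\<theta>i y)))"
        using \<theta>_split[OF yf] g_v[OF \<theta>_free[OF inb[OF tb[OF yf]]] yA[OF yf]] by simp
      finally show "x \<in> g' ` free_mod A b'" using tb[OF yf] unfolding g'_def by blast
    qed
    have hf: "z \<in> free_mod A (Suc a)" if "z \<in> free_mod A a" for z using free_Suc[OF that] .
    show h'_lin: "linear_over A (free_mod A a) h'"
    proof -
      have "linear_over A (free_mod A a) (\<lambda>z. \<theta>i (h z))"
        by (rule lin_comp[OF lin_subset[OF h(1)] \<theta>i_lin]) (use hf hy in auto)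
      then show ?thesis unfolding h'_def
        by (rule lin_comp[OF _ lin_vtake[of A UNIV]]) simp
    qed
    have hv: "h (z + t \<odot> unit_vec a) = h z + t \<odot> v" if "z \<in> free_mod A (Suc a)" "t \<in> A" for z t
      using linD(1)[OF h(1) that(1) submodD(3)[OF submod_free that(2) ua]] linD(2)[OF h(1) that(2) ua]
      by (simp add: v_def)
    have key: "h z = \<theta> (h' z) + \<theta>i (h z) b' \<odot> v" "\<theta>i (h z) b' \<in> A" "h' z \<in> free_mod A b'" if "z \<in> free_mod A (Suc a)" for z
      using \<theta>_split[OF \<theta>i_free[OF hy(1)[OF that]]] tb[OF \<theta>i_free[OF hy(1)[OF that]]] yA[OF \<theta>i_free[OF hy(1)[OF that]]] \<theta>_\<theta>i[OF hy(1)[OF that]]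
      unfolding h'_def by simp_all
    show "bij_betw h' (free_mod A a) {v\<in>free_mod A b'. g' v = 0}"
      unfolding bij_betw_def
    proof (intro conjI equalityI subsetI)
      show "inj_on h' (free_mod A a)"
      proof (rule inj_on_ker[OF h'_lin submod_free])
        fix z assume z: "z \<in> free_mod A a" "h' z = 0"
        define t where "t = \<theta>i (h z) b'"
        have t: "t \<in> A" using key(2)[OF hf[OF z(1)]] by (simp add: t_def)
        have "h z = 0 + t \<odot> v"
          using key(1)[OF hf[OF z(1)]] z(2) lin_zero[OF \<theta>(1) submod_free] by (simp add: t_def)
        also have "\<dots> = h (t \<odot> unit_vec a)"
          using linD(2)[OF h(1) t ua] by (simp add: v_def)
        finally have eq: "z = t \<odot> unit_vec a"
          using h(2) hf[OF z(1)] submodD(3)[OF submod_free t ua] unfolding bij_betw_def by (auto dest: inj_onD)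
        have "z a = 0" using z(1) by (simp add: free_mod_def)
        then have "t = 0" unfolding eq by (simp add: unit_vec_def vec_simps)
        then show "z = 0" using eq by simp
      qed
    next
      fix x assume "x \<in> h' ` free_mod A a"
      then obtain z where z: "z \<in> free_mod A a" "x = h' z" by blast
      note k = key[OF hf[OF z(1)]]
      have "g (\<theta> (h' z)) = 0"
        using g_v[OF \<theta>_free[OF inb[OF k(3)]] k(2)] k(1) hy(2)[OF hf[OF z(1)]] by simp
      then show "x \<in> {v\<in>free_mod A b'. g' v = 0}"
        using k(3) z(2) by (simp add: g'_def)
    next
      fix w assume w: "w \<in> {v\<in>free_mod A b'. g' v = 0}"
      then have wb: "w \<in> free_mod A b" and gw: "g (\<theta> w) = 0" using inb by (auto simp: g'_def)
      define y where "y = hi (\<theta> w)"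
      have y: "y \<in> free_mod A (Suc a)" "h y = \<theta> w"
        using h_hi[OF \<theta>_free[OF wb] gw] by (auto simp: y_def)
      have z: "vtake a y \<in> free_mod A a" by (rule vtake_free'[OF y(1)])
      have t: "y a \<in> A" using y(1) by (auto simp: free_mod_def)
      have "\<theta> w = h (vtake a y) + y a \<odot> v"
        using hv[OF hf[OF z] t] split_last[OF y(1)] y(2) by simp
      then have "h (vtake a y) = \<theta> w - y a \<odot> v" by simp
      also have "\<dots> = \<theta> (w - y a \<odot> unit_vec b')"
        using lin_diff[OF \<theta>(1) submod_free wb submodD(3)[OF submod_free t ubb]] linD(2)[OF \<theta>(1) t ubb] \<theta>(3) by simp
      finally have "\<theta>i (h (vtake a y)) = w - y a \<odot> unit_vec b'"
        using \<theta>i_\<theta>[OF submod_diff[OF submod_free wb submodD(3)[OF submod_free t ubb]]] by simp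
      moreover have "vtake b' (w - y a \<odot> unit_vec b') = w"
        using w by (auto simp: vtake_def unit_vec_def free_mod_def fun_eq_iff vec_simps)
      ultimately have "h' (vtake a y) = w" by (simp add: h'_def)
      then show "w \<in> h' ` free_mod A a" using z by blast
    qed
  qed
qed

text \<open>Resolutions make the module stably free, and completability removes the stabilisation.\<close>

theorem projective_free:
  assumes "unimodular_completable A" "finite_resolutions A" "projective A E" "E \<subseteq> free_mod A d"
  obtains r f where "linear_over A (free_mod A r) f" "bij_betw f (free_mod A r) E"
proof -
  obtain j where "free_resolution A j E"
    using assms(2) projective_submod[OF assms(3)] assms(4) unfolding finite_resolutions_def by blast
  then have "free_resolution A (Suc (Suc 0)) E" by (rule projective_stably_free[OF assms(3)])
  then obtain a b g h where "linear_over A (free_mod A b) g" "g ` free_mod A b = E"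
    "linear_over A (free_mod A a) h" "bij_betw h (free_mod A a) {v\<in>free_mod A b. g v = 0}"
    by (rule resolution_2D)
  then have "free_resolution A (Suc 0) E" by (rule stably_free_cancel[OF assms(1,3)])
  then show thesis using that resolution_1_iff by blast
qed

text \<open>Induction on the rank: the projection to the last coordinate has an image of dimension at most one.\<close>

lemma finite_resolutions_field:
  assumes inv: "\<And>a. a \<in> A \<Longrightarrow> a \<noteq> 0 \<Longrightarrow> \<exists>b\<in>A. b * a = 1"
  shows "finite_resolutions A"
  unfolding finite_resolutions_def
proof (intro allI impI)
  fix b M assume "submod A M" "M \<subseteq> free_mod A b"
  then show "\<exists>j. free_resolution A j M"
  proof (induction b arbitrary: M)
    case 0
    then have "M = {0}" using submodD(1)[OF 0(1)] unfolding free_0 by blast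
    then show ?case by (intro exI[of _ 0]) simp
  next
    case (Suc b)
    define \<pi> :: "(nat \<Rightarrow> 'r) \<Rightarrow> nat \<Rightarrow> 'r" where "\<pi> v = v b \<odot> unit_vec 0" for v
    have \<pi>: "linear_over A M \<pi>" by (auto simp: linear_over_def \<pi>_def smul_distribs vec_simps)
    let ?K = "{x\<in>M. \<pi> x = 0}"
    have vb: "v b = 0" if "\<pi> v = 0" for v
      using fun_cong[OF that, of 0] by (simp add: \<pi>_def unit_vec_def vec_simps)
    have "?K \<subseteq> free_mod A b"
    proof
      fix x assume "x \<in> ?K"
      then have "x \<in> free_mod A (Suc b)" "x b = 0" using Suc.prems(2) vb by auto
      then show "x \<in> free_mod A b" by (auto simp: free_mod_def dest: le_imp_less_or_eq)
    qed
    then obtain j where j: "free_resolution A j ?K"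
      using Suc.IH[OF submod_ker[OF \<pi> Suc.prems(1)]] by blast
    have img: "free_resolution A (Suc 0) (\<pi> ` M)"
    proof (cases "\<exists>v\<in>M. v b \<noteq> 0")
      case False
      then have "\<pi> ` M = {0}" using submodD(1)[OF Suc.prems(1)] by (auto simp: \<pi>_def intro!: rev_image_eqI[of 0])
      then show ?thesis by (intro resolution_Suc) simp
    next
      case True
      then obtain v where v: "v \<in> M" "v b \<noteq> 0" by blast
      then have "v b \<in> A" using Suc.prems(2) by (auto simp: free_mod_def)
      then obtain c where c: "c \<in> A" "c * v b = 1" using inv v(2) by blast
      have "\<pi> ` M = free_mod A 1"
      proof (intro equalityI subsetI)
        fix x assume "x \<in> \<pi> ` M"
        then show "x \<in> free_mod A 1"
          using Suc.prems(2) by (auto simp: \<pi>_def free_mod_def unit_vec_def vec_simps)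
      next
        fix x assume x: "x \<in> free_mod A 1"
        then have "x 0 \<in> A" by (auto simp: free_mod_def)
        then have "(x 0 * c) \<odot> v \<in> M" using submodD(3)[OF Suc.prems(1) _ v(1)] c(1) mult by blast
        moreover have "\<pi> ((x 0 * c) \<odot> v) = x"
          using x c(2) by (auto simp: \<pi>_def free_mod_def unit_vec_def vec_simps fun_eq_iff mult.assoc)
        ultimately show "x \<in> \<pi> ` M" by force
      qed
      moreover have "bij_betw (\<lambda>x. x) (free_mod A 1) (free_mod A 1)"
        by (simp add: bij_betw_def)
      ultimately show ?thesis unfolding resolution_1_iff using lin_id[of A "free_mod A 1"] by auto
    qed
    have "free_resolution A (max j (Suc 0)) (\<pi> ` M)" by (rule resolution_mono[OF img]) simp
    moreover have "free_resolution A (max j (Suc 0)) ?K" by (rule resolution_mono[OF j]) simp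
    ultimately show ?case using resolution_extension[OF \<pi> Suc.prems(1) refl] by blast
  qed
qed

end

section \<open>Resolutions over Laurent polynomial rings\<close>

lemma finite_int_bound: "finite S \<Longrightarrow> \<exists>T. \<forall>t\<in>S. \<bar>t::int\<bar> \<le> T"
  by (rule exI[of _ "Max (insert 0 (abs ` S))"]) auto

text \<open>The ring \<open>R\<close> of Laurent polynomials over \<open>A\<close> in a variable whose \<open>i\<close>-th power is \<open>X i\<close>; the
  coefficient of degree \<open>i\<close> of \<open>r\<close> is \<open>co r i\<close>.\<close>

locale laurent = A: subring A + R: subring R for A R :: "'r::comm_ring_1 set" +
  fixes X :: "int \<Rightarrow> 'r" and co :: "'r \<Rightarrow> int \<Rightarrow> 'r"
  assumes A_R: "A \<subseteq> R" and X_R: "X i \<in> R" and X_add: "X (i + j) = X i * X j" and X_0: "X 0 = 1"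
    and co_mem: "r \<in> R \<Longrightarrow> co r i \<in> A" and co_fin: "r \<in> R \<Longrightarrow> finite {i. co r i \<noteq> 0}"
    and co_add: "r \<in> R \<Longrightarrow> s \<in> R \<Longrightarrow> co (r + s) i = co r i + co s i"
    and co_mon: "a \<in> A \<Longrightarrow> co (a * X i) j = (if i = j then a else 0)"
    and co_sum: "r \<in> R \<Longrightarrow> r = (\<Sum>i | co r i \<noteq> 0. co r i * X i)"
begin

lemma AR: "a \<in> A \<Longrightarrow> a \<in> R" using A_R by blast

lemma co_A: "a \<in> A \<Longrightarrow> co a j = (if j = 0 then a else 0)"
  using co_mon[of a 0 j] by (auto simp: X_0)

lemma co_0 [simp]: "co 0 j = 0"
  using co_A[of 0] by simp

lemma co_sum_fun: "(\<And>k. k \<in> S \<Longrightarrow> f k \<in> R) \<Longrightarrow> co (sum f S) i = (\<Sum>k\<in>S. co (f k) i)"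
  by (induction S rule: infinite_finite_induct) (auto simp: co_add R.sum_mem)

lemma co_sum': "r \<in> R \<Longrightarrow> finite S \<Longrightarrow> (\<And>i. i \<notin> S \<Longrightarrow> co r i = 0) \<Longrightarrow> r = (\<Sum>i\<in>S. co r i * X i)"
  by (subst co_sum, assumption) (rule sum.mono_neutral_left, auto)

lemma co_eqI: "r \<in> R \<Longrightarrow> s \<in> R \<Longrightarrow> (\<And>i. co r i = co s i) \<Longrightarrow> r = s"
  using co_sum[of r] co_sum[of s] by simp

lemma co_poly:
  assumes "finite S" "\<And>i. i \<in> S \<Longrightarrow> a i \<in> A"
  shows "co (\<Sum>i\<in>S. a i * X i) j = (if j \<in> S then a j else 0)"
proof -
  have "co (\<Sum>i\<in>S. a i * X i) j = (\<Sum>i\<in>S. if i = j then a i else 0)"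
    using assms by (subst co_sum_fun) (auto simp: AR X_R co_mon intro!: sum.cong)
  then show ?thesis using assms(1) by simp
qed

lemma co_mult:
  assumes "a \<in> A" "r \<in> R"
  shows "co (a * (X k * r)) j = a * co r (j - k)"
proof -
  let ?S = "{i. co r i \<noteq> 0}"
  have "a * (X k * r) = (\<Sum>i\<in>?S. a * (X k * (co r i * X i)))"
    by (subst co_sum[OF assms(2)]) (simp add: sum_distrib_left)
  also have "\<dots> = (\<Sum>i\<in>(\<lambda>i. i + k) ` ?S. (a * co r (i - k)) * X i)"
    by (subst sum.reindex) (auto simp: X_add algebra_simps)
  finally have "co (a * (X k * r)) j = (if j \<in> (\<lambda>i. i + k) ` ?S then a * co r (j - k) else 0)"
    using assms co_fin[OF assms(2)] by (subst co_poly[symmetric]) (auto simp: co_mem A.mult)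
  also have "j \<in> (\<lambda>i. i + k) ` ?S \<longleftrightarrow> co r (j - k) \<noteq> 0"
    by (auto intro!: image_eqI[of _ _ "j - k"])
  finally show ?thesis by auto
qed

lemma co_scale: "a \<in> A \<Longrightarrow> r \<in> R \<Longrightarrow> co (a * r) j = a * co r j"
  using co_mult[of a r 0 j] by (simp add: X_0)

lemma X_inv: "X (- i) * X i = 1" "X i * X (- i) = 1"
  using X_add[of "- i" i] X_add[of i "- i"] X_0 by simp_all

lemma X_cancel [simp]: "X (- i) * (X i * r) = r" "X i * (X (- i) * r) = r"
  using X_inv[of i] by (simp_all flip: mult.assoc)

definition coeff_vec :: "(nat \<Rightarrow> 'r) \<Rightarrow> int \<Rightarrow> nat \<Rightarrow> 'r" where
  "coeff_vec v t = (\<lambda>i. co (v i) t)"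

text \<open>The module \<open>M[x, x\<^sup>-\<^sup>1]\<close> inside \<open>R\<^sup>c\<close>: all coefficient vectors belong to \<open>M\<close>.\<close>

definition base_ext :: "nat \<Rightarrow> (nat \<Rightarrow> 'r) set \<Rightarrow> (nat \<Rightarrow> 'r) set" where
  "base_ext c M = {v\<in>free_mod R c. \<forall>t. coeff_vec v t \<in> M}"

lemma free_R: "v \<in> free_mod R c \<Longrightarrow> v i \<in> R"
  by (cases "i < c") (auto simp: free_mod_def)

lemma free_A: "v \<in> free_mod A c \<Longrightarrow> v i \<in> A"
  by (cases "i < c") (auto simp: free_mod_def)

lemma free_AR: "v \<in> free_mod A c \<Longrightarrow> v \<in> free_mod R c"
  by (auto simp: free_mod_def AR)

lemma cov_free: "v \<in> free_mod R c \<Longrightarrow> coeff_vec v t \<in> free_mod A c"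
  by (auto simp: free_mod_def coeff_vec_def co_mem)

lemma cov_0 [simp]: "coeff_vec 0 t = 0"
  by (auto simp: coeff_vec_def fun_eq_iff vec_simps)

lemma cov_add: "v \<in> free_mod R c \<Longrightarrow> w \<in> free_mod R c \<Longrightarrow> coeff_vec (v + w) t = coeff_vec v t + coeff_vec w t"
  by (auto simp: coeff_vec_def fun_eq_iff vec_simps co_add free_R)

lemma cov_mult: "v \<in> free_mod R c \<Longrightarrow> a \<in> A \<Longrightarrow> coeff_vec ((a * X k) \<odot> v) t = a \<odot> coeff_vec v (t - k)"
  by (auto simp: coeff_vec_def fun_eq_iff vec_simps co_mult free_R mult.assoc)

lemma cov_scale: "v \<in> free_mod R c \<Longrightarrow> a \<in> A \<Longrightarrow> coeff_vec (a \<odot> v) t = a \<odot> coeff_vec v t"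
  using cov_mult[of v c a 0 t] by (simp add: X_0)

lemma cov_X: "v \<in> free_mod R c \<Longrightarrow> coeff_vec (X k \<odot> v) t = coeff_vec v (t - k)"
  using cov_mult[of v c 1 k t] by simp

lemma cov_diff: "v \<in> free_mod R c \<Longrightarrow> w \<in> free_mod R c \<Longrightarrow> coeff_vec (v - w) t = coeff_vec v t - coeff_vec w t"
  using cov_add[of v c "- w" t] cov_scale[of w c "- 1" t] submodD(3)[OF R.submod_free, of "- 1" w c]
  by simp

lemma cov_A: "v \<in> free_mod A c \<Longrightarrow> coeff_vec v t = (if t = 0 then v else 0)"
  by (auto simp: coeff_vec_def fun_eq_iff vec_simps co_A free_A)

lemma cov_sum: "(\<And>k. k \<in> S \<Longrightarrow> f k \<in> free_mod R c) \<Longrightarrow> coeff_vec (sum f S) t = (\<Sum>k\<in>S. coeff_vec (f k) t)"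
proof (induction S rule: infinite_finite_induct)
  case (insert x F)
  then show ?case
    using cov_add[of "f x" c "sum f F" t] submod_sum[OF R.submod_free, of F f c] by simp
qed simp_all

lemma cov_fin: "v \<in> free_mod R c \<Longrightarrow> finite {t. coeff_vec v t \<noteq> 0}"
proof -
  assume v: "v \<in> free_mod R c"
  have "{t. coeff_vec v t \<noteq> 0} \<subseteq> (\<Union>i<c. {t. co (v i) t \<noteq> 0})"
  proof
    fix t assume "t \<in> {t. coeff_vec v t \<noteq> 0}"
    then obtain i where i: "co (v i) t \<noteq> 0" by (auto simp: coeff_vec_def fun_eq_iff vec_simps)
    then have "i < c" using v by (rule_tac ccontr) (simp add: free_mod_def)
    then show "t \<in> (\<Union>i<c. {t. co (v i) t \<noteq> 0})" using i by auto
  qed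
  then show ?thesis by (rule finite_subset) (auto intro: co_fin free_R[OF v])
qed

lemma cov_expand: "v \<in> free_mod R c \<Longrightarrow> finite T \<Longrightarrow> (\<And>t. t \<notin> T \<Longrightarrow> coeff_vec v t = 0) \<Longrightarrow> v = (\<Sum>t\<in>T. X t \<odot> coeff_vec v t)"
proof (rule ext)
  fix i assume v: "v \<in> free_mod R c" and T: "finite T" "\<And>t. t \<notin> T \<Longrightarrow> coeff_vec v t = 0"
  have "co (v i) t = 0" if "t \<notin> T" for t
    using fun_cong[OF T(2)[OF that], of i] by (simp add: coeff_vec_def vec_simps)
  then show "v i = (\<Sum>t\<in>T. X t \<odot> coeff_vec v t) i"
    using co_sum'[OF free_R[OF v] T(1), of i] by (simp add: sum_apply coeff_vec_def vec_simps mult.commute)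
qed

lemma cov_eqI:
  assumes "v \<in> free_mod R c" "w \<in> free_mod R c" "\<And>t. coeff_vec v t = coeff_vec w t"
  shows "v = w"
proof (rule ext)
  fix i
  have "co (v i) t = co (w i) t" for t
    using fun_cong[OF assms(3)[of t], of i] by (simp add: coeff_vec_def)
  then show "v i = w i" by (rule co_eqI[OF free_R[OF assms(1)] free_R[OF assms(2)]])
qed

lemma submod_A: "submod R M \<Longrightarrow> submod A M"
  by (auto simp: submod_def AR)

lemma submod_base_ext:
  assumes "submod A M"
  shows "submod R (base_ext c M)"
  unfolding submod_def
proof (intro conjI ballI)
  show "0 \<in> base_ext c M" using submodD(1)[OF assms] submodD(1)[OF R.submod_free] by (simp add: base_ext_def)
  show 1: "x + y \<in> base_ext c M" if "x \<in> base_ext c M" "y \<in> base_ext c M" for x y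
    using that submodD(2)[OF assms] submodD(2)[OF R.submod_free] by (auto simp: base_ext_def cov_add)
  fix r x assume r: "r \<in> R" and x: "x \<in> base_ext c M"
  then have xf: "x \<in> free_mod R c" and xM: "coeff_vec x t \<in> M" for t by (auto simp: base_ext_def)
  let ?S = "{i. co r i \<noteq> 0}"
  have *: "r \<odot> x = (\<Sum>k\<in>?S. (co r k * X k) \<odot> x)"
    by (rule ext, subst co_sum[OF r]) (simp add: sum_apply vec_simps sum_distrib_right)
  have "coeff_vec (r \<odot> x) t = (\<Sum>k\<in>?S. co r k \<odot> coeff_vec x (t - k))" for t
    unfolding * using r xf
    by (subst cov_sum[of _ _ c]) (auto simp: cov_mult co_mem AR X_R R.mult intro!: submodD(3)[OF R.submod_free])
  moreover have "(\<Sum>k\<in>?S. co r k \<odot> coeff_vec x (t - k)) \<in> M" for t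
    using r xM by (intro submod_sum[OF assms] submodD(3)[OF assms]) (auto simp: co_mem)
  ultimately show "r \<odot> x \<in> base_ext c M"
    using submodD(3)[OF R.submod_free r xf] by (simp add: base_ext_def)
qed

lemma lcomb_free: "(\<And>i. i < n \<Longrightarrow> v i \<in> R) \<Longrightarrow> (\<And>i. i < n \<Longrightarrow> l i \<in> free_mod R c) \<Longrightarrow> lcomb n l v \<in> free_mod R c"
  by (rule lcomb_mem[OF R.submod_free])

lemma cov_lcomb:
  assumes "v \<in> free_mod R n" "\<And>i. i < n \<Longrightarrow> l i \<in> free_mod A c"
  shows "coeff_vec (lcomb n l v) t = lcomb n l (coeff_vec v t)"
proof
  fix j
  have vR: "v i \<in> R" for i by (rule free_R[OF assms(1)])
  have lA: "l i j \<in> A" if "i < n" for i by (rule free_A[OF assms(2)[OF that]])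
  have "co (v i * l i j) t = l i j * co (v i) t" if "i < n" for i
    using co_scale[OF lA[OF that] vR[of i], of t] by (simp add: mult.commute)
  then have "co (\<Sum>i<n. v i * l i j) t = (\<Sum>i<n. l i j * co (v i) t)"
    by (subst co_sum_fun) (auto intro: R.mult vR AR lA)
  then show "coeff_vec (lcomb n l v) t j = lcomb n l (coeff_vec v t) j"
    by (simp add: coeff_vec_def lcomb_def sum_apply vec_simps mult.commute)
qed

text \<open>Base change along \<open>A \<subseteq> R\<close> keeps resolutions exact, since everything happens degree by degree.\<close>

lemma resolution_base_ext: "free_resolution A l M \<Longrightarrow> M \<subseteq> free_mod A c \<Longrightarrow> free_resolution R l (base_ext c M)"
proof (induction l arbitrary: M c)
  case 0
  then have M: "M = {0}" by simp
  have "v = 0" if "v \<in> base_ext c M" for v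
    using that submodD(1)[OF R.submod_free] by (intro cov_eqI[of v c]) (auto simp: base_ext_def M)
  moreover have "0 \<in> base_ext c M" using submodD(1)[OF R.submod_free] by (simp add: base_ext_def M)
  ultimately show ?case by auto
next
  case (Suc l)
  from Suc.prems(1) obtain n f where f: "linear_over A (free_mod A n) f" "f ` free_mod A n = M"
      "free_resolution A l {v\<in>free_mod A n. f v = 0}"
    unfolding free_resolution.simps by blast
  define F where "F = lcomb n (\<lambda>i. f (unit_vec i))"
  have fub: "f (unit_vec i) \<in> free_mod A c" if "i < n" for i
    using f(2) Suc.prems(2) A.unit_vec_free[OF that] by blast
  have Ff: "F v = f v" if "v \<in> free_mod A n" for v
    unfolding F_def by (rule A.lin_free_expand[OF f(1) that, symmetric])
  have F_free: "F v \<in> free_mod R c" if "v \<in> free_mod R n" for v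
    unfolding F_def by (rule lcomb_free) (use free_R[OF that] free_AR[OF fub] in auto)
  have cov_F: "coeff_vec (F v) t = f (coeff_vec v t)" if "v \<in> free_mod R n" for v t
    using cov_lcomb[OF that, of "\<lambda>i. f (unit_vec i)" c t] fub A.lin_free_expand[OF f(1) cov_free[OF that], of t]
    unfolding F_def by simp
  have F_lin: "linear_over R UNIV F" unfolding F_def by (rule lin_lcomb)
  have "F ` free_mod R n = base_ext c M"
  proof (intro equalityI subsetI)
    fix x assume "x \<in> F ` free_mod R n"
    then obtain v where v: "v \<in> free_mod R n" "x = F v" by blast
    have "f (coeff_vec v t) \<in> M" for t using cov_free[OF v(1)] f(2) by blast
    then show "x \<in> base_ext c M" using v F_free[OF v(1)] by (simp add: base_ext_def cov_F)
  next
    fix w assume w: "w \<in> base_ext c M"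
    then have wf: "w \<in> free_mod R c" by (simp add: base_ext_def)
    have img: "coeff_vec w t \<in> f ` free_mod A n" for t
      using w f(2) by (simp add: base_ext_def)
    define a where "a t = inv_into (free_mod A n) f (coeff_vec w t)" for t
    have a: "a t \<in> free_mod A n" "f (a t) = coeff_vec w t" for t
      unfolding a_def by (rule inv_into_into[OF img], rule f_inv_into_f[OF img])
    let ?T = "{t. coeff_vec w t \<noteq> 0}"
    define v where "v = (\<Sum>t\<in>?T. X t \<odot> a t)"
    have "v \<in> free_mod R n" unfolding v_def
      by (intro submod_sum[OF R.submod_free] submodD(3)[OF R.submod_free] X_R free_AR a)
    moreover have "F v = w"
    proof -
      have "F v = (\<Sum>t\<in>?T. X t \<odot> F (a t))"
        unfolding v_def by (rule R.lin_sum[OF F_lin]) (auto simp: submod_def X_R)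
      also have "\<dots> = (\<Sum>t\<in>?T. X t \<odot> coeff_vec w t)" by (simp add: Ff[OF a(1)] a(2))
      also have "\<dots> = w" by (rule cov_expand[OF wf cov_fin[OF wf], symmetric]) simp
      finally show ?thesis .
    qed
    ultimately show "w \<in> F ` free_mod R n" by blast
  qed
  moreover have "{v\<in>free_mod R n. F v = 0} = base_ext n {v\<in>free_mod A n. f v = 0}"
  proof (intro equalityI subsetI)
    fix v assume "v \<in> {v\<in>free_mod R n. F v = 0}"
    then have v: "v \<in> free_mod R n" "F v = 0" by auto
    have "f (coeff_vec v t) = 0" for t using cov_F[OF v(1), of t] v(2) by simp
    then show "v \<in> base_ext n {v\<in>free_mod A n. f v = 0}" using v(1) cov_free[OF v(1)] by (simp add: base_ext_def)
  next
    fix v assume "v \<in> base_ext n {v\<in>free_mod A n. f v = 0}"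
    then have v: "v \<in> free_mod R n" "\<And>t. f (coeff_vec v t) = 0" by (auto simp: base_ext_def)
    have "F v = 0"
      by (rule cov_eqI[OF F_free[OF v(1)] submodD(1)[OF R.submod_free]]) (simp add: cov_F[OF v(1)] v(2))
    then show "v \<in> {v\<in>free_mod R n. F v = 0}" using v(1) by simp
  qed
  moreover have "free_resolution R l (base_ext n {v\<in>free_mod A n. f v = 0})"
    by (rule Suc.IH[OF f(3)]) blast
  moreover have "linear_over R (free_mod R n) F" by (rule lin_subset[OF F_lin]) simp
  ultimately show ?case unfolding free_resolution.simps by (intro exI[of _ n] exI[of _ F] conjI) simp_all
qed


text \<open>A vector over \<open>A\<close> of length \<open>N b\<close> stores \<open>N\<close> vectors \<open>w\<^sub>0, \<dots>, w\<^sub>N\<^sub>-\<^sub>1\<close> of length \<open>b\<close> one after the other; it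
  represents the vector \<open>\<Sum>\<^sub>j w\<^sub>j x\<^sup>j\<close> over \<open>R\<close>.\<close>

definition eval_slots :: "nat \<Rightarrow> nat \<Rightarrow> (nat \<Rightarrow> 'r) \<Rightarrow> nat \<Rightarrow> 'r" where
  "eval_slots b N w = (\<lambda>i. if i < b then \<Sum>j<N. X (int j) * w (j * b + i) else 0)"

lemma lin_ev: "linear_over S M (eval_slots b N)"
  by (auto simp: linear_over_def eval_slots_def fun_eq_iff vec_simps algebra_simps sum.distrib sum_distrib_left)

lemma ev_diff: "eval_slots b N (v - w) = eval_slots b N v - eval_slots b N w"
  by (auto simp: eval_slots_def fun_eq_iff vec_simps algebra_simps sum_subtractf)

lemma ev_X: "eval_slots b N (X k \<odot> v) = X k \<odot> eval_slots b N v"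
  by (auto simp: eval_slots_def fun_eq_iff vec_simps algebra_simps sum_distrib_left)

lemma ev_0 [simp]: "eval_slots b N 0 = 0"
  by (auto simp: eval_slots_def fun_eq_iff vec_simps)

lemma slot_less: "j < N \<Longrightarrow> i < b \<Longrightarrow> j * b + i < N * (b::nat)"
  using mult_le_mono1[of "Suc j" N b] by simp

lemma ev_shift: "eval_slots b (Suc n) (vshift b u) = X 1 \<odot> eval_slots b n u"
proof
  fix i
  have X1: "X (int (Suc j)) = X 1 * X (int j)" for j
    using X_add[of 1 "int j"] by simp
  show "eval_slots b (Suc n) (vshift b u) i = (X 1 \<odot> eval_slots b n u) i"
  proof (cases "i < b")
    case True
    have "(\<Sum>j<Suc n. X (int j) * vshift b u (j * b + i)) =
        X (int 0) * vshift b u (0 * b + i) + (\<Sum>j<n. X (int (Suc j)) * vshift b u (Suc j * b + i))"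
      by (rule sum.lessThan_Suc_shift)
    also have "\<dots> = X 1 * (\<Sum>j<n. X (int j) * u (j * b + i))"
      unfolding X1 using True by (simp add: vshift_def sum_distrib_left mult.assoc)
    finally show ?thesis using True by (simp add: eval_slots_def smul_apply)
  qed (simp add: eval_slots_def smul_apply)
qed

lemma ev_last: "u \<in> free_mod R (n * b) \<Longrightarrow> eval_slots b (Suc n) u = eval_slots b n u"
  by (auto simp: eval_slots_def free_mod_def fun_eq_iff)

lemma ev_cov:
  assumes "v \<in> free_mod R (N * b)"
  shows "eval_slots b N v = (\<Sum>t | coeff_vec v t \<noteq> 0. X t \<odot> eval_slots b N (coeff_vec v t))"
proof -
  have "eval_slots b N v = eval_slots b N (\<Sum>t | coeff_vec v t \<noteq> 0. X t \<odot> coeff_vec v t)"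
    using cov_expand[OF assms cov_fin[OF assms]] by simp
  also have "\<dots> = (\<Sum>t | coeff_vec v t \<noteq> 0. X t \<odot> eval_slots b N (coeff_vec v t))"
    by (rule R.lin_sum[OF lin_ev[of R UNIV]]) (auto simp: submod_def X_R)
  finally show ?thesis .
qed

text \<open>The elements of \<open>E\<close> with degrees in \<open>0, \<dots>, N - 1\<close>, as a module over \<open>A\<close>.\<close>

definition slice :: "nat \<Rightarrow> (nat \<Rightarrow> 'r) set \<Rightarrow> nat \<Rightarrow> (nat \<Rightarrow> 'r) set" where
  "slice b E N = {w\<in>free_mod A (N * b). eval_slots b N w \<in> E}"

lemma submod_slice: "submod R E \<Longrightarrow> submod A (slice b E N)"
  unfolding slice_def by (intro A.submod_vimage lin_ev A.submod_free submod_A)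

text \<open>Let \<open>T\<close> shift the slots. Evaluating the slots is the substitution \<open>T = x\<close>, whose kernel consists of the
multiples of \<open>T - x\<close>; the quotient is found by solving the recursion for its coefficients degree by degree.\<close>

lemma slice_relations:
  fixes n :: nat
  assumes E: "submod R E" and b: "b > 0"
  defines "Z \<equiv> {v \<in> base_ext (Suc n * b) (slice b E (Suc n)). eval_slots b (Suc n) v = 0}"
  shows "bij_betw (\<lambda>u. vshift b u - X 1 \<odot> u) (base_ext (n * b) (slice b E n)) Z"
  unfolding bij_betw_def
proof (intro conjI equalityI subsetI)
  let ?\<Psi> = "\<lambda>u. vshift b u - X 1 \<odot> u"
  let ?D = "base_ext (n * b) (slice b E n)"
  have nb: "n * b + b = Suc n * b" "b + n * b = Suc n * b" by simp_all
  have sD: "submod R ?D" by (rule submod_base_ext[OF submod_slice[OF E]])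
  have lin: "linear_over R ?D ?\<Psi>"
    by (intro lin_minus lin_vshift) (simp add: linear_over_def smul_distribs mult.commute)
  have up: "u \<in> free_mod R (Suc n * b)" "vshift b u \<in> free_mod R (Suc n * b)" if "u \<in> free_mod R (n * b)" for u
    using R.free_mono[OF that, of b] R.vshift_free[OF that, of b] unfolding nb by blast+
  have upA: "u \<in> free_mod A (Suc n * b)" "vshift b u \<in> free_mod A (Suc n * b)" if "u \<in> free_mod A (n * b)" for u
    using A.free_mono[OF that, of b] A.vshift_free[OF that, of b] unfolding nb by blast+
  have \<Psi>_free: "?\<Psi> u \<in> free_mod R (Suc n * b)" if "u \<in> free_mod R (n * b)" for u
    by (intro R.submod_diff[OF R.submod_free] submodD(3)[OF R.submod_free] X_R up that)
  have cov_shift: "coeff_vec (vshift b u) t = vshift b (coeff_vec u t)" for u t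
    by (auto simp: coeff_vec_def vshift_def fun_eq_iff)
  have cov_\<Psi>: "coeff_vec (?\<Psi> u) t = vshift b (coeff_vec u t) - coeff_vec u (t - 1)" if "u \<in> free_mod R (n * b)" for u t
    using cov_diff[OF up(2)[OF that] submodD(3)[OF R.submod_free X_R up(1)[OF that]], where t = t] cov_X[OF that, of 1 t]
    by (simp add: cov_shift)
  have ev_\<Psi>: "eval_slots b (Suc n) (vshift b u - w) = X 1 \<odot> eval_slots b n u - eval_slots b n w" if "w \<in> free_mod R (n * b)" for u w
    by (simp add: ev_diff ev_shift ev_last[OF that])
  show "inj_on ?\<Psi> ?D"
  proof (rule R.inj_on_ker[OF lin sD])
    fix u assume "u \<in> ?D" and "?\<Psi> u = 0"
    then have "X 1 \<odot> u = vshift b u" by simp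
    from fun_cong[OF this] have eq: "X 1 * u p = (if p < b then 0 else u (p - b))" for p
      by (simp add: vshift_def smul_apply)
    have "u p = 0" for p
    proof (induction p rule: less_induct)
      case (less p)
      have "X 1 * u p = 0"
        using eq[of p] less[of "p - b"] b by (cases "p < b") auto
      then have "X (- 1) * (X 1 * u p) = 0" by simp
      then show ?case by (simp only: X_cancel)
    qed
    then show "u = 0" by (simp add: fun_eq_iff vec_simps)
  qed
  {
    fix x assume "x \<in> ?\<Psi> ` ?D"
    then obtain u where u: "u \<in> free_mod R (n * b)" "\<And>t. coeff_vec u t \<in> slice b E n" "x = ?\<Psi> u"
      by (auto simp: base_ext_def)
    have "coeff_vec x t \<in> slice b E (Suc n)" for t
    proof -
      have c: "coeff_vec u t \<in> free_mod A (n * b)" "eval_slots b n (coeff_vec u t) \<in> E" for t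
        using u(2)[of t] by (auto simp: slice_def)
      have "vshift b (coeff_vec u t) - coeff_vec u (t - 1) \<in> free_mod A (Suc n * b)"
        by (intro A.submod_diff[OF A.submod_free] upA c)
      moreover have "eval_slots b (Suc n) (vshift b (coeff_vec u t) - coeff_vec u (t - 1)) \<in> E"
        unfolding ev_\<Psi>[OF free_AR[OF c(1)]]
        by (intro R.submod_diff[OF E] submodD(3)[OF E X_R] c)
      ultimately show ?thesis using u(3) cov_\<Psi>[OF u(1), of t] by (simp add: slice_def)
    qed
    moreover have "eval_slots b (Suc n) x = 0"
      using ev_\<Psi>[OF submodD(3)[OF R.submod_free X_R u(1)], of u 1] by (simp add: u(3) ev_X)
    ultimately show "x \<in> Z" using \<Psi>_free[OF u(1)] u(3) by (simp add: Z_def base_ext_def)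
  next
    fix v assume "v \<in> Z"
    then have v: "v \<in> free_mod R (Suc n * b)" "\<And>t. eval_slots b (Suc n) (coeff_vec v t) \<in> E" "eval_slots b (Suc n) v = 0"
      by (auto simp: Z_def base_ext_def slice_def)
    \<comment> \<open>synthetic division of the polynomial \<open>v\<close> in \<open>T\<close>, which has the root \<open>x\<close>, by \<open>T - x\<close>\<close>
    define q where "q p = (\<Sum>l\<le>p div b. X (int l - int (p div b)) * v (l * b + p mod b))" for p
    define u where "u p = (if p < n * b then - X (- 1) * q p else 0)" for p
    have q_R: "q p \<in> R" for p
      unfolding q_def by (intro R.sum_mem R.mult X_R free_R[OF v(1)])
    have q_small: "q p = v p" if "p < b" for p
      using that by (simp add: q_def X_0)
    have q_step: "q p = v p + X (- 1) * q (p - b)" if "p \<ge> b" for p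
    proof -
      define m where "m = (p - b) div b"
      have m: "p div b = Suc m" "(p - b) div b = m" "(p - b) mod b = p mod b"
        using that b le_div_geq[of b p] le_mod_geq[of b p] by (simp_all add: m_def)
      have X': "X (int l - int (Suc m)) = X (- 1) * X (int l - int m)" for l
        using X_add[of "- 1" "int l - int m"] by (simp add: algebra_simps)
      have "q p = v (Suc m * b + p mod b) + (\<Sum>l\<le>m. X (int l - int (Suc m)) * v (l * b + p mod b))"
        unfolding q_def m(1) sum.atMost_Suc by (simp add: X_0)
      also have "Suc m * b + p mod b = p" using m(1) div_mult_mod_eq[of p b] by simp
      also have "(\<Sum>l\<le>m. X (int l - int (Suc m)) * v (l * b + p mod b)) = X (- 1) * q (p - b)"
        unfolding q_def m(2,3) X' by (simp add: sum_distrib_left mult.assoc)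
      finally show ?thesis .
    qed
    have q_last: "q p = 0" if "p < Suc n * b" "\<not> p < n * b" for p
    proof -
      have d: "p div b = n"
        using that b by (intro div_nat_eqI) (auto simp: algebra_simps)
      have "q p = (\<Sum>l<Suc n. X (- int n) * (X (int l) * v (l * b + p mod b)))"
        unfolding q_def d lessThan_Suc_atMost using X_add[of "- int n" "int _"]
        by (intro sum.cong) (auto simp: mult.assoc[symmetric] X_add[symmetric])
      also have "\<dots> = X (- int n) * eval_slots b (Suc n) v (p mod b)"
        using mod_less_divisor[OF b, of p] by (simp only: eval_slots_def sum_distrib_left if_True)
      finally show ?thesis using v(3) by (simp add: vec_simps)
    qed
    have u_free: "u \<in> free_mod R (n * b)"
      by (auto simp: free_mod_def u_def intro!: R.mult R.uminus X_R q_R)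
    have eq: "v = ?\<Psi> u"
    proof
      fix p
      consider "p < n * b" | "p < Suc n * b" "\<not> p < n * b" | "\<not> p < Suc n * b" by blast
      then show "v p = ?\<Psi> u p"
      proof cases
        case 1
        then show ?thesis
          using q_small[of p] q_step[of p] X_cancel(2)[of 1 "q p"]
          by (cases "p < b") (auto simp: vshift_def u_def vec_simps)
      next
        case 2
        then have "v p = - (X (- 1) * q (p - b))" if "p \<ge> b"
          using q_step[OF that] q_last[OF 2] by (simp add: eq_neg_iff_add_eq_0)
        then show ?thesis
          using 2 q_small[of p] q_last[OF 2]
          by (cases "p < b") (auto simp: vshift_def u_def vec_simps)
      next
        case 3
        then show ?thesis using v(1) b by (auto simp: free_mod_def vshift_def u_def vec_simps)
      qed
    qed
    have c: "coeff_vec u t \<in> free_mod A (n * b)" for t by (rule cov_free[OF u_free])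
    define e where "e t = eval_slots b n (coeff_vec u t)" for t
    have e_step: "e t = X (- 1) \<odot> (eval_slots b (Suc n) (coeff_vec v t) + e (t - 1))" for t
    proof -
      have "eval_slots b (Suc n) (coeff_vec v t) = X 1 \<odot> e t - e (t - 1)"
        unfolding eq cov_\<Psi>[OF u_free] ev_\<Psi>[OF free_AR[OF c]] e_def ..
      then show ?thesis by (simp add: X_inv)
    qed
    obtain t0 where t0: "\<And>t. t < t0 \<Longrightarrow> coeff_vec u t = 0"
    proof (cases "{t. coeff_vec u t \<noteq> 0} = {}")
      case False
      show ?thesis
        by (rule that[of "Min {t. coeff_vec u t \<noteq> 0}"]) (use Min_le[OF cov_fin[OF u_free]] in force)
    qed blast
    \<comment> \<open>as \<open>u\<close> has only finitely many degrees, membership in \<open>E\<close> propagates upwards from degree \<open>t0\<close>\<close>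
    have "e t \<in> E" for t
    proof (cases "t < t0")
      case True
      then show ?thesis using t0[of t] submodD(1)[OF E] by (simp add: e_def)
    next
      case False
      then have "t0 \<le> t" by simp
      then show ?thesis
      proof (induction t rule: int_ge_induct)
        case base
        have "e (t0 - 1) = 0" using t0[of "t0 - 1"] by (simp add: e_def)
        then show ?case unfolding e_step[of t0] by (simp add: submodD(3)[OF E X_R v(2)])
      next
        case (step i)
        show ?case unfolding e_step[of "i + 1"]
          by (intro submodD(3)[OF E X_R] submodD(2)[OF E] v(2)) (use step in simp)
      qed
    qed
    then have "u \<in> ?D" using u_free c by (simp add: base_ext_def slice_def e_def)
    then show "v \<in> ?\<Psi> ` ?D" using eq by blast
  }
qed

text \<open>As in Hilbert's basis theorem, the leading coefficients of elements of \<open>E\<close> form a finitely generated module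
over \<open>A\<close>. Once the slice contains elements that realise its generators, the top degree of any element can
be lowered until the element lies in the slice.\<close>

lemma slice_generates:
  assumes A: "finite_resolutions A" and E: "submod R E" "E \<subseteq> free_mod R b" and b: "b > 0"
  obtains N where "eval_slots b (Suc N) ` base_ext (Suc N * b) (slice b E (Suc N)) = E"
proof -
  define L where "L = {a\<in>free_mod A b. \<exists>v\<in>E. coeff_vec v 0 = a \<and> (\<forall>t>0. coeff_vec v t = 0)}"
  have Ef: "v \<in> free_mod R b" if "v \<in> E" for v using that E(2) by blast
  have "submod A L"
    unfolding submod_def
  proof (intro conjI ballI)
    show "0 \<in> L" using submodD(1)[OF E(1)] submodD(1)[OF A.submod_free]
      by (auto simp: L_def intro!: bexI[of _ 0])
    show "x + y \<in> L" if "x \<in> L" "y \<in> L" for x y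
    proof -
      obtain v w where "v \<in> E" "w \<in> E" "coeff_vec v 0 = x" "coeff_vec w 0 = y" "\<forall>t>0. coeff_vec v t = 0" "\<forall>t>0. coeff_vec w t = 0"
        using \<open>x \<in> L\<close> \<open>y \<in> L\<close> by (auto simp: L_def)
      then show ?thesis using that submodD(2)[OF A.submod_free] submodD(2)[OF E(1)]
        by (auto simp: L_def intro!: bexI[of _ "v + w"] cov_add[OF Ef Ef] simp: cov_add[OF Ef Ef])
    qed
    show "c \<odot> x \<in> L" if "c \<in> A" "x \<in> L" for c x
    proof -
      obtain v where "v \<in> E" "coeff_vec v 0 = x" "\<forall>t>0. coeff_vec v t = 0"
        using \<open>x \<in> L\<close> by (auto simp: L_def)
      then show ?thesis using that submodD(3)[OF A.submod_free] submodD(3)[OF E(1) AR]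
        by (auto simp: L_def intro!: bexI[of _ "c \<odot> v"] simp: cov_scale[OF Ef])
    qed
  qed
  moreover have "L \<subseteq> free_mod A b" by (auto simp: L_def)
  ultimately obtain l where "free_resolution A l L" using A unfolding finite_resolutions_def by blast
  then have "free_resolution A (Suc l) L" by (rule A.resolution_Suc)
  then obtain n f where f: "linear_over A (free_mod A n) f" "f ` free_mod A n = L"
    unfolding free_resolution.simps by blast
  have "\<forall>k\<in>{..<n}. \<exists>v. v \<in> E \<and> coeff_vec v 0 = f (unit_vec k) \<and> (\<forall>t>0. coeff_vec v t = 0)"
  proof
    fix k assume "k \<in> {..<n}"
    then have "f (unit_vec k) \<in> L" using f(2) A.unit_vec_free[of k n] by blast
    then show "\<exists>v. v \<in> E \<and> coeff_vec v 0 = f (unit_vec k) \<and> (\<forall>t>0. coeff_vec v t = 0)" by (auto simp: L_def)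
  qed
  then obtain vs where vs: "\<And>k. k < n \<Longrightarrow> vs k \<in> E" "\<And>k. k < n \<Longrightarrow> coeff_vec (vs k) 0 = f (unit_vec k)"
      "\<And>k t. k < n \<Longrightarrow> t > 0 \<Longrightarrow> coeff_vec (vs k) t = 0"
    by (metis lessThan_iff)
  have "finite (\<Union>k<n. {t. coeff_vec (vs k) t \<noteq> 0})" using cov_fin[OF Ef[OF vs(1)]] by blast
  from finite_int_bound[OF this]
  obtain T where T: "\<forall>t\<in>(\<Union>k<n. {t. coeff_vec (vs k) t \<noteq> 0}). \<bar>t\<bar> \<le> T" by (elim exE) (rule that)
  define N where "N = nat T"
  have vs_low: "coeff_vec (vs k) t = 0" if "k < n" "t < - int N" for k t
  proof (rule ccontr)
    assume "coeff_vec (vs k) t \<noteq> 0"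
    then have "\<bar>t\<bar> \<le> T" using T that(1) by blast
    then show False using that(2) by (simp add: N_def split: if_splits)
  qed
  let ?S = "slice b E (Suc N)"
  let ?D = "base_ext (Suc N * b) ?S"
  have sD: "submod R ?D" by (rule submod_base_ext[OF submod_slice[OF E(1)]])
  define G where "G = eval_slots b (Suc N) ` ?D"
  have sG: "submod R G" unfolding G_def by (rule R.submod_image[OF lin_ev sD])
  have GE: "G \<subseteq> E"
  proof
    fix x assume "x \<in> G"
    then obtain v where v: "v \<in> free_mod R (Suc N * b)" "\<And>t. eval_slots b (Suc N) (coeff_vec v t) \<in> E" "x = eval_slots b (Suc N) v"
      by (auto simp: G_def base_ext_def slice_def)
    show "x \<in> E" unfolding v(3) ev_cov[OF v(1)]
      by (intro submod_sum[OF E(1)] submodD(3)[OF E(1) X_R] v(2))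
  qed
  have base: "v \<in> G" if v: "v \<in> E" and supp: "\<And>t. t < 0 \<or> t > int N \<Longrightarrow> coeff_vec v t = 0" for v
  proof -
    define w where "w p = (if p < Suc N * b then co (v (p mod b)) (int (p div b)) else 0)" for p
    have w: "w \<in> free_mod A (Suc N * b)"
      by (auto simp: free_mod_def w_def intro!: co_mem free_R[OF Ef[OF v]])
    have "eval_slots b (Suc N) w = v"
    proof
      fix i
      show "eval_slots b (Suc N) w i = v i"
      proof (cases "i < b")
        case True
        have "co (v i) t = 0" if "t \<notin> int ` {..<Suc N}" for t
        proof -
          have "t < 0 \<or> t > int N"
          proof (rule ccontr)
            assume "\<not> (t < 0 \<or> t > int N)"
            then have "t = int (nat t)" "nat t < Suc N" by auto
            with that show False by blast
          qed
          then show ?thesis using fun_cong[OF supp, of t i] by (simp add: coeff_vec_def vec_simps)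
        qed
        then have "v i = (\<Sum>t\<in>int ` {..<Suc N}. co (v i) t * X t)"
          by (intro co_sum' free_R[OF Ef[OF v]]) auto
        also have "\<dots> = (\<Sum>j<Suc N. co (v i) (int j) * X (int j))"
          by (subst sum.reindex) (auto simp: inj_on_def)
        also have "\<dots> = eval_slots b (Suc N) w i"
          unfolding eval_slots_def using True slot_less[OF _ True, of _ "Suc N"]
          by (auto simp: w_def mult.commute intro!: sum.cong simp del: sum.lessThan_Suc)
        finally show ?thesis by simp
      next
        case False
        then show ?thesis using Ef[OF v] by (auto simp: eval_slots_def free_mod_def)
      qed
    qed
    moreover have "w \<in> ?D"
      using w v calculation submodD(1)[OF submod_slice[OF E(1)], of b "Suc N"] free_AR[OF w]
      by (auto simp: base_ext_def cov_A[OF w] slice_def)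
    ultimately show ?thesis unfolding G_def by blast
  qed
  have X_G: "X k \<odot> v \<in> G" if "v \<in> G" for k v by (rule submodD(3)[OF sG X_R that])
  have vs_G: "vs k \<in> G" if "k < n" for k
  proof -
    have "X (int N) \<odot> vs k \<in> G"
    proof (rule base)
      show "X (int N) \<odot> vs k \<in> E" by (rule submodD(3)[OF E(1) X_R vs(1)[OF that]])
      show "coeff_vec (X (int N) \<odot> vs k) t = 0" if "t < 0 \<or> t > int N" for t
        using that vs_low[OF \<open>k < n\<close>, of "t - int N"] vs(3)[OF \<open>k < n\<close>, of "t - int N"]
        by (auto simp: cov_X[OF Ef[OF vs(1)[OF \<open>k < n\<close>]]])
    qed
    then have "X (- int N) \<odot> X (int N) \<odot> vs k \<in> G" by (rule X_G)
    then show ?thesis by (simp add: X_inv)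
  qed
  \<comment> \<open>subtracting a combination of shifts of the \<open>vs k\<close> removes the top coefficient, and stays in degrees
     at least zero as long as the top degree is at least \<open>N\<close>\<close>
  have main: "v \<in> G" if "v \<in> E" "\<And>t. t < 0 \<or> t \<ge> int M \<Longrightarrow> coeff_vec v t = 0" for M v
    using that
  proof (induction M arbitrary: v)
    case 0
    then show ?case by (intro base) auto
  next
    case (Suc M)
    show ?case
    proof (cases "M \<le> N")
      case True
      then show ?thesis using Suc.prems by (intro base) auto
    next
      case False
      define a where "a = coeff_vec v (int M)"
      have "coeff_vec (X (- int M) \<odot> v) t = coeff_vec v (t + int M)" for t
        using cov_X[OF Ef[OF Suc.prems(1)], of "- int M" t] by simp
      then have "a \<in> L"
        using cov_free[OF Ef[OF Suc.prems(1)]] Suc.prems submodD(3)[OF E(1) X_R Suc.prems(1)]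
        by (auto simp: L_def a_def intro!: bexI[of _ "X (- int M) \<odot> v"])
      then obtain c where c: "c \<in> free_mod A n" "a = f c" using f(2) by blast
      define u where "u = lcomb n vs c"
      have u_G: "u \<in> G" unfolding u_def
        by (rule lcomb_mem[OF sG]) (use free_AR[OF c(1)] free_R vs_G in auto)
      have uE: "u \<in> E" using u_G GE by blast
      have cov_u: "coeff_vec u t = lcomb n (\<lambda>k. coeff_vec (vs k) t) c" for t
      proof -
        have "coeff_vec u t = (\<Sum>k<n. coeff_vec (c k \<odot> vs k) t)"
          unfolding u_def lcomb_def
          by (rule cov_sum[of _ _ b]) (use Ef[OF vs(1)] free_A[OF c(1)] AR submodD(3)[OF R.submod_free] in auto)
        also have "\<dots> = (\<Sum>k<n. c k \<odot> coeff_vec (vs k) t)"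
          by (intro sum.cong refl cov_scale[OF Ef[OF vs(1)]] free_A[OF c(1)]) simp
        finally show ?thesis by (simp add: lcomb_def)
      qed
      have lc0: "lcomb n l c = 0" if "\<And>k. k < n \<Longrightarrow> l k = 0" for l
        unfolding lcomb_def using that by simp
      have "coeff_vec u 0 = a"
        unfolding cov_u c(2) A.lin_free_expand[OF f(1) c(1)] lcomb_def using vs(2) by simp
      have u_hi: "coeff_vec u t = 0" if "t > 0" for t unfolding cov_u by (rule lc0) (use vs(3) that in blast)
      have u_lo: "coeff_vec u t = 0" if "t < - int N" for t unfolding cov_u by (rule lc0) (use vs_low that in blast)
      define v' where "v' = v - X (int M) \<odot> u"
      have xu: "X (int M) \<odot> u \<in> E" by (rule submodD(3)[OF E(1) X_R uE])
      have cov_v': "coeff_vec v' t = coeff_vec v t - coeff_vec u (t - int M)" for t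
        unfolding v'_def cov_diff[OF Ef[OF Suc.prems(1)] Ef[OF xu]] cov_X[OF Ef[OF uE]] ..
      have "v' \<in> G"
      proof (rule Suc.IH)
        show "v' \<in> E" unfolding v'_def by (rule R.submod_diff[OF E(1) Suc.prems(1) xu])
        fix t assume "t < 0 \<or> t \<ge> int M"
        then consider "t < 0" | "t = int M" | "t \<ge> int (Suc M)" by linarith
        then show "coeff_vec v' t = 0"
        proof cases
          case 1
          then show ?thesis using Suc.prems(2)[of t] u_lo[of "t - int M"] False by (simp add: cov_v')
        next
          case 2
          then show ?thesis using \<open>coeff_vec u 0 = a\<close> by (simp add: cov_v' a_def)
        next
          case 3
          then show ?thesis using Suc.prems(2)[of t] u_hi[of "t - int M"] by (simp add: cov_v')
        qed
      qed
      then have "v' + X (int M) \<odot> u \<in> G" by (rule submodD(2)[OF sG _ X_G[OF u_G]])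
      then show ?thesis by (simp add: v'_def)
    qed
  qed
  have "v \<in> G" if v: "v \<in> E" for v
  proof -
    from finite_int_bound[OF cov_fin[OF Ef[OF v]]]
    obtain S where S: "\<forall>t\<in>{t. coeff_vec v t \<noteq> 0}. \<bar>t\<bar> \<le> S" by (elim exE) (rule that)
    have "X S \<odot> v \<in> G"
    proof (rule main[of _ "nat (2 * S + 1)"])
      show "X S \<odot> v \<in> E" by (rule submodD(3)[OF E(1) X_R v])
      show "coeff_vec (X S \<odot> v) t = 0" if "t < 0 \<or> t \<ge> int (nat (2 * S + 1))" for t
      proof (rule ccontr)
        assume "coeff_vec (X S \<odot> v) t \<noteq> 0"
        then have "\<bar>t - S\<bar> \<le> S" using S by (simp add: cov_X[OF Ef[OF v]])
        then show False using that by linarith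
      qed
    qed
    then have "X (- S) \<odot> X S \<odot> v \<in> G" by (rule X_G)
    then show ?thesis by (simp add: X_inv)
  qed
  then have "G = E" using GE by blast
  then show thesis using that unfolding G_def by blast
qed

text \<open>The cover of \<open>E\<close> by its large slice, with the next smaller slice as its kernel.\<close>

theorem finite_resolutions_laurent:
  assumes A: "finite_resolutions A"
  shows "finite_resolutions R"
  unfolding finite_resolutions_def
proof (intro allI impI)
  fix b E assume E: "submod R E" "E \<subseteq> free_mod R b"
  show "\<exists>j. free_resolution R j E"
  proof (cases "b = 0")
    case True
    then have "E = {0}" using E submodD(1)[OF E(1)] R.free_0 by blast
    then show ?thesis by (intro exI[of _ 0]) simp
  next
    case False
    then have b: "b > 0" by simp
    obtain N where N: "eval_slots b (Suc N) ` base_ext (Suc N * b) (slice b E (Suc N)) = E"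
      by (rule slice_generates[OF A E b])
    have sub: "slice b E n \<subseteq> free_mod A (n * b)" for n by (auto simp: slice_def)
    have "\<exists>j. free_resolution R j (base_ext (n * b) (slice b E n))" for n
      using A submod_slice[OF E(1), of b n] sub[of n] resolution_base_ext unfolding finite_resolutions_def by blast
    then obtain j1 j2 where j: "free_resolution R j1 (base_ext (Suc N * b) (slice b E (Suc N)))"
        "free_resolution R j2 (base_ext (N * b) (slice b E N))" by blast
    have lin: "linear_over R (base_ext (N * b) (slice b E N)) (\<lambda>u. vshift b u - X 1 \<odot> u)"
      by (intro lin_minus lin_vshift) (simp add: linear_over_def smul_distribs mult.commute)
    have "free_resolution R j2 {v \<in> base_ext (Suc N * b) (slice b E (Suc N)). eval_slots b (Suc N) v = 0}"
      by (rule R.resolution_iso[OF j(2) lin slice_relations[OF E(1) b]])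
    then have "free_resolution R (max j1 j2) {v \<in> base_ext (Suc N * b) (slice b E (Suc N)). eval_slots b (Suc N) v = 0}"
      by (rule R.resolution_mono) simp
    moreover have "free_resolution R (max j1 j2) (base_ext (Suc N * b) (slice b E (Suc N)))"
      by (rule R.resolution_mono[OF j(1)]) simp
    ultimately show ?thesis using R.resolution_quotient[OF lin_ev N] by blast
  qed
qed

end

section \<open>Vectors up to invertible matrices\<close>

definition poly_over :: "'f::comm_ring_1 set \<Rightarrow> 'f poly set" where
  "poly_over A = {p. \<forall>i. coeff p i \<in> A}"

context subring begin

lemma pCons_over [simp]: "pCons a p \<in> poly_over A \<longleftrightarrow> a \<in> A \<and> p \<in> poly_over A"
  by (auto simp: poly_over_def coeff_pCons split: nat.splits)

lemma zero_over [simp]: "0 \<in> poly_over A" and one_over [simp]: "1 \<in> poly_over A"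
  by (auto simp: poly_over_def)

lemma subring_poly_over: "subring (poly_over A)"
  by standard (auto simp: poly_over_def coeff_mult add uminus intro!: sum_mem mult)

lemma smult_over: "a \<in> A \<Longrightarrow> p \<in> poly_over A \<Longrightarrow> smult a p \<in> poly_over A"
  by (auto simp: poly_over_def)

lemma monom_over: "a \<in> A \<Longrightarrow> monom a n \<in> poly_over A"
  by (auto simp: poly_over_def)

lemma pcompose_over: "p \<in> poly_over A \<Longrightarrow> q \<in> poly_over A \<Longrightarrow> pcompose p q \<in> poly_over A"
proof (induction p)
  case (pCons a p)
  interpret P: subring "poly_over A" by (rule subring_poly_over)
  show ?case using pCons by (auto simp: pcompose_pCons simp del: add_pCons)
qed simp

text \<open>A polynomial maps congruent arguments to congruent values.\<close>

lemma pcompose_diff_over: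
  assumes "g \<in> poly_over A" "p \<in> poly_over A" "q \<in> poly_over A"
  shows "\<exists>r\<in>poly_over A. pcompose g p - pcompose g q = (p - q) * r"
  using assms(1)
proof (induction g)
  case 0
  then show ?case by (intro bexI[of _ 0]) auto
next
  case (pCons a g)
  interpret P: subring "poly_over A" by (rule subring_poly_over)
  obtain r where r: "r \<in> poly_over A" "pcompose g p - pcompose g q = (p - q) * r"
    using pCons by auto
  have "pcompose (pCons a g) p - pcompose (pCons a g) q = p * pcompose g p - q * pcompose g q"
    by (simp add: pcompose_pCons)
  also have "\<dots> = (p - q) * pcompose g p + q * (pcompose g p - pcompose g q)"
    by (simp add: algebra_simps)
  also have "\<dots> = (p - q) * (pcompose g p + q * r)"
    unfolding r(2) by (simp add: algebra_simps)
  finally have "pcompose (pCons a g) p - pcompose (pCons a g) q = (p - q) * (pcompose g p + q * r)" .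
  moreover have "pcompose g p + q * r \<in> poly_over A"
    using r assms(2,3) pCons by (intro P.add P.mult pcompose_over) auto
  ultimately show ?case by blast
qed

end

lemma poly_mem: "subring R \<Longrightarrow> A \<subseteq> R \<Longrightarrow> x \<in> R \<Longrightarrow> p \<in> poly_over A \<Longrightarrow> poly p x \<in> R"
  by (auto simp: poly_altdef poly_over_def intro!: subring.sum_mem subring.mult subring.power_mem)

definition mmul :: "nat \<Rightarrow> (nat \<Rightarrow> nat \<Rightarrow> 'a::comm_ring_1) \<Rightarrow> (nat \<Rightarrow> nat \<Rightarrow> 'a) \<Rightarrow> nat \<Rightarrow> nat \<Rightarrow> 'a" where
  "mmul m G H i j = (\<Sum>k<m. G i k * H k j)"

definition mvec :: "nat \<Rightarrow> (nat \<Rightarrow> nat \<Rightarrow> 'a::comm_ring_1) \<Rightarrow> (nat \<Rightarrow> 'a) \<Rightarrow> nat \<Rightarrow> 'a" where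
  "mvec m G v i = (\<Sum>k<m. G i k * v k)"

definition mats :: "'a set \<Rightarrow> nat \<Rightarrow> (nat \<Rightarrow> nat \<Rightarrow> 'a) set" where
  "mats S m = {G. \<forall>i<m. \<forall>j<m. G i j \<in> S}"

definition inverse_mats :: "nat \<Rightarrow> (nat \<Rightarrow> nat \<Rightarrow> 'a::comm_ring_1) \<Rightarrow> (nat \<Rightarrow> nat \<Rightarrow> 'a) \<Rightarrow> bool" where
  "inverse_mats m G H \<longleftrightarrow> (\<forall>i<m. \<forall>j<m. mmul m G H i j = unit_vec i j \<and> mmul m H G i j = unit_vec i j)"

text \<open>Two vectors are equivalent over \<open>S\<close> if an invertible matrix over \<open>S\<close> maps one to the other. Matrices
  are functions of which only the first \<open>m\<close> rows and columns matter; the inverse is carried along,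
  since it has to have entries in \<open>S\<close> too.\<close>

definition unit_equiv :: "'a::comm_ring_1 set \<Rightarrow> nat \<Rightarrow> (nat \<Rightarrow> 'a) \<Rightarrow> (nat \<Rightarrow> 'a) \<Rightarrow> bool" where
  "unit_equiv S m v w \<longleftrightarrow> (\<exists>G H. G \<in> mats S m \<and> H \<in> mats S m \<and> inverse_mats m G H \<and>
     (\<forall>i<m. mvec m G v i = w i))"

definition unimodular :: "'a::comm_ring_1 set \<Rightarrow> nat \<Rightarrow> (nat \<Rightarrow> 'a) \<Rightarrow> bool" where
  "unimodular S m v \<longleftrightarrow> (\<exists>u. (\<forall>i<m. u i \<in> S) \<and> (\<Sum>i<m. u i * v i) = 1)"

lemma mmul_assoc: "mmul m (mmul m F G) H = mmul m F (mmul m G H)"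
  unfolding mmul_def sum_distrib_left sum_distrib_right mult.assoc
  by (intro HOL.ext) (rule sum.swap)

lemma mvec_mmul: "mvec m (mmul m G H) v = mvec m G (mvec m H v)"
  unfolding mmul_def mvec_def sum_distrib_left sum_distrib_right mult.assoc
  by (intro HOL.ext) (rule sum.swap)

lemma sum_unit_vec_left: "i < m \<Longrightarrow> (\<Sum>k<m. unit_vec i k * f k) = f i"
  by (simp add: unit_vec_def if_distrib[of "\<lambda>c. c * _"] if_distrib[of "\<lambda>c. _ * c"] cong: if_cong)

lemma mmul_cong: "(\<And>k. k < m \<Longrightarrow> G i k = G' i k) \<Longrightarrow> (\<And>k. k < m \<Longrightarrow> H k j = H' k j) \<Longrightarrow> mmul m G H i j = mmul m G' H' i j"
  unfolding mmul_def by (intro sum.cong) auto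

lemma mvec_cong: "(\<And>k. k < m \<Longrightarrow> v k = w k) \<Longrightarrow> mvec m G v i = mvec m G w i"
  unfolding mvec_def by (intro sum.cong) auto

lemma inverse_mats_cancel:
  assumes "inverse_mats m G H" "i < m"
  shows "mvec m H (mvec m G v) i = v i" "mvec m G (mvec m H v) i = v i"
proof -
  have "mvec m H (mvec m G v) i = (\<Sum>k<m. unit_vec i k * v k)"
    unfolding mvec_mmul[symmetric] mvec_def[of m "mmul m H G"]
    using assms by (intro sum.cong) (auto simp: inverse_mats_def)
  then show "mvec m H (mvec m G v) i = v i" using assms(2) by (simp add: sum_unit_vec_left)
  have "mvec m G (mvec m H v) i = (\<Sum>k<m. unit_vec i k * v k)"
    unfolding mvec_mmul[symmetric] mvec_def[of m "mmul m G H"]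
    using assms by (intro sum.cong) (auto simp: inverse_mats_def)
  then show "mvec m G (mvec m H v) i = v i" using assms(2) by (simp add: sum_unit_vec_left)
qed

lemma inverse_mats_mmul:
  assumes "inverse_mats m G H" "inverse_mats m G' H'"
  shows "inverse_mats m (mmul m G' G) (mmul m H H')"
proof -
  have *: "mmul m (mmul m P Q) (mmul m Q' P') i j = unit_vec i j"
    if "\<And>i j. i < m \<Longrightarrow> j < m \<Longrightarrow> mmul m Q Q' i j = unit_vec i j" "\<And>i j. i < m \<Longrightarrow> j < m \<Longrightarrow> mmul m P P' i j = unit_vec i j"
      "i < m" "j < m" for P Q P' Q' :: "nat \<Rightarrow> nat \<Rightarrow> 'a" and i j
  proof -
    have "mmul m Q (mmul m Q' P') k j = P' k j" if "k < m" for k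
      unfolding mmul_assoc[symmetric] mmul_def[of m "mmul m Q Q'"]
      using that \<open>\<And>i j. i < m \<Longrightarrow> j < m \<Longrightarrow> mmul m Q Q' i j = unit_vec i j\<close> by (simp add: sum_unit_vec_left)
    then have "mmul m P (mmul m Q (mmul m Q' P')) i j = mmul m P P' i j"
      by (intro mmul_cong) auto
    then show ?thesis using that by (simp add: mmul_assoc)
  qed
  show ?thesis
    using assms unfolding inverse_mats_def by (auto intro!: *)
qed

context subring begin

lemma mmul_mats: "G \<in> mats A m \<Longrightarrow> H \<in> mats A m \<Longrightarrow> mmul m G H \<in> mats A m"
  by (auto simp: mats_def mmul_def intro!: sum_mem mult)

lemma unit_equiv_refl: "unit_equiv A m v v"
  unfolding unit_equiv_def
  by (rule exI[of _ unit_vec], rule exI[of _ unit_vec])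
     (auto simp: mats_def inverse_mats_def mmul_def mvec_def sum_unit_vec_left, auto simp: unit_vec_def)

lemma unit_equiv_trans [trans]: "unit_equiv A m v w \<Longrightarrow> unit_equiv A m w x \<Longrightarrow> unit_equiv A m v x"
proof -
  assume "unit_equiv A m v w" "unit_equiv A m w x"
  then obtain G H G' H' where *: "G \<in> mats A m" "H \<in> mats A m" "inverse_mats m G H" "\<forall>i<m. mvec m G v i = w i"
    "G' \<in> mats A m" "H' \<in> mats A m" "inverse_mats m G' H'" "\<forall>i<m. mvec m G' w i = x i"
    unfolding unit_equiv_def by blast
  have "mvec m (mmul m G' G) v i = x i" if "i < m" for i
    using that mvec_cong[of m "mvec m G v" w G' i] *(4,8) by (simp add: mvec_mmul)
  then show ?thesis
    unfolding unit_equiv_def using inverse_mats_mmul[OF *(3,7)] mmul_mats[OF *(5,1)] mmul_mats[OF *(2,6)] by blast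
qed

lemma unit_equiv_add:
  assumes "l < m" "\<And>p. p < m \<Longrightarrow> c p \<in> A" "\<And>p. p < m \<Longrightarrow> w p = (if p = l then v p else v p + c p * v l)"
  shows "unit_equiv A m v w"
proof -
  define E :: "(nat \<Rightarrow> 'r) \<Rightarrow> nat \<Rightarrow> nat \<Rightarrow> 'r" where "E c p q = unit_vec p q + (if p = l then 0 else c p) * unit_vec l q" for c p q
  have E_vec: "mvec m (E c) v p = v p + (if p = l then 0 else c p) * v l" if "p < m" for c v p
  proof -
    have "mvec m (E c) v p = (\<Sum>k<m. unit_vec p k * v k) + (if p = l then 0 else c p) * (\<Sum>k<m. unit_vec l k * v k)"
      by (simp add: mvec_def E_def distrib_right sum.distrib sum_distrib_left mult.assoc)
    then show ?thesis using that assms(1) by (simp add: sum_unit_vec_left)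
  qed
  have E_inv: "mmul m (E c) (E c') p q = unit_vec p q" if "p < m" "\<And>p. c' p = - c p" for c c' p q
  proof -
    have "mmul m (E c) (E c') p q = mvec m (E c) (\<lambda>k. E c' k q) p"
      by (simp add: mmul_def mvec_def)
    then show ?thesis using that by (simp add: E_vec) (simp add: E_def)
  qed
  have "E c \<in> mats A m" "E (\<lambda>p. - c p) \<in> mats A m"
    using assms(2) by (auto simp: mats_def E_def unit_vec_def)
  moreover have "inverse_mats m (E c) (E (\<lambda>p. - c p))"
    by (auto simp: inverse_mats_def intro!: E_inv)
  moreover have "mvec m (E c) v p = w p" if "p < m" for p
    using that by (simp add: E_vec assms(3))
  ultimately show ?thesis unfolding unit_equiv_def by blast
qed

lemma unit_equiv_scale:
  assumes "\<And>p. p < m \<Longrightarrow> u p \<in> A" "\<And>p. p < m \<Longrightarrow> u' p \<in> A" "\<And>p. p < m \<Longrightarrow> u p * u' p = 1"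
    "\<And>p. p < m \<Longrightarrow> w p = u p * v p"
  shows "unit_equiv A m v w"
proof -
  define E :: "(nat \<Rightarrow> 'r) \<Rightarrow> nat \<Rightarrow> nat \<Rightarrow> 'r" where "E c p q = c p * unit_vec p q" for c p q
  have E_vec: "mvec m (E c) v p = c p * v p" if "p < m" for c v p
    using that by (simp add: mvec_def E_def mult.assoc sum_unit_vec_left flip: sum_distrib_left)
  have E_inv: "mmul m (E c) (E c') p q = unit_vec p q" if "p < m" "c p * c' p = 1" for c c' p q
  proof -
    have "mmul m (E c) (E c') p q = mvec m (E c) (\<lambda>k. E c' k q) p"
      by (simp add: mmul_def mvec_def)
    then show ?thesis using that by (simp add: E_vec) (simp add: E_def flip: mult.assoc)
  qed
  have "E u \<in> mats A m" "E u' \<in> mats A m"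
    using assms(1,2) by (auto simp: mats_def E_def unit_vec_def)
  moreover have "inverse_mats m (E u) (E u')"
    using assms(3) by (auto simp: inverse_mats_def intro!: E_inv) (auto simp: mult.commute)
  moreover have "mvec m (E u) v p = w p" if "p < m" for p
    using that by (simp add: E_vec assms(4))
  ultimately show ?thesis unfolding unit_equiv_def by blast
qed

lemma unit_equiv_unit_vector:
  assumes "\<And>i. i < m \<Longrightarrow> v i \<in> A" "l < m" "v l = 1" "k < m"
  shows "unit_equiv A m v (unit_vec k)"
proof -
  have "unit_equiv A m v (unit_vec l)"
    using assms by (intro unit_equiv_add[of l m "\<lambda>p. - v p"]) (auto simp: unit_vec_def)
  also have "unit_equiv A m (unit_vec l) (unit_vec k)"
  proof (cases "k = l")
    case False
    have "unit_equiv A m (unit_vec l) (\<lambda>i. if i = l \<or> i = k then 1 else 0)"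
      using assms False by (intro unit_equiv_add[of l m "unit_vec k"]) (auto simp: unit_vec_def)
    also have "unit_equiv A m (\<lambda>i. if i = l \<or> i = k then 1 else 0) (unit_vec k)"
      using assms False by (intro unit_equiv_add[of k m "\<lambda>i. - unit_vec l i"]) (auto simp: unit_vec_def)
    finally show ?thesis .
  qed (simp add: unit_equiv_refl)
  finally show ?thesis .
qed

lemma unit_equiv_mem: "unit_equiv A m v w \<Longrightarrow> (\<And>i. i < m \<Longrightarrow> v i \<in> A) \<Longrightarrow> i < m \<Longrightarrow> w i \<in> A"
  by (auto simp: unit_equiv_def mats_def mvec_def) (metis (no_types, lifting) lessThan_iff mult sum_mem)

lemma unimodular_unit_equiv:
  assumes "unit_equiv A m v w" "unimodular A m v"
  shows "unimodular A m w"
proof -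
  from assms obtain G H u where *: "H \<in> mats A m" "inverse_mats m G H" "\<And>i. i < m \<Longrightarrow> mvec m G v i = w i"
    and u: "\<And>i. i < m \<Longrightarrow> u i \<in> A" "(\<Sum>i<m. u i * v i) = 1"
    unfolding unit_equiv_def unimodular_def by blast
  have "(\<Sum>i<m. (\<Sum>j<m. u j * H j i) * w i) = (\<Sum>i<m. (\<Sum>j<m. u j * (H j i * mvec m G v i)))"
    by (intro sum.cong) (auto simp: *(3) sum_distrib_right mult.assoc)
  also have "\<dots> = (\<Sum>j<m. u j * mvec m H (mvec m G v) j)"
    unfolding mvec_def[of m H] sum_distrib_left by (rule sum.swap)
  also have "\<dots> = 1" using u(2) inverse_mats_cancel(1)[OF *(2)] by simp
  finally show ?thesis
    unfolding unimodular_def using *(1) u(1) by (intro exI[of _ "\<lambda>i. \<Sum>j<m. u j * H j i"]) (auto simp: mats_def intro!: sum_mem mult)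
qed

end

lemma unit_equiv_hom:
  fixes \<phi> :: "'a::comm_ring_1 \<Rightarrow> 'b::comm_ring_1"
  assumes "\<And>a b. \<phi> (a + b) = \<phi> a + \<phi> b" "\<And>a b. \<phi> (a * b) = \<phi> a * \<phi> b" "\<phi> 0 = 0" "\<phi> 1 = 1"
    "\<And>a. a \<in> S \<Longrightarrow> \<phi> a \<in> T" "unit_equiv S m v w"
  shows "unit_equiv T m (\<lambda>i. \<phi> (v i)) (\<lambda>i. \<phi> (w i))"
proof -
  have sum: "\<phi> (sum f I) = (\<Sum>i\<in>I. \<phi> (f i))" for f :: "nat \<Rightarrow> 'a" and I
    by (induction I rule: infinite_finite_induct) (auto simp: assms)
  from assms(6) obtain G H where *: "G \<in> mats S m" "H \<in> mats S m" "inverse_mats m G H"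
      "\<forall>i<m. mvec m G v i = w i"
    unfolding unit_equiv_def by blast
  have mm: "mmul m (\<lambda>i j. \<phi> (P i j)) (\<lambda>i j. \<phi> (Q i j)) i j = \<phi> (mmul m P Q i j)" for P Q i j
    by (simp add: mmul_def sum assms)
  have mv: "mvec m (\<lambda>i j. \<phi> (P i j)) (\<lambda>i. \<phi> (x i)) i = \<phi> (mvec m P x i)" for P x i
    by (simp add: mvec_def sum assms)
  have unit_vec: "\<phi> (unit_vec i j) = unit_vec i j" for i j by (simp add: unit_vec_def assms)
  have "inverse_mats m (\<lambda>i j. \<phi> (G i j)) (\<lambda>i j. \<phi> (H i j))"
    using *(3) by (simp add: inverse_mats_def mm unit_vec)
  moreover have "\<forall>i<m. mvec m (\<lambda>i j. \<phi> (G i j)) (\<lambda>i. \<phi> (v i)) i = \<phi> (w i)"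
    using *(4) by (simp add: mv)
  moreover have "(\<lambda>i j. \<phi> (G i j)) \<in> mats T m" "(\<lambda>i j. \<phi> (H i j)) \<in> mats T m"
    using *(1,2) assms(5) by (auto simp: mats_def)
  ultimately show ?thesis unfolding unit_equiv_def by blast
qed

section \<open>Unimodular vectors over polynomials with local coefficients\<close>

text \<open>A local ring, given by an ideal \<open>N\<close> outside of which every element is a unit.\<close>

locale local_subring = subring A for A :: "'f::comm_ring_1 set" +
  fixes N :: "'f set"
  assumes N_zero: "0 \<in> N" and N_add: "a \<in> N \<Longrightarrow> b \<in> N \<Longrightarrow> a + b \<in> N"
    and N_mult: "a \<in> A \<Longrightarrow> b \<in> N \<Longrightarrow> a * b \<in> N" and N_one: "1 \<notin> N"
    and N_unit: "a \<in> A \<Longrightarrow> a \<notin> N \<Longrightarrow> \<exists>c\<in>A. c * a = 1"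
begin

lemma N_sum: "(\<And>i. i \<in> I \<Longrightarrow> f i \<in> N) \<Longrightarrow> sum f I \<in> N"
  by (induction I rule: infinite_finite_induct) (auto simp: N_zero N_add)

lemma N_diff: "a \<in> N \<Longrightarrow> b \<in> N \<Longrightarrow> a - b \<in> N"
  using N_add[of a "- b"] N_mult[of "- 1" b] by simp

end

context subring begin

lemma poly_over_coeff: "p \<in> poly_over A \<Longrightarrow> coeff p i \<in> A"
  by (simp add: poly_over_def)

lemma monic_division:
  assumes "f \<in> poly_over A" "coeff f d = 1" "\<And>i. i > d \<Longrightarrow> coeff f i = 0" "g \<in> poly_over A"
  shows "\<exists>q\<in>poly_over A. \<forall>i\<ge>d. coeff (g - q * f) i = 0"
proof -
  interpret P: subring "poly_over A" by (rule subring_poly_over)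
  have "\<exists>q\<in>poly_over A. \<forall>i\<ge>d. coeff (g - q * f) i = 0"
    if "g \<in> poly_over A" "\<And>i. i \<ge> d + n \<Longrightarrow> coeff g i = 0" for n g
    using that
  proof (induction n arbitrary: g)
    case 0
    then show ?case by (intro bexI[of _ 0]) auto
  next
    case (Suc n)
    define c where "c = coeff g (d + n)"
    have c: "monom c n \<in> poly_over A" using Suc.prems(1) by (auto simp: c_def poly_over_coeff intro: monom_over)
    have "\<exists>q\<in>poly_over A. \<forall>i\<ge>d. coeff (g - monom c n * f - q * f) i = 0"
    proof (rule Suc.IH)
      show "g - monom c n * f \<in> poly_over A" using c assms(1) Suc.prems(1) by blast
      fix i assume i: "d + n \<le> i"
      show "coeff (g - monom c n * f) i = 0"
      proof (cases "i = d + n")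
        case True
        then show ?thesis using assms(2) by (simp add: coeff_monom_mult c_def)
      next
        case False
        then show ?thesis using i Suc.prems(2)[of i] assms(3)[of "i - n"] by (simp add: coeff_monom_mult)
      qed
    qed
    then obtain q where q: "q \<in> poly_over A" "\<forall>i\<ge>d. coeff (g - monom c n * f - q * f) i = 0" by blast
    have "g - monom c n * f - q * f = g - (monom c n + q) * f" by (simp add: algebra_simps)
    then show ?case using q c P.add[OF c q(1)] by (metis (no_types))
  qed
  from this[OF assms(4), of "Suc (degree g)"] show ?thesis by (simp add: coeff_eq_0)
qed

text \<open>Any coefficient of \<open>g\<close> becomes the coefficient of degree \<open>d - 1\<close> of a combination of \<open>f\<close> and \<open>g\<close>:
  multiplying by the variable and cancelling against the monic \<open>f\<close> moves the coefficients up.\<close>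

lemma raise_coefficient:
  assumes f: "f \<in> poly_over A" "coeff f d = 1" "\<And>i. i > d \<Longrightarrow> coeff f i = 0"
    and g: "g \<in> poly_over A" "\<And>i. i \<ge> d \<Longrightarrow> coeff g i = 0" and "k < d"
  shows "\<exists>a\<in>poly_over A. \<exists>b\<in>poly_over A.
    (\<forall>i\<ge>d. coeff (a * f + b * g) i = 0) \<and> coeff (a * f + b * g) (d - 1) = coeff g k"
proof -
  interpret P: subring "poly_over A" by (rule subring_poly_over)
  define I where "I = {h. (\<exists>a\<in>poly_over A. \<exists>b\<in>poly_over A. h = a * f + b * g) \<and> (\<forall>i\<ge>d. coeff h i = 0)}"
  have I_over: "h \<in> poly_over A" if "h \<in> I" for h
    using that f(1) g(1) by (auto simp: I_def)
  have I_lin: "h + smult c h' \<in> I" if "h \<in> I" "h' \<in> I" "c \<in> A" for h h' c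
  proof -
    obtain a b a' b' where *: "a \<in> poly_over A" "b \<in> poly_over A" "a' \<in> poly_over A" "b' \<in> poly_over A"
        "h = a * f + b * g" "h' = a' * f + b' * g"
      using \<open>h \<in> I\<close> \<open>h' \<in> I\<close> by (auto simp: I_def)
    then have "h + smult c h' = (a + smult c a') * f + (b + smult c b') * g"
      by (simp add: algebra_simps smult_add_right)
    moreover have "a + smult c a' \<in> poly_over A" "b + smult c b' \<in> poly_over A"
      using * that(3) by (auto intro: smult_over)
    moreover have "\<forall>i\<ge>d. coeff (h + smult c h') i = 0" using that by (auto simp: I_def)
    ultimately show ?thesis unfolding I_def by blast
  qed
  have "\<exists>h'\<in>I. coeff h' (d - 1) = coeff h (d - 1 - n)" if "h \<in> I" "n < d" for n h
    using that
  proof (induction n arbitrary: h)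
    case 0
    then show ?case by auto
  next
    case (Suc n)
    define c where "c = coeff h (d - 1)"
    have c: "c \<in> A" using I_over[OF Suc.prems(1)] by (simp add: c_def poly_over_coeff)
    define h1 where "h1 = pCons 0 h - smult c f"
    have "h1 \<in> I"
    proof -
      obtain a b where ab: "a \<in> poly_over A" "b \<in> poly_over A" "h = a * f + b * g"
        using Suc.prems(1) by (auto simp: I_def)
      have "h1 = (pCons 0 a - [:c:]) * f + pCons 0 b * g"
        by (simp add: h1_def ab(3) algebra_simps)
      moreover have "pCons 0 a - [:c:] \<in> poly_over A" "pCons 0 b \<in> poly_over A"
        using ab c by (auto intro!: P.diff simp del: diff_pCons)
      moreover have "coeff h1 i = 0" if "i \<ge> d" for i
      proof (cases "i = d")
        case True
        then show ?thesis using f(2) Suc.prems(2) by (auto simp: h1_def c_def coeff_pCons split: nat.splits)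
      next
        case False
        then have "coeff h (i - 1) = 0" using Suc.prems(1) that by (auto simp: I_def)
        then show ?thesis using f(3)[of i] False that by (auto simp: h1_def coeff_pCons split: nat.splits)
      qed
      ultimately show ?thesis unfolding I_def by blast
    qed
    then obtain h' where h': "h' \<in> I" "coeff h' (d - 1) = coeff h1 (d - 1 - n)"
      using Suc.IH[of h1] Suc.prems(2) by auto
    have "d - 1 - n = Suc (d - 1 - Suc n)" using Suc.prems(2) by simp
    then have "coeff h1 (d - 1 - n) = coeff h (d - 1 - Suc n) - c * coeff f (d - 1 - n)"
      by (simp add: h1_def del: diff_Suc_1 diff_Suc_Suc)
    then have "coeff (h' + smult (coeff f (d - 1 - n)) h) (d - 1) = coeff h (d - 1 - Suc n)"
      using h'(2) by (simp add: c_def mult.commute)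
    moreover have "h' + smult (coeff f (d - 1 - n)) h \<in> I"
      by (rule I_lin[OF h'(1) Suc.prems(1) poly_over_coeff[OF f(1)]])
    ultimately show ?case by blast
  qed
  moreover have "g \<in> I"
  proof -
    have "g = 0 * f + 1 * g" by simp
    then show ?thesis using g(2) P.zero P.one unfolding I_def by blast
  qed
  ultimately obtain h' where h': "h' \<in> I" "coeff h' (d - 1) = coeff g (d - 1 - (d - 1 - k))"
    using \<open>k < d\<close> by (metis diff_less less_imp_diff_less not_less0 not_less_eq One_nat_def diff_Suc_less gr0I)
  have "d - 1 - (d - 1 - k) = k" using \<open>k < d\<close> by simp
  moreover obtain a b where "a \<in> poly_over A" "b \<in> poly_over A" "h' = a * f + b * g" "\<forall>i\<ge>d. coeff h' i = 0"
    using h'(1) unfolding I_def by blast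
  ultimately show ?thesis using h'(2) by (intro bexI[of _ a] bexI[of _ b]) simp_all
qed

end

context local_subring begin

text \<open>A unimodular row with a monic entry of positive degree cannot have all other entries in the
  maximal ideal, since the monic entry is no unit of the residue ring.\<close>

lemma monic_not_unit_mod:
  fixes m l :: nat
  assumes u: "\<And>i. i < m \<Longrightarrow> u i \<in> poly_over A" and sum: "(\<Sum>i<m. u i * v i) = 1"
    and l: "l < m" "coeff (v l) d = 1" "\<And>i. i > d \<Longrightarrow> coeff (v l) i = 0" "d > 0"
    and v: "\<And>i k. i < m \<Longrightarrow> i \<noteq> l \<Longrightarrow> coeff (v i) k \<in> N" and vl: "v l \<in> poly_over A"
  shows False
proof -
  have split: "1 = u l * v l + (\<Sum>i\<in>{..<m}-{l}. u i * v i)"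
    using sum.remove[of "{..<m}" l "\<lambda>i. u i * v i"] sum l(1) by simp
  have rest: "coeff (\<Sum>i\<in>{..<m}-{l}. u i * v i) k \<in> N" for k
    unfolding coeff_sum coeff_mult using u v by (intro N_sum N_mult) (auto simp: poly_over_coeff)
  have uv: "coeff (u l * v l) k \<in> N" if "k > 0" for k
  proof -
    have "coeff (u l * v l) k = 0 - coeff (\<Sum>i\<in>{..<m}-{l}. u i * v i) k"
      using arg_cong[OF split, of "\<lambda>p. coeff p k"] that by (simp add: eq_neg_iff_add_eq_0 coeff_eq_0)
    then show ?thesis using N_diff[OF N_zero rest] by simp
  qed
  have ul: "coeff (u l) k \<in> A" for k by (rule poly_over_coeff[OF u[OF l(1)]])
  have vl': "coeff (v l) k \<in> A" for k by (rule poly_over_coeff[OF vl])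
  have "coeff (u l) k \<in> N" for k
  proof (cases "k > degree (u l)")
    case True
    then show ?thesis by (simp add: coeff_eq_0 N_zero)
  next
    case False
    then have "k \<le> degree (u l)" by simp
    then show ?thesis
    proof (induction "degree (u l) - k" arbitrary: k rule: less_induct)
      case (less k)
      have IH: "coeff (u l) j \<in> N" if "k < j" "j \<le> degree (u l)" for j
        by (rule less.hyps) (use that in auto)
      have "coeff (u l * v l) (k + d) = (\<Sum>j\<le>k + d. coeff (u l) j * coeff (v l) (k + d - j))"
        by (rule coeff_mult)
      also have "\<dots> = coeff (u l) k * coeff (v l) d + (\<Sum>j\<in>{..k + d}-{k}. coeff (u l) j * coeff (v l) (k + d - j))"
        by (subst sum.remove[of _ k]) auto
      finally have "coeff (u l) k = coeff (u l * v l) (k + d) - (\<Sum>j\<in>{..k + d}-{k}. coeff (u l) j * coeff (v l) (k + d - j))"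
        using l(2) by simp
      moreover have "coeff (u l) j * coeff (v l) (k + d - j) \<in> N" if "j \<in> {..k + d} - {k}" for j
      proof (cases "j < k")
        case True
        then show ?thesis using l(3)[of "k + d - j"] by (simp add: N_zero)
      next
        case False
        then have "coeff (u l) j \<in> N"
          using IH[of j] that by (cases "j \<le> degree (u l)") (auto simp: coeff_eq_0 N_zero)
        then show ?thesis using N_mult[OF vl'] by (simp add: mult.commute)
      qed
      ultimately show "coeff (u l) k \<in> N"
        using uv[of "k + d"] l(4) by (auto intro!: N_diff N_sum)
    qed
  qed
  then have "coeff (u l * v l) 0 \<in> N"
    using N_mult[OF vl', of "coeff (u l) 0" 0] by (simp add: coeff_mult mult.commute)
  then have "coeff 1 0 \<in> N"
    using arg_cong[OF split, of "\<lambda>p. coeff p 0"] N_add rest[of 0] by (simp only: coeff_add)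
  then show False using N_one by simp
qed

text \<open>Horrocks' theorem for vectors, by induction on the degree \<open>d\<close> of the monic entry. All other entries
  may be reduced to smaller degree. One of them has a coefficient outside of the maximal ideal, hence
  a unit, so the ideal of these two entries contains a polynomial that is monic of degree \<open>d - 1\<close>. It
  serves to make a third entry monic of degree \<open>d - 1\<close>; this is why three entries are needed.\<close>

theorem local_unimodular_monic:
  assumes "3 \<le> m" "\<And>i. i < m \<Longrightarrow> v i \<in> poly_over A" "unimodular (poly_over A) m v"
    "l < m" "coeff (v l) d = 1" "\<And>i. i > d \<Longrightarrow> coeff (v l) i = 0"
  shows "unit_equiv (poly_over A) m v (unit_vec 0)"
  using assms(2-)
proof (induction d arbitrary: v l)
  case 0
  interpret P: subring "poly_over A" by (rule subring_poly_over)
  have "v l = 1" using 0 by (intro poly_eqI) (auto simp: coeff_1)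
  then show ?case using 0 assms(1) by (intro P.unit_equiv_unit_vector[of m v l 0]) auto
next
  case (Suc d)
  interpret P: subring "poly_over A" by (rule subring_poly_over)
  let ?d = "Suc d"
  have "\<forall>i\<in>{..<m}. \<exists>q\<in>poly_over A. \<forall>k\<ge>?d. coeff (v i - q * v l) k = 0"
    using monic_division[of "v l" ?d] Suc.prems by blast
  then obtain q where q: "\<And>i. i < m \<Longrightarrow> q i \<in> poly_over A" "\<And>i k. i < m \<Longrightarrow> k \<ge> ?d \<Longrightarrow> coeff (v i - q i * v l) k = 0"
    by (metis lessThan_iff)
  define w where "w i = (if i = l then v l else v i + (- q i) * v l)" for i
  have vw: "unit_equiv (poly_over A) m v w"
    by (rule P.unit_equiv_add[of l m "\<lambda>i. - q i"]) (use Suc.prems q(1) in \<open>auto simp: w_def\<close>)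
  have w_over: "w i \<in> poly_over A" if "i < m" for i
    by (rule P.unit_equiv_mem[OF vw Suc.prems(1) that])
  obtain u where u: "\<And>i. i < m \<Longrightarrow> u i \<in> poly_over A" "(\<Sum>i<m. u i * w i) = 1"
    using P.unimodular_unit_equiv[OF vw Suc.prems(2)] unfolding unimodular_def by blast
  have wl: "coeff (w l) ?d = 1" "\<And>i. i > ?d \<Longrightarrow> coeff (w l) i = 0"
    using Suc.prems by (simp_all add: w_def)
  have w_deg: "coeff (w i) k = 0" if "i < m" "i \<noteq> l" "k \<ge> ?d" for i k
    using q(2)[OF that(1,3)] that(2) by (simp add: w_def)
  have "\<exists>i k. i < m \<and> i \<noteq> l \<and> coeff (w i) k \<notin> N"
    using monic_not_unit_mod[of m u w l ?d] u Suc.prems(3) wl w_over by blast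
  then obtain i k where i: "i < m" "i \<noteq> l" "coeff (w i) k \<notin> N" by blast
  then have "k < ?d" using w_deg[of i k] N_zero by (cases "k < ?d") auto
  obtain t where t: "t \<in> A" "t * coeff (w i) k = 1"
    using N_unit[OF poly_over_coeff[OF w_over[OF i(1)]] i(3)] by blast
  obtain a b where ab: "a \<in> poly_over A" "b \<in> poly_over A"
      "\<forall>i'\<ge>?d. coeff (a * w l + b * w i) i' = 0" "coeff (a * w l + b * w i) d = coeff (w i) k"
    using raise_coefficient[OF w_over[OF Suc.prems(3)] wl w_over[OF i(1)] w_deg[OF i(1,2)] \<open>k < ?d\<close>] by auto
  obtain j where j: "j < m" "j \<noteq> l" "j \<noteq> i"
  proof -
    have "card {l, i} < card {..<m}" using assms(1) by (simp add: card_insert_if)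
    then have "\<not> {..<m} \<subseteq> {l, i}" using card_mono[of "{l, i}" "{..<m}"] by auto
    then show ?thesis using that by blast
  qed
  define e where "e = (1 - coeff (w j) d) * t"
  have e: "e \<in> A" unfolding e_def using t(1) poly_over_coeff[OF w_over[OF j(1)]] by blast
  define x where "x p = (if p = j then w j + smult e a * w l else w p)" for p
  define y where "y p = (if p = j then x j + smult e b * x i else x p)" for p
  have "unit_equiv (poly_over A) m w x"
    by (rule P.unit_equiv_add[of l m "\<lambda>p. if p = j then smult e a else 0"])
       (use j Suc.prems e ab in \<open>auto simp: x_def smult_over\<close>)
  also have "unit_equiv (poly_over A) m x y"
    by (rule P.unit_equiv_add[of i m "\<lambda>p. if p = j then smult e b else 0"])
       (use j i e ab in \<open>auto simp: y_def smult_over\<close>)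
  finally have vy: "unit_equiv (poly_over A) m v y" using P.unit_equiv_trans[OF vw] by blast
  have yj: "y j = w j + smult e (a * w l + b * w i)"
    using j(3) by (simp add: y_def x_def smult_add_right)
  have "unit_equiv (poly_over A) m y (unit_vec 0)"
  proof (rule Suc.IH[of _ j])
    show "y p \<in> poly_over A" if "p < m" for p
      by (rule P.unit_equiv_mem[OF vy Suc.prems(1) that])
    show "unimodular (poly_over A) m y" by (rule P.unimodular_unit_equiv[OF vy Suc.prems(2)])
    show "coeff (y j) d = 1"
    proof -
      have "coeff (y j) d = coeff (w j) d + e * coeff (a * w l + b * w i) d"
        by (simp only: yj coeff_add[of "w j"] coeff_smult)
      then show ?thesis by (simp only: ab(4) e_def mult.assoc t(2)) simp
    qed
    show "coeff (y j) p = 0" if "p > d" for p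
      using that ab(3) w_deg[OF j(1,2), of p] by (simp only: yj coeff_add coeff_smult) simp
  qed (rule j(1))
  then show ?case using P.unit_equiv_trans[OF vy] by blast
qed

end

section \<open>From localisations to the ring\<close>

definition ideal_of :: "'f::comm_ring_1 set \<Rightarrow> 'f set \<Rightarrow> bool" where
  "ideal_of A J \<longleftrightarrow> J \<subseteq> A \<and> 0 \<in> J \<and> (\<forall>x\<in>J. \<forall>y\<in>J. x + y \<in> J) \<and> (\<forall>a\<in>A. \<forall>x\<in>J. a * x \<in> J)"

text \<open>An ideal that is maximal among the proper ideals containing \<open>I\<close> is prime.\<close>

lemma (in subring) prime_ideal_exists:
  assumes I: "ideal_of A I" "1 \<notin> I"
  obtains P where "ideal_of A P" "I \<subseteq> P" "1 \<notin> P"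
    "\<And>a b. a \<in> A \<Longrightarrow> b \<in> A \<Longrightarrow> a * b \<in> P \<Longrightarrow> a \<in> P \<or> b \<in> P"
proof -
  let ?S = "{J. ideal_of A J \<and> I \<subseteq> J \<and> 1 \<notin> J}"
  have "\<exists>M\<in>?S. \<forall>X\<in>?S. M \<subseteq> X \<longrightarrow> X = M"
  proof (rule subset_Zorn_nonempty)
    show "?S \<noteq> {}" using I by blast
    fix C assume C: "C \<noteq> {}" "subset.chain ?S C"
    have "C \<subseteq> ?S" using C(2) by (simp add: subset_chain_def)
    then have CS: "ideal_of A J" "I \<subseteq> J" "1 \<notin> J" if "J \<in> C" for J
      using that by blast+
    have dir: "\<exists>J\<in>C. x \<in> J \<and> y \<in> J" if "x \<in> \<Union>C" "y \<in> \<Union>C" for x y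
    proof -
      from that(1) obtain J where J: "J \<in> C" "x \<in> J" by (rule UnionE)
      from that(2) obtain K where K: "K \<in> C" "y \<in> K" by (rule UnionE)
      have "J \<subseteq> K \<or> K \<subseteq> J"
        using C(2) J(1) K(1) unfolding subset_chain_def by blast
      then show ?thesis using J K by blast
    qed
    have "ideal_of A (\<Union>C)"
      unfolding ideal_of_def
    proof (intro conjI ballI)
      show "\<Union>C \<subseteq> A" using CS(1) unfolding ideal_of_def by blast
      show "0 \<in> \<Union>C" using CS(1) C(1) by (auto simp: ideal_of_def)
      show "x + y \<in> \<Union>C" if "x \<in> \<Union>C" "y \<in> \<Union>C" for x y
        using dir[OF that] CS(1) unfolding ideal_of_def by blast
      show "a * x \<in> \<Union>C" if "a \<in> A" "x \<in> \<Union>C" for a x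
        using that CS(1) unfolding ideal_of_def by blast
    qed
    then show "\<Union>C \<in> ?S" using CS(2,3) C(1) by blast
  qed
  then obtain M where M': "M \<in> ?S" "\<forall>X\<in>?S. M \<subseteq> X \<longrightarrow> X = M" ..
  then have M: "ideal_of A M" "I \<subseteq> M" "1 \<notin> M" by simp_all
  have max: "X = M" if "ideal_of A X" "M \<subseteq> X" "1 \<notin> X" for X
    using M' that by (simp add: subset_trans[OF M(2)])
  note MD = M(1)[unfolded ideal_of_def]
  have grow: "\<exists>x\<in>M. \<exists>c\<in>A. 1 = x + c * a" if a: "a \<in> A" "a \<notin> M" for a
  proof (rule ccontr)
    let ?X = "{x + c * a | x c. x \<in> M \<and> c \<in> A}"
    assume "\<not> ?thesis"
    then have "1 \<notin> ?X" by blast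
    moreover have "ideal_of A ?X"
      unfolding ideal_of_def
    proof (intro conjI ballI)
      show "?X \<subseteq> A" using MD a(1) by auto
      show "0 \<in> ?X" using MD by (auto intro!: exI[of _ 0])
      show "x + y \<in> ?X" if xy: "x \<in> ?X" "y \<in> ?X" for x y
      proof -
        obtain x1 c1 x2 c2 where *: "x = x1 + c1 * a" "y = x2 + c2 * a" "x1 \<in> M" "x2 \<in> M" "c1 \<in> A" "c2 \<in> A"
          using xy by blast
        then have "x + y = (x1 + x2) + (c1 + c2) * a" by (simp add: algebra_simps)
        then show ?thesis using * MD by blast
      qed
      show "b * x \<in> ?X" if bx: "b \<in> A" "x \<in> ?X" for b x
      proof -
        obtain x1 c1 where *: "x = x1 + c1 * a" "x1 \<in> M" "c1 \<in> A" using bx by blast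
        then have "b * x = b * x1 + (b * c1) * a" by (simp add: algebra_simps)
        then show ?thesis using * MD bx(1) by blast
      qed
    qed
    moreover have "M \<subseteq> ?X"
    proof
      fix x assume "x \<in> M"
      moreover have "x = x + 0 * a" by simp
      ultimately show "x \<in> ?X" using zero by blast
    qed
    ultimately have "?X = M" by (intro max)
    moreover have "a = 0 + 1 * a" by simp
    then have "a \<in> ?X" using MD one by blast
    ultimately show False using a(2) by blast
  qed
  show thesis
  proof (rule that[OF M])
    fix a b assume ab: "a \<in> A" "b \<in> A" "a * b \<in> M"
    show "a \<in> M \<or> b \<in> M"
    proof (rule ccontr)
      assume "\<not> (a \<in> M \<or> b \<in> M)"
      then obtain x c y e where *: "x \<in> M" "c \<in> A" "1 = x + c * a" "y \<in> M" "e \<in> A" "1 = y + e * b"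
        using grow[OF ab(1)] grow[OF ab(2)] by blast
      have "1 = (x + c * a) * (y + e * b)" using *(3,6) by simp
      also have "\<dots> = (y + e * b) * x + (c * a) * y + (c * e) * (a * b)" by (simp add: algebra_simps)
      also have "\<dots> \<in> M"
      proof -
        have "y + e * b \<in> A" "c * a \<in> A" "c * e \<in> A" using *(2,4,5) ab(1,2) MD by auto
        then show ?thesis using *(1,4) ab(3) MD by blast
      qed
      finally show False using M(3) by blast
    qed
  qed
qed

text \<open>Localisation of a subring of a field at a prime ideal, again as a subring of the field.\<close>

locale prime_localization = subring A for A :: "'f::field set" +
  fixes P :: "'f set"
  assumes P_ideal: "ideal_of A P" and P_one: "1 \<notin> P"
    and P_prime: "a \<in> A \<Longrightarrow> b \<in> A \<Longrightarrow> a * b \<in> P \<Longrightarrow> a \<in> P \<or> b \<in> P"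
begin

definition loc :: "'f set" where "loc = {a / s | a s. a \<in> A \<and> s \<in> A \<and> s \<notin> P}"
definition locP :: "'f set" where "locP = {a / s | a s. a \<in> P \<and> s \<in> A \<and> s \<notin> P}"

lemma P_facts: "0 \<in> P" "x \<in> P \<Longrightarrow> y \<in> P \<Longrightarrow> x + y \<in> P" "a \<in> A \<Longrightarrow> x \<in> P \<Longrightarrow> a * x \<in> P" "x \<in> P \<Longrightarrow> x \<in> A"
  using P_ideal by (auto simp: ideal_of_def)

lemma den_mult: "s \<in> A \<Longrightarrow> s \<notin> P \<Longrightarrow> t \<in> A \<Longrightarrow> t \<notin> P \<Longrightarrow> s * t \<in> A \<and> s * t \<notin> P"
  using P_prime by blast

lemma den_nz: "s \<notin> P \<Longrightarrow> s \<noteq> 0" using P_facts(1) by blast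

lemma locI: "a \<in> A \<Longrightarrow> s \<in> A \<Longrightarrow> s \<notin> P \<Longrightarrow> a / s \<in> loc" by (auto simp: loc_def)
lemma locPI: "a \<in> P \<Longrightarrow> s \<in> A \<Longrightarrow> s \<notin> P \<Longrightarrow> a / s \<in> locP" by (auto simp: locP_def)

lemma A_loc: "a \<in> A \<Longrightarrow> a \<in> loc" using locI[of a 1] P_one by simp

sublocale L: local_subring loc locP
proof
  show "0 \<in> loc" "1 \<in> loc" by (auto intro: A_loc)
  show "0 \<in> locP" using locPI[OF P_facts(1) one P_one] by simp
  show "- a \<in> loc" if "a \<in> loc" for a
    using that by (auto simp: loc_def) (metis minus_divide_left uminus)
  show "a + b \<in> loc" if "a \<in> loc" "b \<in> loc" for a b
  proof -
    obtain x s y t where *: "a = x / s" "b = y / t" "x \<in> A" "y \<in> A" "s \<in> A" "t \<in> A" "s \<notin> P" "t \<notin> P"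
      using \<open>a \<in> loc\<close> \<open>b \<in> loc\<close> by (auto simp: loc_def)
    then have "a + b = (x * t + y * s) / (s * t)" by (simp add: add_frac_eq den_nz)
    then show ?thesis using locI[of "x * t + y * s" "s * t"] den_mult[of s t] * by (auto intro: add mult)
  qed
  show "a * b \<in> loc" if "a \<in> loc" "b \<in> loc" for a b
  proof -
    obtain x s y t where *: "a = x / s" "b = y / t" "x \<in> A" "y \<in> A" "s \<in> A" "t \<in> A" "s \<notin> P" "t \<notin> P"
      using \<open>a \<in> loc\<close> \<open>b \<in> loc\<close> by (auto simp: loc_def)
    then show ?thesis using locI[of "x * y" "s * t"] den_mult[of s t] by (auto intro: mult)
  qed
  show "a + b \<in> locP" if "a \<in> locP" "b \<in> locP" for a b
  proof -
    obtain x s y t where *: "a = x / s" "b = y / t" "x \<in> P" "y \<in> P" "s \<in> A" "t \<in> A" "s \<notin> P" "t \<notin> P"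
      using \<open>a \<in> locP\<close> \<open>b \<in> locP\<close> by (auto simp: locP_def)
    then have "a + b = (t * x + s * y) / (s * t)" by (simp add: add_frac_eq den_nz mult.commute)
    then show ?thesis using locPI[of "t * x + s * y" "s * t"] den_mult[of s t] * P_facts by auto
  qed
  show "a * b \<in> locP" if "a \<in> loc" "b \<in> locP" for a b
  proof -
    obtain x s y t where *: "a = x / s" "b = y / t" "x \<in> A" "y \<in> P" "s \<in> A" "t \<in> A" "s \<notin> P" "t \<notin> P"
      using \<open>a \<in> loc\<close> \<open>b \<in> locP\<close> by (auto simp: loc_def locP_def)
    then show ?thesis using locPI[of "x * y" "s * t"] den_mult[of s t] P_facts by auto
  qed
  show "1 \<notin> locP"
  proof
    assume "1 \<in> locP"
    then obtain x s where "1 = x / s" "x \<in> P" "s \<notin> P" by (auto simp: locP_def)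
    then show False using den_nz by (simp add: field_simps)
  qed
  show "\<exists>c\<in>loc. c * a = 1" if "a \<in> loc" "a \<notin> locP" for a
  proof -
    obtain x s where *: "a = x / s" "x \<in> A" "s \<in> A" "s \<notin> P" using \<open>a \<in> loc\<close> by (auto simp: loc_def)
    then have "x \<notin> P" using that(2) locPI by blast
    then show ?thesis using * locI[of s x] den_nz by (intro bexI[of _ "s / x"]) auto
  qed
qed

lemma common_denominator:
  assumes "finite S" "S \<subseteq> loc"
  shows "\<exists>d. d \<in> A \<and> d \<notin> P \<and> (\<forall>b\<in>S. d * b \<in> A)"
  using assms
proof (induction S)
  case empty
  then show ?case using P_one by blast
next
  case (insert b S)
  then obtain d where d: "d \<in> A" "d \<notin> P" "\<forall>b\<in>S. d * b \<in> A" by auto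
  from insert obtain x s where b: "b = x / s" "x \<in> A" "s \<in> A" "s \<notin> P" by (auto simp: loc_def)
  have "d * s * b' \<in> A" if "b' \<in> insert b S" for b'
  proof (cases "b' = b")
    case True
    then have eq: "d * s * b' = d * x" using b(1) den_nz[OF b(4)] by simp
    show ?thesis unfolding eq using d(1) b(2) by blast
  next
    case False
    then have "s * (d * b') \<in> A" using that d b by blast
    then show ?thesis by (simp add: ac_simps)
  qed
  then show ?case using den_mult[of d s] d b by blast
qed

lemma common_denominator_mats:
  assumes "G \<in> mats (poly_over loc) m" "H \<in> mats (poly_over loc) m"
  obtains d where "d \<in> A" "d \<notin> P" "\<And>i j. i < m \<Longrightarrow> j < m \<Longrightarrow> smult d (G i j) \<in> poly_over A"
    "\<And>i j. i < m \<Longrightarrow> j < m \<Longrightarrow> smult d (H i j) \<in> poly_over A"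
proof -
  define S where "S = (\<Union>i<m. \<Union>j<m. set (coeffs (G i j)) \<union> set (coeffs (H i j)))"
  have "S \<subseteq> loc"
    using assms by (auto simp: S_def mats_def poly_over_def coeffs_def split: if_splits)
  moreover have "finite S" by (auto simp: S_def)
  ultimately obtain d where d: "d \<in> A" "d \<notin> P" "\<forall>b\<in>S. d * b \<in> A" using common_denominator by blast
  have *: "smult d p \<in> poly_over A" if "set (coeffs p) \<subseteq> S" for p
    unfolding poly_over_def
  proof (intro CollectI allI)
    fix i
    have "coeff p i = 0 \<or> coeff p i \<in> S"
      using that coeff_in_coeffs[of p i] by (cases "p = 0"; cases "i \<le> degree p") (auto simp: coeff_eq_0)
    then show "coeff (smult d p) i \<in> A" using d(3) by auto
  qed
  show thesis
  proof (rule that[OF d(1,2)])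
    fix i j assume "i < m" "j < m"
    then have "set (coeffs (G i j)) \<subseteq> S" "set (coeffs (H i j)) \<subseteq> S" unfolding S_def by blast+
    then show "smult d (G i j) \<in> poly_over A" "smult d (H i j) \<in> poly_over A" by (auto intro: *)
  qed
qed

end

lemma smult_cancel: "smult d p = smult d q \<Longrightarrow> p = q" if "d \<noteq> 0" for d :: "'f::field"
  using that by (simp add: poly_eq_iff)

text \<open>If \<open>d\<close> clears the denominators of \<open>G\<close> and \<open>H\<close> and \<open>p - q\<close> is divisible by \<open>d\<^sup>2\<close>, then
  \<open>H(q) G(p) = 1 + H(q) (G(p) - G(q))\<close> has no denominators.\<close>

lemma transition_over:
  fixes A :: "'f::field set"
  assumes "subring A" and d: "d \<in> A" "d \<noteq> 0"
    and G: "\<And>i j. i < m \<Longrightarrow> j < m \<Longrightarrow> smult d (G i j) \<in> poly_over A"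
    and H: "\<And>i j. i < m \<Longrightarrow> j < m \<Longrightarrow> smult d (H i j) \<in> poly_over A"
    and HG: "\<And>i j. i < m \<Longrightarrow> j < m \<Longrightarrow> mmul m H G i j = unit_vec i j"
    and p: "p \<in> poly_over A" and q: "q \<in> poly_over A" and a: "a \<in> poly_over A" "p - q = smult (d * d) a"
  shows "mmul m (\<lambda>i j. pcompose (H i j) q) (\<lambda>i j. pcompose (G i j) p) \<in> mats (poly_over A) m"
  unfolding mats_def
proof (intro CollectI allI impI)
  interpret subring A by fact
  interpret P: subring "poly_over A" by (rule subring_poly_over)
  fix i j assume ij: "i < m" "j < m"
  have "mmul m (\<lambda>i j. pcompose (H i j) q) (\<lambda>i j. pcompose (G i j) p) i j =
      (\<Sum>k<m. pcompose (H i k) q * pcompose (G k j) q) + (\<Sum>k<m. pcompose (H i k) q * (pcompose (G k j) p - pcompose (G k j) q))"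
    by (simp add: mmul_def algebra_simps flip: sum.distrib)
  also have "(\<Sum>k<m. pcompose (H i k) q * pcompose (G k j) q) = pcompose (mmul m H G i j) q"
    by (simp add: mmul_def pcompose_sum pcompose_mult)
  also have "\<dots> = unit_vec i j" by (simp add: HG[OF ij] unit_vec_def pcompose_1)
  finally have eq: "mmul m (\<lambda>i j. pcompose (H i j) q) (\<lambda>i j. pcompose (G i j) p) i j =
      unit_vec i j + (\<Sum>k<m. pcompose (H i k) q * (pcompose (G k j) p - pcompose (G k j) q))" .
  have "pcompose (H i k) q * (pcompose (G k j) p - pcompose (G k j) q) \<in> poly_over A" if k: "k < m" for k
  proof -
    obtain r where r: "r \<in> poly_over A" "pcompose (smult d (G k j)) p - pcompose (smult d (G k j)) q = (p - q) * r"
      using pcompose_diff_over[OF G[OF k ij(2)] p q] by blast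
    have "smult d (pcompose (G k j) p - pcompose (G k j) q) = smult d (smult d (a * r))"
      using r(2) by (simp add: pcompose_smult a(2) smult_diff_right)
    then have "pcompose (G k j) p - pcompose (G k j) q = smult d (a * r)"
      by (rule smult_cancel[OF d(2)])
    then have "pcompose (H i k) q * (pcompose (G k j) p - pcompose (G k j) q) = pcompose (smult d (H i k)) q * (a * r)"
      by (simp add: pcompose_smult)
    then show ?thesis using pcompose_over[OF H[OF ij(1) k] q] a(1) r(1) by (auto intro: P.mult)
  qed
  then show "mmul m (\<lambda>i j. pcompose (H i j) q) (\<lambda>i j. pcompose (G i j) p) i j \<in> poly_over A"
    unfolding eq by (auto intro!: P.add P.sum_mem simp: unit_vec_def)
qed

text \<open>Vaserstein's argument. The elements \<open>c\<close> of \<open>A\<close> such that \<open>v(p)\<close> and \<open>v(q)\<close> are equivalent whenever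
  \<open>c\<close> divides \<open>p - q\<close> form an ideal. For every prime ideal \<open>Q\<close> the vector \<open>v\<close> is equivalent over the
  localisation to a basis vector, which does not depend on the variable. The square of a common
  denominator of the matrices involved lies in the ideal but not in \<open>Q\<close>. So the ideal contains one,
  and \<open>p\<close> and \<open>q\<close> can be taken to be the variable and zero.\<close>

theorem monic_unimodular_equiv_constant:
  fixes A :: "'f::field set"
  assumes "subring A" "3 \<le> m" and v: "\<And>i. i < m \<Longrightarrow> v i \<in> poly_over A" "unimodular (poly_over A) m v"
    and l: "l < m" "coeff (v l) d = 1" "\<And>i. i > d \<Longrightarrow> coeff (v l) i = 0"
  shows "unit_equiv (poly_over A) m v (\<lambda>i. [:coeff (v i) 0:])"
proof -
  interpret subring A by fact
  interpret P: subring "poly_over A" by (rule subring_poly_over)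
  define I where "I = {c\<in>A. \<forall>p q a. p \<in> poly_over A \<longrightarrow> q \<in> poly_over A \<longrightarrow> a \<in> poly_over A \<longrightarrow> p - q = smult c a \<longrightarrow>
    unit_equiv (poly_over A) m (\<lambda>i. pcompose (v i) p) (\<lambda>i. pcompose (v i) q)}"
  have ID: "unit_equiv (poly_over A) m (\<lambda>i. pcompose (v i) p) (\<lambda>i. pcompose (v i) q)"
    if "c \<in> I" "p \<in> poly_over A" "q \<in> poly_over A" "a \<in> poly_over A" "p - q = smult c a" for c p q a
    using that unfolding I_def by blast
  have "ideal_of A I"
    unfolding ideal_of_def
  proof (intro conjI ballI)
    show "I \<subseteq> A" by (auto simp: I_def)
    show "0 \<in> I" by (auto simp: I_def P.unit_equiv_refl)
    show "x + y \<in> I" if xy: "x \<in> I" "y \<in> I" for x y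
      unfolding I_def
    proof (intro CollectI conjI allI impI)
      show "x + y \<in> A" using xy by (auto simp: I_def)
      fix p q a assume *: "p \<in> poly_over A" "q \<in> poly_over A" "a \<in> poly_over A" "p - q = smult (x + y) a"
      have xA: "x \<in> A" using xy(1) by (auto simp: I_def)
      have m: "p - smult x a \<in> poly_over A" using * xA by (auto intro: smult_over)
      have "unit_equiv (poly_over A) m (\<lambda>i. pcompose (v i) p) (\<lambda>i. pcompose (v i) (p - smult x a))"
        by (rule ID[OF xy(1) *(1) m *(3)]) simp
      also have "unit_equiv (poly_over A) m (\<lambda>i. pcompose (v i) (p - smult x a)) (\<lambda>i. pcompose (v i) q)"
        by (rule ID[OF xy(2) m *(2,3)]) (use *(4) in \<open>simp add: algebra_simps smult_add_left\<close>)
      finally show "unit_equiv (poly_over A) m (\<lambda>i. pcompose (v i) p) (\<lambda>i. pcompose (v i) q)" .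
    qed
    show "b * x \<in> I" if bx: "b \<in> A" "x \<in> I" for b x
      unfolding I_def
    proof (intro CollectI conjI allI impI)
      show "b * x \<in> A" using bx by (auto simp: I_def)
      fix p q a assume *: "p \<in> poly_over A" "q \<in> poly_over A" "a \<in> poly_over A" "p - q = smult (b * x) a"
      show "unit_equiv (poly_over A) m (\<lambda>i. pcompose (v i) p) (\<lambda>i. pcompose (v i) q)"
        by (rule ID[OF bx(2) *(1,2) smult_over[OF bx(1) *(3)]]) (use *(4) in \<open>simp add: mult.commute\<close>)
    qed
  qed
  moreover have "1 \<in> I"
  proof (rule ccontr)
    assume "1 \<notin> I"
    then obtain Q where Q: "ideal_of A Q" "I \<subseteq> Q" "1 \<notin> Q"
        "\<And>a b. a \<in> A \<Longrightarrow> b \<in> A \<Longrightarrow> a * b \<in> Q \<Longrightarrow> a \<in> Q \<or> b \<in> Q"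
      using prime_ideal_exists[OF \<open>ideal_of A I\<close>] by metis
    interpret Q: prime_localization A Q by standard (use Q in auto)
    interpret LP: subring "poly_over Q.loc" by (rule Q.L.subring_poly_over)
    have sub: "poly_over A \<subseteq> poly_over Q.loc" using Q.A_loc by (auto simp: poly_over_def)
    have "unimodular (poly_over Q.loc) m v" using v(2) sub unfolding unimodular_def by blast
    then have "unit_equiv (poly_over Q.loc) m v (unit_vec 0)"
      using v(1) sub l by (intro Q.L.local_unimodular_monic[where m = m and v = v and l = l and d = d] assms(2)) auto
    then obtain G H where GH: "G \<in> mats (poly_over Q.loc) m" "H \<in> mats (poly_over Q.loc) m" "inverse_mats m G H"
        "\<forall>i<m. mvec m G v i = unit_vec 0 i"
      unfolding unit_equiv_def by blast
    obtain e where e: "e \<in> A" "e \<notin> Q" "\<And>i j. i < m \<Longrightarrow> j < m \<Longrightarrow> smult e (G i j) \<in> poly_over A"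
        "\<And>i j. i < m \<Longrightarrow> j < m \<Longrightarrow> smult e (H i j) \<in> poly_over A"
      by (rule Q.common_denominator_mats[OF GH(1,2)]) blast
    have e0: "e \<noteq> 0" using e(2) Q.den_nz by blast
    have HG: "\<And>i j. i < m \<Longrightarrow> j < m \<Longrightarrow> mmul m H G i j = unit_vec i j"
      using GH(3) by (auto simp: inverse_mats_def)
    have "e * e \<in> I"
      unfolding I_def
    proof (intro CollectI conjI allI impI)
      show "e * e \<in> A" using e(1) by blast
      fix p q a assume *: "p \<in> poly_over A" "q \<in> poly_over A" "a \<in> poly_over A" "p - q = smult (e * e) a"
      define c where "c F r = (\<lambda>i j. pcompose (F i j) r)" for F :: "nat \<Rightarrow> nat \<Rightarrow> 'f poly" and r
      have c_mm: "mmul m (c F r) (c F' r) i j = pcompose (mmul m F F' i j) r" for F F' r i j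
        by (simp add: c_def mmul_def pcompose_sum pcompose_mult)
      have c_inv: "inverse_mats m (c G r) (c H r)" "inverse_mats m (c H r) (c G r)" for r
        using GH(3) by (auto simp: inverse_mats_def c_mm) (auto simp: unit_vec_def pcompose_1)
      have c_v: "mvec m (c G r) (\<lambda>i. pcompose (v i) r) i = unit_vec 0 i" if "i < m" for r i
      proof -
        have "mvec m (c G r) (\<lambda>i. pcompose (v i) r) i = pcompose (mvec m G v i) r"
          by (simp add: c_def mvec_def pcompose_sum pcompose_mult)
        then show ?thesis using GH(4) that by (simp add: unit_vec_def pcompose_1)
      qed
      have qp: "q - p = smult (e * e) (- a)"
        unfolding smult_minus_right *(4)[symmetric] by simp
      have "mmul m (c H q) (c G p) \<in> mats (poly_over A) m"
        unfolding c_def by (rule transition_over[OF assms(1) e(1) e0 e(3,4) HG *])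
      moreover have "mmul m (c H p) (c G q) \<in> mats (poly_over A) m"
        unfolding c_def
        by (rule transition_over[OF assms(1) e(1) e0 e(3,4) HG *(2,1) P.uminus[OF *(3)] qp])
      moreover have "inverse_mats m (mmul m (c H q) (c G p)) (mmul m (c H p) (c G q))"
        by (rule inverse_mats_mmul[OF c_inv(1) c_inv(2)])
      moreover have "mvec m (mmul m (c H q) (c G p)) (\<lambda>i. pcompose (v i) p) i = pcompose (v i) q" if "i < m" for i
      proof -
        have "mvec m (mmul m (c H q) (c G p)) (\<lambda>i. pcompose (v i) p) i
            = mvec m (c H q) (mvec m (c G q) (\<lambda>i. pcompose (v i) q)) i"
          unfolding mvec_mmul by (rule mvec_cong) (simp add: c_v)
        then show ?thesis using inverse_mats_cancel(1)[OF c_inv(1) that] by simp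
      qed
      ultimately show "unit_equiv (poly_over A) m (\<lambda>i. pcompose (v i) p) (\<lambda>i. pcompose (v i) q)"
        unfolding unit_equiv_def by blast
    qed
    then have "e * e \<in> Q" using Q(2) by blast
    then show False using Q(4) e(1,2) by blast
  qed
  ultimately have "unit_equiv (poly_over A) m (\<lambda>i. pcompose (v i) [:0, 1:]) (\<lambda>i. pcompose (v i) 0)"
    by (intro ID[of 1 _ _ "[:0, 1:]"]) auto
  then show ?thesis by (simp add: pcompose_0')
qed

section \<open>Unimodular vectors over Laurent polynomials\<close>

lemma (in subring) unimodular_1:
  assumes "unimodular A 1 v" "v 0 \<in> A"
  shows "unit_equiv A 1 v (unit_vec 0)"
proof -
  obtain u where "u 0 \<in> A" "u 0 * v 0 = 1" using assms(1) by (auto simp: unimodular_def)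
  then show ?thesis using assms(2) by (intro unit_equiv_scale[of 1 "\<lambda>_. u 0" "\<lambda>_. v 0"]) (auto simp: unit_vec_def)
qed

lemma (in subring) unimodular_2:
  assumes "unimodular A 2 v" "v 0 \<in> A" "v 1 \<in> A"
  shows "unit_equiv A 2 v (unit_vec 0)"
proof -
  obtain u where "\<forall>i<2. u i \<in> A" "(\<Sum>i<2. u i * v i) = 1"
    using assms(1) unfolding unimodular_def by blast
  then have u: "u 0 \<in> A" "u 1 \<in> A" "u 0 * v 0 + u 1 * v 1 = 1"
    by (simp_all add: numeral_2_eq_2)
  define G where "G i j = (if i = 0 then u j else if j = 0 then - v 1 else v 0)" for i j :: nat
  define H where "H i j = (if j = 0 then v i else if i = 0 then - u 1 else u 0)" for i j :: nat
  have two: "i < 2 \<longleftrightarrow> i = 0 \<or> i = 1" for i :: nat by auto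
  have "G \<in> mats A 2" "H \<in> mats A 2"
    using u assms(2,3) by (auto simp: mats_def G_def H_def two)
  moreover have "inverse_mats 2 G H"
    unfolding inverse_mats_def
  proof (intro allI impI)
    fix i j :: nat assume "i < 2" "j < 2"
    have mm: "mmul 2 F F' i j = F i 0 * F' 0 j + F i 1 * F' 1 j" for F F' :: "nat \<Rightarrow> nat \<Rightarrow> 'r"
      by (simp add: mmul_def numeral_2_eq_2)
    have "(i = 0 \<or> i = 1) \<and> (j = 0 \<or> j = 1)" using \<open>i < 2\<close> \<open>j < 2\<close> by auto
    then show "mmul 2 G H i j = unit_vec i j \<and> mmul 2 H G i j = unit_vec i j"
      using u(3) unfolding mm by (elim conjE disjE) (simp_all add: G_def H_def unit_vec_def algebra_simps)
  qed
  moreover have "mvec 2 G v i = unit_vec 0 i" if "i < 2" for i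
  proof -
    have "i = 0 \<or> i = 1" using that by auto
    then show ?thesis using u(3) by (elim disjE) (simp_all add: mvec_def numeral_2_eq_2 G_def unit_vec_def algebra_simps)
  qed
  ultimately show ?thesis unfolding unit_equiv_def by blast
qed

text \<open>A row that generates a power of the variable and has an entry with invertible constant
  coefficient is unimodular, as the two ideals are comaximal.\<close>

lemma (in subring) unimodular_from_power:
  assumes V: "\<And>i. i < m \<Longrightarrow> V i \<in> poly_over A" and Q: "\<And>i. i < m \<Longrightarrow> Q i \<in> poly_over A"
    and sum: "(\<Sum>i<m. Q i * V i) = monom 1 K" and l: "l < m" and a: "a \<in> A" "a * coeff (V l) 0 = 1"
  shows "unimodular (poly_over A) m V"
proof -
  interpret P: subring "poly_over A" by (rule subring_poly_over)
  define W where "W = smult a (V l)"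
  have W: "W \<in> poly_over A" unfolding W_def by (rule smult_over[OF a(1) V[OF l]])
  obtain c g where cg: "W = pCons c g" by (cases W)
  have "c = 1" using a(2) arg_cong[OF cg, of "\<lambda>p. coeff p 0"] by (simp add: W_def)
  have g: "g \<in> poly_over A" using W cg by simp
  define y where "y = - pCons 0 g"
  have y: "1 - y = W" by (simp add: y_def cg \<open>c = 1\<close> one_pCons)
  have y_over: "y \<in> poly_over A" using g P.uminus[of "pCons 0 g"] by (simp add: y_def)
  have yK: "y ^ K = (- g) ^ K * monom 1 K"
  proof -
    have y': "y = (- g) * monom 1 1" by (simp add: y_def monom_altdef mult.commute)
    show ?thesis unfolding y' power_mult_distrib monom_power by simp
  qed
  define S where "S = (\<Sum>i<K. y ^ i)"
  have S: "S \<in> poly_over A" unfolding S_def using y_over by (intro P.sum_mem P.power_mem)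
  have one: "1 = S * W + (- g) ^ K * monom 1 K"
    using one_diff_power_eq[of y K] by (simp add: y yK S_def mult.commute algebra_simps)
  define u where "u i = (- g) ^ K * Q i + (if i = l then smult a S else 0)" for i
  have "(\<Sum>i<m. u i * V i) = (- g) ^ K * (\<Sum>i<m. Q i * V i) + (\<Sum>i<m. if i = l then smult a S * V i else 0)"
    by (simp add: u_def distrib_right sum.distrib sum_distrib_left mult.assoc if_distrib[of "\<lambda>x. x * _"] cong: if_cong)
  also have "\<dots> = 1" using l unfolding sum by (subst one) (simp add: W_def)
  finally have "(\<Sum>i<m. u i * V i) = 1" .
  moreover have "u i \<in> poly_over A" if "i < m" for i
    unfolding u_def using Q[OF that] g S a(1) by (auto intro!: P.add P.mult P.power_mem P.uminus smult_over)
  ultimately show ?thesis unfolding unimodular_def by blast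
qed

text \<open>Multiplying the entries by units turns the Laurent polynomials into polynomials \<open>V\<close>, of which the
  \<open>l\<close>-th is the monic \<open>f\<close>. The vector \<open>V\<close> is unimodular even over \<open>A[x]\<close>, because \<open>f\<close> has an invertible
  constant coefficient, and therefore equivalent to \<open>V(0)\<close>, whose \<open>l\<close>-th entry is a unit.\<close>

theorem laurent_unimodular:
  fixes A R :: "'f::field set" and x :: 'f
  assumes "subring A" "subring R" and AR: "A \<subseteq> R" and x: "x \<noteq> 0" "x \<in> R" "inverse x \<in> R"
    and trans: "\<And>p. p \<in> poly_over A \<Longrightarrow> poly p x = 0 \<Longrightarrow> p = 0"
    and rep: "\<And>r. r \<in> R \<Longrightarrow> \<exists>p\<in>poly_over A. \<exists>n. r * x ^ n = poly p x"
    and m: "3 \<le> m" and v: "\<And>i. i < m \<Longrightarrow> v i \<in> R" "unimodular R m v"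
    and l: "l < m" and f: "f \<in> poly_over A" "coeff f d = 1" "\<And>i. i > d \<Longrightarrow> coeff f i = 0" "a \<in> A" "a * coeff f 0 = 1"
    and y: "y \<in> R" "y' \<in> R" "y * y' = 1" "y * v l = poly f x"
  shows "unit_equiv R m v (unit_vec 0)"
proof -
  interpret A: subring A by fact
  interpret R: subring R by fact
  interpret P: subring "poly_over A" by (rule A.subring_poly_over)
  have rep': "\<exists>n. \<forall>k\<ge>n. \<exists>p\<in>poly_over A. r * x ^ k = poly p x" if "r \<in> R" for r
  proof -
    obtain p n where p: "p \<in> poly_over A" "r * x ^ n = poly p x" using rep[OF \<open>r \<in> R\<close>] by blast
    have "\<exists>p\<in>poly_over A. r * x ^ k = poly p x" if "k \<ge> n" for k
    proof (intro bexI)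
      have "r * x ^ k = r * x ^ n * x ^ (k - n)" using that by (simp flip: power_add add: mult.assoc)
      then show "r * x ^ k = poly (p * monom 1 (k - n)) x" by (simp add: p(2) poly_monom)
      show "p * monom 1 (k - n) \<in> poly_over A" using p(1) by (intro P.mult A.monom_over) auto
    qed
    then show ?thesis by blast
  qed
  have rep_all: "\<exists>L p. \<forall>i<m. p i \<in> poly_over A \<and> r i * x ^ L = poly (p i) x" if "\<And>i. i < m \<Longrightarrow> r i \<in> R" for r
  proof -
    have "\<forall>i\<in>{..<m}. \<exists>n. \<forall>k\<ge>n. \<exists>p\<in>poly_over A. r i * x ^ k = poly p x"
      using rep' that by blast
    then obtain n where n: "\<And>i k. i < m \<Longrightarrow> k \<ge> n i \<Longrightarrow> \<exists>p\<in>poly_over A. r i * x ^ k = poly p x"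
      by (metis lessThan_iff)
    have "n i \<le> sum n {..<m}" if "i < m" for i
      using that by (intro member_le_sum) auto
    then have "\<forall>i\<in>{..<m}. \<exists>p. p \<in> poly_over A \<and> r i * x ^ sum n {..<m} = poly p x"
      using n by blast
    then show ?thesis by (metis lessThan_iff)
  qed
  have "\<exists>L p. \<forall>i<m. p i \<in> poly_over A \<and> v i * x ^ L = poly (p i) x"
    by (rule rep_all) (rule v(1))
  then obtain L p where "\<forall>i<m. p i \<in> poly_over A \<and> v i * x ^ L = poly (p i) x"
    by (elim exE) (rule that)
  then have Lp: "\<And>i. i < m \<Longrightarrow> p i \<in> poly_over A" "\<And>i. i < m \<Longrightarrow> v i * x ^ L = poly (p i) x"
    by simp_all
  define V where "V i = (if i = l then f else p i)" for i
  have V: "V i \<in> poly_over A" if "i < m" for i using Lp(1)[OF that] f(1) by (simp add: V_def)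
  have xL: "x ^ L \<in> R" "inverse x ^ L \<in> R" "x ^ L * inverse x ^ L = 1"
    using x by (auto simp flip: power_mult_distrib)
  have vV: "unit_equiv R m v (\<lambda>i. poly (V i) x)"
    by (rule R.unit_equiv_scale[of m "\<lambda>i. if i = l then y else x ^ L" "\<lambda>i. if i = l then y' else inverse x ^ L"])
       (use y xL Lp(2) in \<open>auto simp: V_def mult.commute\<close>)
  obtain u where u': "\<forall>i<m. u i \<in> R" "(\<Sum>i<m. u i * poly (V i) x) = 1"
    using R.unimodular_unit_equiv[OF vV v(2)] unfolding unimodular_def by (elim exE conjE) (rule that)
  then have u: "\<And>i. i < m \<Longrightarrow> u i \<in> R" "(\<Sum>i<m. u i * poly (V i) x) = 1" by simp_all
  have "\<exists>K Q. \<forall>i<m. Q i \<in> poly_over A \<and> u i * x ^ K = poly (Q i) x"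
    by (rule rep_all) (rule u(1))
  then obtain K Q where "\<forall>i<m. Q i \<in> poly_over A \<and> u i * x ^ K = poly (Q i) x"
    by (elim exE) (rule that)
  then have KQ: "\<And>i. i < m \<Longrightarrow> Q i \<in> poly_over A" "\<And>i. i < m \<Longrightarrow> u i * x ^ K = poly (Q i) x"
    by simp_all
  have "poly ((\<Sum>i<m. Q i * V i) - monom 1 K) x = (\<Sum>i<m. poly (Q i) x * poly (V i) x) - x ^ K"
    by (simp add: poly_sum poly_monom)
  also have "\<dots> = (\<Sum>i<m. u i * x ^ K * poly (V i) x) - x ^ K"
    using KQ(2) by simp
  also have "\<dots> = x ^ K * (\<Sum>i<m. u i * poly (V i) x) - x ^ K"
    by (simp add: sum_distrib_left ac_simps)
  finally have "poly ((\<Sum>i<m. Q i * V i) - monom 1 K) x = 0" by (simp add: u(2))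
  moreover have "(\<Sum>i<m. Q i * V i) - monom 1 K \<in> poly_over A"
    using KQ(1) V by (intro P.diff P.sum_mem P.mult A.monom_over) auto
  ultimately have "(\<Sum>i<m. Q i * V i) - monom 1 K = 0" by (intro trans)
  then have sumK: "(\<Sum>i<m. Q i * V i) = monom 1 K" by simp
  have "unimodular (poly_over A) m V"
    by (rule A.unimodular_from_power[where Q = Q and K = K and l = l and a = a],
        fact V, fact KQ(1), fact sumK, fact l, fact f(4)) (simp add: V_def f(5))
  then have "unit_equiv (poly_over A) m V (\<lambda>i. [:coeff (V i) 0:])"
    using f V by (intro monic_unimodular_equiv_constant[where l = l and d = d] assms(1) m l) (auto simp: V_def)
  also have "unit_equiv (poly_over A) m (\<lambda>i. [:coeff (V i) 0:]) (\<lambda>i. if i = l then 1 else [:coeff (V i) 0:])"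
    by (rule P.unit_equiv_scale[of m "\<lambda>i. if i = l then [:a:] else 1" "\<lambda>i. if i = l then [:coeff f 0:] else 1"])
       (use f A.poly_over_coeff[OF f(1)] in \<open>auto simp: V_def one_pCons mult.commute\<close>)
  also have "unit_equiv (poly_over A) m (\<lambda>i. if i = l then 1 else [:coeff (V i) 0:]) (unit_vec 0)"
    by (rule P.unit_equiv_unit_vector[of m _ l 0]) (use l A.poly_over_coeff[OF V] in auto)
  finally have "unit_equiv (poly_over A) m V (unit_vec 0)" .
  then have "unit_equiv R m (\<lambda>i. poly (V i) x) (\<lambda>i. poly (unit_vec 0 i) x)"
    by (rule unit_equiv_hom[of "\<lambda>p. poly p x", rotated -1]) (auto simp: poly_mem[OF assms(2) AR x(2)])
  then have "unit_equiv R m (\<lambda>i. poly (V i) x) (unit_vec 0)"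
    by (simp add: unit_vec_def if_distrib[of "\<lambda>p. poly p x"] cong: if_cong)
  then show ?thesis using R.unit_equiv_trans[OF vV] by blast
qed

lemma (in subring) unimodular_completableI:
  assumes "\<And>b v. (\<And>i. i < b \<Longrightarrow> v i \<in> A) \<Longrightarrow> unimodular A b v \<Longrightarrow> unit_equiv A b v (unit_vec 0)"
  shows "unimodular_completable A"
  unfolding unimodular_completable_def
proof (intro allI impI)
  fix b and v c :: "nat \<Rightarrow> 'r"
  assume v: "v \<in> free_mod A b" and c: "\<forall>i<b. c i \<in> A" and sum: "(\<Sum>i<b. c i * v i) = 1"
  have vA: "\<And>i. i < b \<Longrightarrow> v i \<in> A" using v by (simp add: free_mod_def)
  have "b \<noteq> 0" using sum by (intro notI) simp
  have uni: "unimodular A b v" unfolding unimodular_def using c sum by blast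
  have "unit_equiv A b v (unit_vec (b - 1))"
    by (rule unit_equiv_trans[OF assms[OF vA uni] unit_equiv_unit_vector[of b "unit_vec 0" 0 "b - 1"]])
       (use \<open>b \<noteq> 0\<close> in \<open>auto simp: unit_vec_def\<close>)
  then obtain G H where GH: "G \<in> mats A b" "H \<in> mats A b" "inverse_mats b G H" "\<forall>i<b. mvec b G v i = unit_vec (b - 1) i"
    unfolding unit_equiv_def by blast
  define app where "app F w = (\<lambda>i. if i < b then mvec b F w i else 0)" for F and w :: "nat \<Rightarrow> 'r"
  have app_lin: "linear_over A (free_mod A b) (app F)" for F
    by (auto simp: linear_over_def app_def mvec_def fun_eq_iff vec_simps algebra_simps sum.distrib sum_distrib_left)
  have app_mem: "app F w \<in> free_mod A b" if "F \<in> mats A b" "w \<in> free_mod A b" for F w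
    using that by (auto simp: free_mod_def app_def mvec_def mats_def intro!: sum_mem mult)
  have app_inv: "app F (app F' w) = w" if "inverse_mats b F' F" "w \<in> free_mod A b" for F F' w
  proof
    fix i
    show "app F (app F' w) i = w i"
    proof (cases "i < b")
      case True
      have "mvec b F (app F' w) i = mvec b F (mvec b F' w) i"
        by (rule mvec_cong) (simp add: app_def)
      then show ?thesis using True inverse_mats_cancel(1)[OF that(1) True] by (simp add: app_def)
    next
      case False
      then show ?thesis using that(2) by (simp add: app_def free_mod_def)
    qed
  qed
  have GH': "inverse_mats b H G" using GH(3) by (auto simp: inverse_mats_def)
  have "app G v = unit_vec (b - 1)"
    using GH(4) \<open>b \<noteq> 0\<close> by (auto simp: app_def fun_eq_iff unit_vec_def)
  then have "app H (unit_vec (b - 1)) = v" using app_inv[OF GH(3) v] by simp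
  moreover have "bij_betw (app H) (free_mod A b) (free_mod A b)"
    by (rule bij_betw_byWitness[of _ "app G"]) (use app_inv GH GH' app_mem in auto)
  ultimately show "\<exists>\<theta>. linear_over A (free_mod A b) \<theta> \<and> bij_betw \<theta> (free_mod A b) (free_mod A b) \<and> \<theta> (unit_vec (b - 1)) = v"
    using app_lin by blast
qed

section \<open>The group ring of the integer vectors\<close>

type_synonym 'n group_ring = "(int ^ 'n) \<Rightarrow>\<^sub>0 complex"

abbreviation lookup :: "('a \<Rightarrow>\<^sub>0 'b::zero) \<Rightarrow> 'a \<Rightarrow> 'b" where
  "lookup \<equiv> poly_mapping.lookup"

abbreviation keys :: "('a \<Rightarrow>\<^sub>0 'b::zero) \<Rightarrow> 'a set" where
  "keys \<equiv> Poly_Mapping.keys"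

abbreviation monomial :: "'a \<Rightarrow> 'b::zero \<Rightarrow> 'a \<Rightarrow>\<^sub>0 'b" where
  "monomial g c \<equiv> Poly_Mapping.single g c"

lemma sum_monomials: "(\<Sum>g\<in>keys r. monomial g (lookup r g)) = r" for r :: "'a \<Rightarrow>\<^sub>0 'b::comm_monoid_add"
proof (rule poly_mapping_eqI)
  fix k
  show "lookup (\<Sum>g\<in>keys r. monomial g (lookup r g)) k = lookup r k"
    by (cases "k \<in> keys r")
       (auto simp: lookup_sum lookup_single when_def in_keys_iff)
qed

lemma group_ring_induct [case_names single add]:
  fixes r :: "'a \<Rightarrow>\<^sub>0 'b::comm_monoid_add"
  assumes "\<And>g c. P (monomial g c)" "\<And>r s. P r \<Longrightarrow> P s \<Longrightarrow> P (r + s)"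
  shows "P r"
proof -
  have "P (\<Sum>g\<in>S. monomial g (lookup r g))" if "finite S" for S
    using that
  proof (induction S)
    case empty
    then show ?case using assms(1)[of undefined 0] by simp
  next
    case (insert x F)
    then show ?case using assms by simp
  qed
  from this[OF finite_keys[of r]] show ?thesis by (simp add: sum_monomials)
qed

lemma lookup_mult_monomial: "lookup (r * monomial h c) g = lookup r (g - h) * c" for r :: "'a::ab_group_add \<Rightarrow>\<^sub>0 'b::comm_semiring_1"
proof (induction r rule: group_ring_induct)
  case (single k d)
  show ?case by (auto simp: mult_single lookup_single when_def algebra_simps)
next
  case (add r s)
  then show ?case by (simp add: distrib_right lookup_add)
qed

definition supported_on :: "'a set \<Rightarrow> ('a \<Rightarrow>\<^sub>0 'b::zero) set" where
  "supported_on H = {r. keys r \<subseteq> H}"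

lemma subring_supported_on:
  fixes H :: "'a::ab_group_add set"
  assumes "0 \<in> H" "\<And>g h. g \<in> H \<Longrightarrow> h \<in> H \<Longrightarrow> g + h \<in> H"
  shows "subring (supported_on H :: ('a \<Rightarrow>\<^sub>0 'b::comm_ring_1) set)"
proof
  fix a b :: "'a \<Rightarrow>\<^sub>0 'b" assume *: "a \<in> supported_on H" "b \<in> supported_on H"
  show "a + b \<in> supported_on H" using * keys_add[of a b] by (auto simp: supported_on_def)
  show "a * b \<in> supported_on H" using * keys_mult[of a b] assms(2) by (auto simp: supported_on_def) blast
next
  show "- a \<in> supported_on H" if "a \<in> supported_on H" for a :: "'a \<Rightarrow>\<^sub>0 'b"
    using that by (auto simp: supported_on_def in_keys_iff)
qed (use assms(1) in \<open>auto simp: supported_on_def\<close>)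

lemma monomial_supported: "g \<in> H \<Longrightarrow> monomial g c \<in> supported_on H"
  by (auto simp: supported_on_def)

lemma supported_lookup: "r \<in> supported_on H \<Longrightarrow> g \<notin> H \<Longrightarrow> lookup r g = 0"
  by (auto simp: supported_on_def in_keys_iff)

text \<open>A subgroup \<open>H\<close> with a linear form \<open>w\<close> and a vector \<open>e \<in> H\<close> of weight one: the group ring of
  \<open>H\<close> consists of the Laurent polynomials in the monomial of \<open>e\<close> over the group ring of the kernel.\<close>

locale weighted =
  fixes H :: "(int ^ 'n::finite) set" and c :: "'n \<Rightarrow> int" and e :: "int ^ 'n"
  assumes H_zero: "0 \<in> H" and H_add: "g \<in> H \<Longrightarrow> h \<in> H \<Longrightarrow> g + h \<in> H"
    and e_H: "i *s e \<in> H" and e_w: "(\<Sum>k\<in>UNIV. c k * e $ k) = 1"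
begin

definition w :: "int ^ 'n \<Rightarrow> int" where "w g = (\<Sum>k\<in>UNIV. c k * g $ k)"
definition ker :: "(int ^ 'n) set" where "ker = {g\<in>H. w g = 0}"
definition X :: "int \<Rightarrow> 'n group_ring" where "X i = monomial (i *s e) 1"
definition co :: "'n group_ring \<Rightarrow> int \<Rightarrow> 'n group_ring" where
  "co r i = Abs_poly_mapping (\<lambda>g. if w g = 0 then lookup r (g + i *s e) else 0)"

lemma w_add: "w (g + h) = w g + w h"
  by (simp add: w_def algebra_simps sum.distrib)

lemma w_diff: "w (g - h) = w g - w h"
  by (simp add: w_def algebra_simps sum_subtractf)

lemma w_e: "w (i *s e) = i"
  using e_w by (simp add: w_def mult.left_commute flip: sum_distrib_left)

lemma w_0 [simp]: "w 0 = 0" by (simp add: w_def)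

lemma lookup_co: "lookup (co r i) g = (if w g = 0 then lookup r (g + i *s e) else 0)"
proof -
  have "finite {g. (if w g = 0 then lookup r (g + i *s e) else 0) \<noteq> 0}"
  proof (rule finite_subset)
    show "{g. (if w g = 0 then lookup r (g + i *s e) else 0) \<noteq> 0} \<subseteq> (\<lambda>g. g - i *s e) ` keys r"
      by (auto simp: in_keys_iff intro!: image_eqI[of _ _ "_ + i *s e"])
  qed simp
  then show ?thesis by (simp add: co_def)
qed

lemma H_diff_e: "g + i *s e \<in> H \<Longrightarrow> g \<in> H"
proof -
  assume g: "g + i *s e \<in> H"
  have eq: "g + i *s e + (- i) *s e = g" by (simp add: vec_eq_iff)
  show "g \<in> H" using H_add[OF g e_H[of "- i"]] unfolding eq .
qed

lemma subring_ker: "subring (supported_on ker :: 'n group_ring set)"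
  by (rule subring_supported_on) (auto simp: ker_def H_zero H_add w_add)

lemma subring_H: "subring (supported_on H :: 'n group_ring set)"
  by (rule subring_supported_on) (auto simp: H_zero H_add)

lemma laurent: "laurent (supported_on ker) (supported_on H) X co"
proof -
  interpret A: subring "supported_on ker :: 'n group_ring set" by (rule subring_ker)
  interpret R: subring "supported_on H :: 'n group_ring set" by (rule subring_H)
  show ?thesis
  proof
    show "supported_on ker \<subseteq> (supported_on H :: 'n group_ring set)" by (auto simp: supported_on_def ker_def)
    show "X i \<in> supported_on H" for i unfolding X_def by (rule monomial_supported[OF e_H])
    show "X (i + j) = X i * X j" for i j by (simp add: X_def mult_single vector_sadd_rdistrib)
    show "X 0 = 1" by (simp add: X_def)
    show "co r i \<in> supported_on ker" if "r \<in> supported_on H" for r i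
      using that H_diff_e[of _ i] unfolding supported_on_def
      by (auto simp: lookup_co in_keys_iff ker_def split: if_splits)
    show "finite {i. co r i \<noteq> 0}" for r
    proof (rule finite_subset)
      show "{i. co r i \<noteq> 0} \<subseteq> w ` keys r"
      proof
        fix i assume "i \<in> {i. co r i \<noteq> 0}"
        then obtain g where "lookup (co r i) g \<noteq> 0"
          by (metis (mono_tags) lookup_zero mem_Collect_eq poly_mapping_eqI)
        then have "w g = 0" "g + i *s e \<in> keys r" by (auto simp: lookup_co in_keys_iff split: if_splits)
        then show "i \<in> w ` keys r" by (auto simp: w_add w_e intro!: image_eqI[of _ _ "g + i *s e"])
      qed
    qed simp
    show "co (r + s) i = co r i + co s i" for r s i
      by (rule poly_mapping_eqI) (simp add: lookup_co lookup_add)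
    show "co (a * X i) j = (if i = j then a else 0)" if "a \<in> supported_on ker" for a i j
    proof (rule poly_mapping_eqI)
      fix g
      have "lookup a g = 0" if "w g \<noteq> 0" for g
        using \<open>a \<in> supported_on ker\<close> that by (intro supported_lookup) (auto simp: ker_def)
      then show "lookup (co (a * X i) j) g = lookup (if i = j then a else 0) g"
        by (auto simp: lookup_co X_def lookup_mult_monomial w_add w_diff w_e)
    qed
    show "r = (\<Sum>i | co r i \<noteq> 0. co r i * X i)" for r
    proof (rule poly_mapping_eqI)
      fix g
      have "lookup (\<Sum>i | co r i \<noteq> 0. co r i * X i) g = (\<Sum>i | co r i \<noteq> 0. if i = w g then lookup r g else 0)"
        unfolding lookup_sum by (intro sum.cong) (auto simp: X_def lookup_mult_monomial lookup_co w_diff w_e)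
      also have "\<dots> = (if co r (w g) \<noteq> 0 then lookup r g else 0)"
        using \<open>finite {i. co r i \<noteq> 0}\<close> by simp
      also have "\<dots> = lookup r g"
      proof (cases "co r (w g) = 0")
        case True
        have "lookup (co r (w g)) (g - w g *s e) = lookup r g" by (simp add: lookup_co w_diff w_e)
        then show ?thesis using True by simp
      qed simp
      finally show "lookup r g = lookup (\<Sum>i | co r i \<noteq> 0. co r i * X i) g" by simp
    qed
  qed
qed

end

theorem finite_resolutions_group_ring: "finite_resolutions (UNIV :: 'n::finite group_ring set)"
proof -
  let ?H = "\<lambda>S. {g :: int ^ 'n. \<forall>k. k \<notin> S \<longrightarrow> g $ k = 0}"
  have "finite_resolutions (supported_on (?H S) :: 'n group_ring set)" if "finite S" for S
    using that
  proof (induction S)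
    case empty
    have H: "?H {} = {0}" by (auto simp: vec_eq_iff)
    interpret subring "supported_on {0} :: 'n group_ring set" by (rule subring_supported_on) auto
    show ?case unfolding H
    proof (rule finite_resolutions_field)
      fix a :: "'n group_ring" assume a: "a \<in> supported_on {0}" "a \<noteq> 0"
      have eq: "a = monomial 0 (lookup a 0)"
        using a(1) by (intro poly_mapping_eqI) (auto simp: lookup_single when_def supported_lookup)
      then obtain c where c: "a = monomial 0 c" by blast
      then have "c \<noteq> 0" using a(2) by auto
      then have "monomial 0 (inverse c) * a = 1" by (simp add: c mult_single)
      then show "\<exists>b\<in>supported_on {0}. b * a = 1" using monomial_supported[of 0 "{0}"] by blast
    qed
  next
    case (insert k S)
    interpret weighted "?H (insert k S)" "\<lambda>j. if j = k then 1 else 0" "axis k 1"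
      by standard (auto simp: axis_def vector_scalar_mult_def if_distrib[of "\<lambda>x. x * _"] cong: if_cong)
    have w: "w g = g $ k" for g by (simp add: w_def if_distrib[of "\<lambda>x. x * _"] cong: if_cong)
    have "ker = {g \<in> ?H (insert k S). g $ k = 0}" unfolding ker_def w ..
    also have "\<dots> = ?H S" using insert(2) by auto
    finally have "ker = ?H S" .
    then show ?case using laurent.finite_resolutions_laurent[OF laurent] insert.IH by simp
  qed
  from this[of UNIV] show ?thesis by (simp add: supported_on_def)
qed

text \<open>Give the coordinates the weights \<open>1, N, N\<^sup>2, \<dots>\<close>, where the integer \<open>N\<close> avoids the roots of the
  polynomials whose coefficients are the entries of the given vectors.\<close>

lemma generic_weights:
  fixes D :: "(int ^ 'n::finite) set"
  assumes "finite D" "0 \<notin> D"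
  obtains c :: "'n \<Rightarrow> int" and k where "c k = 1" "\<And>g. g \<in> D \<Longrightarrow> (\<Sum>j\<in>UNIV. c j * g $ j) \<noteq> 0"
proof -
  obtain idx :: "'n \<Rightarrow> nat" where idx: "bij_betw idx UNIV {0..<CARD('n)}"
    using ex_bij_betw_finite_nat[of "UNIV :: 'n set"] by auto
  have "0 \<in> {0..<CARD('n)}" by simp
  then obtain k where k: "idx k = 0" using idx unfolding bij_betw_def by (metis imageE)
  define p where "p g = (\<Sum>j\<in>UNIV. monom (g $ j) (idx j))" for g :: "int ^ 'n"
  have coeff_p: "coeff (p g) (idx i) = g $ i" for g i
  proof -
    have "coeff (p g) (idx i) = (\<Sum>j\<in>UNIV. if j = i then g $ j else 0)"
      unfolding p_def coeff_sum using idx by (intro sum.cong) (auto simp: bij_betw_def inj_eq)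
    then show ?thesis by simp
  qed
  have "p g \<noteq> 0" if "g \<in> D" for g
  proof
    assume "p g = 0"
    then have "g = 0" using coeff_p[of g] by (simp add: vec_eq_iff)
    then show False using that assms(2) by simp
  qed
  then have "finite (\<Union>g\<in>D. {x. poly (p g) x = 0})"
    using assms(1) by (auto intro: poly_roots_finite)
  then obtain N :: int where N: "N \<notin> (\<Union>g\<in>D. {x. poly (p g) x = 0})"
    using ex_new_if_finite[OF infinite_UNIV_int] by blast
  have "(\<Sum>j\<in>UNIV. N ^ idx j * g $ j) = poly (p g) N" for g
    by (simp add: p_def poly_sum poly_monom mult.commute)
  then show thesis using N k by (intro that[of "\<lambda>j. N ^ idx j" k]) auto
qed

lemma subring_image:
  fixes \<phi> :: "'a::comm_ring_1 \<Rightarrow> 'b::comm_ring_1"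
  assumes "subring A" "\<And>a b. \<phi> (a + b) = \<phi> a + \<phi> b" "\<And>a b. \<phi> (a * b) = \<phi> a * \<phi> b" "\<phi> 1 = 1"
  shows "subring (\<phi> ` A)"
proof -
  interpret subring A by fact
  have z: "\<phi> 0 = 0" using assms(2)[of 0 0] by simp
  have u: "\<phi> (- a) = - \<phi> a" for a using assms(2)[of a "- a"] z by (simp add: eq_neg_iff_add_eq_0 add.commute)
  show ?thesis
  proof
    show "0 \<in> \<phi> ` A" by (rule image_eqI[of _ _ 0]) (auto simp: z)
    show "1 \<in> \<phi> ` A" by (rule image_eqI[of _ _ 1]) (auto simp: assms(4))
  qed (auto simp flip: assms(2,3) u)
qed

text \<open>An embedding of the group ring into a field, in which its subrings can be localised.\<close>

locale group_ring_field =
  fixes J :: "'n::finite group_ring \<Rightarrow> 'f::field"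
  assumes J_add: "J (r + s) = J r + J s" and J_mult: "J (r * s) = J r * J s" and J_1: "J 1 = 1"
    and J_inj: "J r = 0 \<Longrightarrow> r = 0"
begin

lemma J_0 [simp]: "J 0 = 0"
proof -
  have "J 0 + J 0 = J 0 + 0" using J_add[of 0 0, symmetric] by (simp only: add_0_right)
  then show ?thesis by (rule add_left_imp_eq)
qed

lemma J_sum: "J (sum f S) = (\<Sum>i\<in>S. J (f i))"
  by (induction S rule: infinite_finite_induct) (auto simp: J_add)
lemma J_diff: "J (r - s) = J r - J s" using J_add[of "r - s" s] by simp
lemma J_eq: "J r = J s \<Longrightarrow> r = s" using J_inj[of "r - s"] by (simp add: J_diff)

lemma unit_equiv_pullback:
  assumes "unit_equiv (range J) m (\<lambda>i. J (v i)) (unit_vec 0)"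
  shows "unit_equiv UNIV m v (unit_vec 0)"
proof -
  obtain G H where GH: "G \<in> mats (range J) m" "H \<in> mats (range J) m" "inverse_mats m G H"
      "\<forall>i<m. mvec m G (\<lambda>i. J (v i)) i = unit_vec 0 i"
    using assms unfolding unit_equiv_def by (elim exE conjE) (rule that)
  define G' where "G' i j = inv J (G i j)" for i j
  define H' where "H' i j = inv J (H i j)" for i j
  have G: "J (G' i j) = G i j" and H: "J (H' i j) = H i j" if "i < m" "j < m" for i j
    using GH(1,2) that by (auto simp: mats_def G'_def H'_def f_inv_into_f)
  have Jub: "J (unit_vec i j) = unit_vec i j" for i j by (simp add: unit_vec_def J_1)
  have mm: "J (mmul m G' H' i j) = mmul m G H i j" "J (mmul m H' G' i j) = mmul m H G i j" if "i < m" "j < m" for i j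
    using that by (auto simp: mmul_def J_sum J_mult G H)
  have "inverse_mats m G' H'"
    unfolding inverse_mats_def
  proof (intro allI impI)
    fix i j assume ij: "i < m" "j < m"
    then have "J (mmul m G' H' i j) = J (unit_vec i j)" "J (mmul m H' G' i j) = J (unit_vec i j)"
      using GH(3) unfolding inverse_mats_def mm[OF ij] Jub by blast+
    then show "mmul m G' H' i j = unit_vec i j \<and> mmul m H' G' i j = unit_vec i j" using J_eq by blast
  qed
  moreover have "mvec m G' v i = unit_vec 0 i" if "i < m" for i
  proof (rule J_eq)
    have "J (mvec m G' v i) = mvec m G (\<lambda>i. J (v i)) i"
      using that by (auto simp: mvec_def J_sum J_mult G)
    then show "J (mvec m G' v i) = J (unit_vec 0 i)" using GH(4) that by (simp add: Jub)
  qed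
  ultimately show ?thesis unfolding unit_equiv_def mats_def by blast
qed

text \<open>Weights that separate the exponents of a nonzero entry make each of its coefficients, as a Laurent
  polynomial in the variable \<open>X 1\<close>, a single monomial and thus a unit. After division by the
  coefficient of highest degree and by the lowest power of \<open>X 1\<close> the entry is monic with an invertible
  constant coefficient.\<close>

theorem unimodular_group_ring:
  fixes v :: "nat \<Rightarrow> 'n group_ring"
  assumes m: "3 \<le> m" and v: "unimodular UNIV m v"
  shows "unit_equiv UNIV m v (unit_vec 0)"
proof -
  have "\<exists>l<m. v l \<noteq> 0"
  proof (rule ccontr)
    assume "\<not> ?thesis"
    then have "v i = 0" if "i < m" for i using that by blast
    then show False using v by (auto simp: unimodular_def)
  qed
  then obtain l where l: "l < m" "v l \<noteq> 0" by blast
  let ?s = "v l"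
  let ?K = "keys ?s"
  define D where "D = {g - h | g h. g \<in> ?K \<and> h \<in> ?K \<and> g \<noteq> h}"
  have "D \<subseteq> (\<lambda>(g, h). g - h) ` (?K \<times> ?K)" by (auto simp: D_def)
  then have "finite D" by (rule finite_subset) simp
  moreover have "0 \<notin> D" by (auto simp: D_def)
  ultimately obtain c k where c: "c k = 1" "\<And>g. g \<in> D \<Longrightarrow> (\<Sum>j\<in>UNIV. c j * g $ j) \<noteq> 0"
    by (rule generic_weights) blast
  interpret weighted UNIV c "axis k 1"
    by standard (auto simp: axis_def c(1) if_distrib[of "\<lambda>x. _ * x"] cong: if_cong)
  let ?e = "axis k 1 :: int ^ 'n"
  let ?A = "supported_on ker :: 'n group_ring set"
  have UNIV: "supported_on UNIV = (UNIV :: 'n group_ring set)" by (simp add: supported_on_def)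
  interpret L: laurent ?A "UNIV :: 'n group_ring set" X co using laurent unfolding UNIV .
  have w_inj: "g = h" if "g \<in> ?K" "h \<in> ?K" "w g = w h" for g h
    using c(2)[of "g - h"] that w_diff[of g h] by (auto simp: D_def w_def)
  have co_K: "co ?s (w g) = monomial (g - w g *s ?e) (lookup ?s g)" if g: "g \<in> ?K" for g
  proof (rule poly_mapping_eqI)
    fix h
    have "h = g - w g *s ?e" if "w h = 0" "h + w g *s ?e \<in> ?K"
      using w_inj[OF that(2) g] that(1) by (simp add: w_add w_e algebra_simps)
    then show "lookup (co ?s (w g)) h = lookup (monomial (g - w g *s ?e) (lookup ?s g)) h"
      by (auto simp: lookup_co lookup_single when_def w_diff w_e in_keys_iff)
  qed
  have co_out: "co ?s t = 0" if "t \<notin> w ` ?K" for t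
  proof (rule poly_mapping_eqI)
    fix h
    have "h + t *s ?e \<notin> ?K" if "w h = 0"
      using \<open>t \<notin> w ` ?K\<close> that by (metis add_0 image_eqI w_add w_e)
    then show "lookup (co ?s t) h = lookup 0 h" by (auto simp: lookup_co in_keys_iff)
  qed
  have K: "finite (w ` ?K)" "w ` ?K \<noteq> {}" using l(2) by auto
  define tmax where "tmax = Max (w ` ?K)"
  define tmin where "tmin = Min (w ` ?K)"
  obtain gmax where gmax: "gmax \<in> ?K" "w gmax = tmax" using Max_in[OF K] unfolding tmax_def by force
  obtain gmin where gmin: "gmin \<in> ?K" "w gmin = tmin" using Min_in[OF K] unfolding tmin_def by force
  have co_range: "co ?s t = 0" if "t \<notin> {tmin..tmax}" for t
    by (rule co_out) (use that Max_ge[OF K(1), of t] Min_le[OF K(1), of t] in \<open>auto simp: tmax_def tmin_def\<close>)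
  have le: "tmin \<le> tmax" using Max_ge[OF K(1), of tmin] gmin by (auto simp: tmax_def)
  define cmax where "cmax = lookup ?s gmax"
  define cmin where "cmin = lookup ?s gmin"
  have nz: "cmax \<noteq> 0" "cmin \<noteq> 0" using gmax gmin by (auto simp: cmax_def cmin_def in_keys_iff)
  define hmax where "hmax = gmax - tmax *s ?e"
  define hmin where "hmin = gmin - tmin *s ?e"
  have h_ker: "hmax \<in> ker" "- hmax \<in> ker" "hmin \<in> ker" "- hmin \<in> ker"
    using w_diff[of 0 hmax] w_diff[of 0 hmin] by (auto simp: hmax_def hmin_def ker_def w_diff w_e gmax gmin)
  define u where "u = monomial (- hmax) (inverse cmax)"
  define u' where "u' = monomial hmax cmax"
  have u: "u \<in> ?A" "u' \<in> ?A" "u * u' = 1"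
    using h_ker nz by (auto simp: u_def u'_def mult_single intro!: monomial_supported)
  have u_max: "u * co ?s tmax = 1"
    using co_K[OF gmax(1)] u(3) by (simp add: gmax(2) u'_def hmax_def cmax_def)
  define b where "b = u' * monomial (- hmin) (inverse cmin)"
  have b: "b \<in> ?A" using u(2) h_ker by (auto simp: b_def intro!: L.A.mult monomial_supported)
  have "b * (u * co ?s tmin) = (u * u') * (monomial (- hmin) (inverse cmin) * co ?s tmin)"
    by (simp add: b_def ac_simps)
  also have "\<dots> = 1"
    using co_K[OF gmin(1)] nz unfolding u(3) by (simp add: gmin(2) hmin_def[symmetric] cmin_def[symmetric] mult_single)
  finally have u_min: "b * (u * co ?s tmin) = 1" .
  define d where "d = nat (tmax - tmin)"
  define a where "a i = u * co ?s (int i + tmin)" for i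
  have a_A: "a i \<in> ?A" for i unfolding a_def by (intro L.A.mult u L.co_mem) simp
  define f where "f = (\<Sum>i\<le>d. monom (J (a i)) i)"
  have coeff_f: "coeff f i = (if i \<le> d then J (a i) else 0)" for i
    by (simp add: f_def coeff_sum)
  define x where "x = J (X 1)"
  have x_pow: "x ^ i = J (X (int i))" for i
  proof (induction i)
    case (Suc i)
    have "X (int (Suc i)) = X 1 * X (int i)" using L.X_add[of 1 "int i"] by simp
    then show ?case using Suc by (simp add: x_def J_mult)
  qed (simp add: L.X_0 J_1)
  have "?s = (\<Sum>t\<in>{tmin..tmax}. co ?s t * X t)"
    by (rule L.co_sum') (use co_range in auto)
  also have "{tmin..tmax} = (\<lambda>i. int i + tmin) ` {..d}"
  proof (intro equalityI subsetI)
    fix t assume "t \<in> {tmin..tmax}"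
    then show "t \<in> (\<lambda>i. int i + tmin) ` {..d}"
      by (intro image_eqI[of _ _ "nat (t - tmin)"]) (auto simp: d_def)
  qed (use le in \<open>auto simp: d_def\<close>)
  also have "(\<Sum>t\<in>(\<lambda>i. int i + tmin) ` {..d}. co ?s t * X t) = (\<Sum>i\<le>d. co ?s (int i + tmin) * X (int i + tmin))"
    by (subst sum.reindex) (auto simp: inj_on_def)
  finally have s_eq: "?s = (\<Sum>i\<le>d. co ?s (int i + tmin) * X (int i + tmin))" .
  have "u * X (- tmin) * ?s = (\<Sum>i\<le>d. u * X (- tmin) * (co ?s (int i + tmin) * X (int i + tmin)))"
    by (subst s_eq) (rule sum_distrib_left)
  also have "\<dots> = (\<Sum>i\<le>d. a i * X (int i))"
  proof (rule sum.cong[OF refl])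
    fix i
    have "u * X (- tmin) * (co ?s (int i + tmin) * X (int i + tmin))
        = (u * co ?s (int i + tmin)) * (X (- tmin) * X (int i + tmin))"
      by (simp only: ac_simps)
    also have "X (- tmin) * X (int i + tmin) = X (int i)" using L.X_add[of "- tmin" "int i + tmin"] by simp
    finally show "u * X (- tmin) * (co ?s (int i + tmin) * X (int i + tmin)) = a i * X (int i)"
      by (simp only: a_def)
  qed
  finally have us: "u * X (- tmin) * ?s = (\<Sum>i\<le>d. a i * X (int i))" .
  have "unit_equiv (range J) m (\<lambda>i. J (v i)) (unit_vec 0)"
  proof (rule laurent_unimodular[where A = "J ` ?A" and R = "range J" and x = x and l = l and f = f and d = d
        and a = "J b" and y = "J (u * X (- tmin))" and y' = "J (u' * X tmin)"])
    show "subring (J ` ?A)" by (rule subring_image[OF L.A.subring_axioms J_add J_mult J_1])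
    show "subring (range J)" by (rule subring_image[OF L.R.subring_axioms J_add J_mult J_1])
    have x_inv: "x * J (X (- 1)) = 1" unfolding x_def by (simp add: L.X_inv J_1 flip: J_mult)
    then show "x \<noteq> 0" by auto
    then have "inverse x = J (X (- 1))" using x_inv by (simp add: field_simps)
    then show "inverse x \<in> range J" by simp
    show "x \<in> range J" by (simp add: x_def)
    show "p = 0" if p: "p \<in> poly_over (J ` ?A)" "poly p x = 0" for p
    proof -
      have "\<forall>i. \<exists>r. r \<in> ?A \<and> coeff p i = J r" using p(1) by (auto simp: poly_over_def)
      then obtain r where r: "\<And>i. r i \<in> ?A" "\<And>i. coeff p i = J (r i)" by metis
      have "J (\<Sum>i\<le>degree p. r i * X (int i)) = poly p x"
        by (simp add: poly_altdef J_sum J_mult r(2) x_pow)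
      then have "(\<Sum>i\<le>degree p. r i * X (int i)) = 0" using p(2) J_inj by simp
      moreover have "(\<Sum>i\<le>degree p. r i * X (int i)) = (\<Sum>t\<in>int ` {..degree p}. r (nat t) * X t)"
        by (subst sum.reindex) auto
      ultimately have "r (nat (int i)) = 0" if "i \<le> degree p" for i
        using L.co_poly[of "int ` {..degree p}" "\<lambda>t. r (nat t)" "int i"] r(1) that by auto
      then have "coeff p i = 0" for i using r(2)[of i] by (cases "i \<le> degree p") (auto simp: coeff_eq_0)
      then show ?thesis by (simp add: poly_eq_iff)
    qed
    show "\<exists>p\<in>poly_over (J ` ?A). \<exists>n. r * x ^ n = poly p x" if "r \<in> range J" for r
    proof -
      interpret JA: subring "J ` ?A" by (rule subring_image[OF L.A.subring_axioms J_add J_mult J_1])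
      interpret P: subring "poly_over (J ` ?A)" by (rule JA.subring_poly_over)
      obtain s where s: "r = J s" using \<open>r \<in> range J\<close> by blast
      let ?I = "{i. co s i \<noteq> 0}"
      obtain T where T: "\<forall>t\<in>?I. \<bar>t\<bar> \<le> T" using finite_int_bound[OF L.co_fin[OF UNIV_I, of s]] by (elim exE) (rule that)
      define p where "p = (\<Sum>i\<in>?I. monom (J (co s i)) (nat (i + int (nat T))))"
      have "s * X (int (nat T)) = (\<Sum>i\<in>?I. co s i * X i) * X (int (nat T))"
        using L.co_sum[of s] by simp
      also have "\<dots> = (\<Sum>i\<in>?I. co s i * X (int (nat (i + int (nat T)))))"
        unfolding sum_distrib_right
      proof (rule sum.cong[OF refl])
        fix i assume "i \<in> ?I"
        then have "int (nat (i + int (nat T))) = i + int (nat T)" using T by force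
        then show "co s i * X i * X (int (nat T)) = co s i * X (int (nat (i + int (nat T))))"
          using L.X_add[of i "int (nat T)"] by (simp add: mult.assoc)
      qed
      finally have "r * x ^ nat T = poly p x"
        by (simp add: s x_pow p_def poly_sum poly_monom flip: J_mult J_sum)
      moreover have "p \<in> poly_over (J ` ?A)"
        unfolding p_def by (intro P.sum_mem JA.monom_over imageI L.co_mem) simp
      ultimately show ?thesis by blast
    qed
    show "unimodular (range J) m (\<lambda>i. J (v i))"
    proof -
      obtain q where "(\<Sum>i<m. q i * v i) = 1" using v unfolding unimodular_def by blast
      then have "(\<Sum>i<m. J (q i) * J (v i)) = 1" by (simp add: J_1 flip: J_mult J_sum)
      then show ?thesis unfolding unimodular_def by (intro exI[of _ "\<lambda>i. J (q i)"]) auto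
    qed
    show "f \<in> poly_over (J ` ?A)"
      using a_A subring.zero[OF subring_image[OF L.A.subring_axioms J_add J_mult J_1]]
      by (auto simp: poly_over_def coeff_f)
    show "coeff f d = 1" using u_max le by (simp add: coeff_f a_def d_def J_1)
    show "coeff f i = 0" if "i > d" for i using that by (simp add: coeff_f)
    show "J b \<in> J ` ?A" using b by blast
    show "J b * coeff f 0 = 1" using u_min by (simp add: coeff_f a_def J_1 flip: J_mult)
    show "J (u * X (- tmin)) * J (u' * X tmin) = 1"
    proof -
      have "u * X (- tmin) * (u' * X tmin) = (u * u') * (X (- tmin) * X tmin)" by (simp add: ac_simps)
      then show ?thesis using u(3) L.X_inv(1)[of tmin] by (simp add: J_1 flip: J_mult)
    qed
    show "J (u * X (- tmin)) * J (v l) = poly f x"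
    proof -
      have "J (u * X (- tmin)) * J (v l) = J (\<Sum>i\<le>d. a i * X (int i))"
        by (simp only: us flip: J_mult)
      then show ?thesis by (simp add: J_sum J_mult f_def poly_sum poly_monom x_pow)
    qed
  qed (use m l in auto)
  then show ?thesis by (rule unit_equiv_pullback)
qed

end

section \<open>Splitting idempotent matrices\<close>

text \<open>Exponents are moved to the finitely supported sequences of integers, whose lexicographic order makes
  the group ring an integral domain; the field is its field of fractions.\<close>

lemma group_ring_field_exists:
  "\<exists>J :: 'n::finite group_ring \<Rightarrow> ((nat \<Rightarrow>\<^sub>0 int) \<Rightarrow>\<^sub>0 complex) fract. group_ring_field J"
proof -
  obtain idx :: "'n \<Rightarrow> nat" where "bij_betw idx UNIV {0..<CARD('n)}"
    using ex_bij_betw_finite_nat[of "UNIV :: 'n set"] by auto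
  then have idx: "idx j = idx k \<longleftrightarrow> j = k" for j k by (auto simp: bij_betw_def inj_eq)
  define \<epsilon> :: "int ^ 'n \<Rightarrow> nat \<Rightarrow>\<^sub>0 int" where "\<epsilon> g = (\<Sum>k\<in>UNIV. monomial (idx k) (g $ k))" for g
  have \<epsilon>_add: "\<epsilon> (g + h) = \<epsilon> g + \<epsilon> h" for g h by (simp add: \<epsilon>_def single_add sum.distrib)
  have \<epsilon>_lookup: "lookup (\<epsilon> g) (idx k) = g $ k" for g k
    by (simp add: \<epsilon>_def lookup_sum lookup_single when_def idx)
  have \<epsilon>_inj: "\<epsilon> g = \<epsilon> h \<longleftrightarrow> g = h" for g h
    using \<epsilon>_lookup by (metis vec_eq_iff)
  have \<epsilon>_0: "\<epsilon> 0 = 0" by (simp add: \<epsilon>_def)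
  define \<phi> :: "'n group_ring \<Rightarrow> (nat \<Rightarrow>\<^sub>0 int) \<Rightarrow>\<^sub>0 complex" where
    "\<phi> r = (\<Sum>g\<in>keys r. monomial (\<epsilon> g) (lookup r g))" for r
  have \<phi>_sup: "\<phi> r = (\<Sum>g\<in>S. monomial (\<epsilon> g) (lookup r g))" if "finite S" "keys r \<subseteq> S" for r S
    unfolding \<phi>_def using that by (intro sum.mono_neutral_left) (auto simp: in_keys_iff)
  have \<phi>_add: "\<phi> (r + s) = \<phi> r + \<phi> s" for r s
  proof -
    let ?S = "keys r \<union> keys s"
    show ?thesis
      using \<phi>_sup[of ?S r] \<phi>_sup[of ?S s] \<phi>_sup[of ?S "r + s"] keys_add[of r s]
      by (simp add: lookup_add single_add sum.distrib)
  qed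
  have \<phi>_single: "\<phi> (monomial g c) = monomial (\<epsilon> g) c" for g c
    using \<phi>_sup[of "{g}" "monomial g c"] by simp
  have \<phi>_mult: "\<phi> (r * s) = \<phi> r * \<phi> s" for r s
  proof (induction r arbitrary: s rule: group_ring_induct)
    case (single g c)
    show ?case
      by (induction s rule: group_ring_induct)
         (simp_all add: mult_single \<phi>_single \<epsilon>_add distrib_left \<phi>_add)
  next
    case (add r s')
    then show ?case by (simp add: distrib_right \<phi>_add)
  qed
  have \<phi>_lookup: "lookup (\<phi> r) (\<epsilon> g) = lookup r g" for r g
    by (cases "g \<in> keys r")
       (auto simp: \<phi>_def lookup_sum lookup_single when_def \<epsilon>_inj in_keys_iff)
  have \<phi>_inj: "r = 0" if "\<phi> r = 0" for r
    using \<phi>_lookup[of r] that by (intro poly_mapping_eqI) simp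
  have \<phi>_1: "\<phi> 1 = 1" using \<phi>_single[of 0 1] by (simp add: \<epsilon>_0)
  have "group_ring_field (\<lambda>r. Fract (\<phi> r) 1)"
    by standard (auto simp: \<phi>_add \<phi>_mult \<phi>_1 One_fract_def Zero_fract_def eq_fract intro: \<phi>_inj)
  then show ?thesis by blast
qed

lemma unimodular_completable_group_ring: "unimodular_completable (UNIV :: 'n::finite group_ring set)"
proof -
  obtain J :: "'n group_ring \<Rightarrow> ((nat \<Rightarrow>\<^sub>0 int) \<Rightarrow>\<^sub>0 complex) fract" where "group_ring_field J"
    using group_ring_field_exists by blast
  then interpret group_ring_field J .
  interpret subring "UNIV :: 'n group_ring set" by standard auto
  show ?thesis
  proof (rule unimodular_completableI)
    fix b and v :: "nat \<Rightarrow> 'n group_ring" assume v: "unimodular UNIV b v"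
    consider "b = 0" | "b = 1" | "b = 2" | "b \<ge> 3" by linarith
    then show "unit_equiv UNIV b v (unit_vec 0)"
    proof cases
      case 1
      then show ?thesis using v by (simp add: unimodular_def)
    next
      case 2
      then show ?thesis using v unimodular_1[of v] by simp
    next
      case 3
      then show ?thesis using v unimodular_2[of v] by simp
    next
      case 4
      then show ?thesis using unimodular_group_ring v by blast
    qed
  qed
qed

text \<open>The rows of \<open>C\<close> are a basis of the row space \<open>E\<close> of \<open>P\<close>, and the rows of \<open>B\<close> are the coordinates of the
  rows of \<open>P\<close> in this basis.\<close>

theorem idempotent_splits:
  fixes P :: "nat \<Rightarrow> nat \<Rightarrow> 'n::finite group_ring"
  assumes idem: "\<And>i j. i < d \<Longrightarrow> j < d \<Longrightarrow> (\<Sum>k<d. P i k * P k j) = P i j"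
  shows "\<exists>r B C. (\<forall>i<d. \<forall>j<d. (\<Sum>k<r. B i k * C k j) = P i j) \<and>
    (\<forall>k<r. \<forall>l<r. (\<Sum>i<d. C k i * B i l) = unit_vec k l)"
proof -
  let ?R = "UNIV :: 'n group_ring set"
  interpret subring ?R by standard auto
  define row where "row i = (\<lambda>j. if j < d then P i j else 0)" for i
  define q where "q = lcomb d row"
  have q_apply: "q u j = (if j < d then \<Sum>i<d. u i * P i j else 0)" for u j
    by (simp add: q_def lcomb_def sum_apply vec_simps row_def)
  have q_free: "q u \<in> free_mod ?R d" for u by (simp add: free_mod_def q_apply)
  have qq: "q (q u) = q u" for u
  proof
    fix j
    have "(\<Sum>k<d. (\<Sum>i<d. u i * P i k) * P k j) = (\<Sum>i<d. u i * (\<Sum>k<d. P i k * P k j))"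
      unfolding sum_distrib_left sum_distrib_right mult.assoc by (rule sum.swap)
    also have "\<dots> = (\<Sum>i<d. u i * P i j)" if "j < d"
      by (intro sum.cong) (auto simp: idem that)
    finally show "q (q u) j = q u j" by (simp add: q_apply)
  qed
  define E where "E = q ` free_mod ?R d"
  have qE: "q x = x" if "x \<in> E" for x using that by (auto simp: E_def qq)
  have E_free: "E \<subseteq> free_mod ?R d" using q_free by (auto simp: E_def)
  have "projective ?R E"
    unfolding projective_def
  proof (rule exI[of _ d], rule exI[of _ q], rule exI[of _ "\<lambda>x. x"], intro conjI ballI)
    show "linear_over ?R (free_mod ?R d) q" unfolding q_def by (rule lin_lcomb)
    show "q ` free_mod ?R d = E" unfolding E_def ..
    show "linear_over ?R E (\<lambda>x. x)" by (rule lin_id)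
    show "(\<lambda>x. x) ` E \<subseteq> free_mod ?R d" using E_free by simp
  qed (rule qE)
  then obtain r f where f: "linear_over ?R (free_mod ?R r) f" "bij_betw f (free_mod ?R r) E"
    by (rule projective_free[OF unimodular_completable_group_ring finite_resolutions_group_ring _ E_free])
  define g where "g = inv_into (free_mod ?R r) f"
  have g: "linear_over ?R E g" unfolding g_def by (rule lin_inv[OF f(1) submod_free f(2)])
  have gf: "g (f x) = x" if "x \<in> free_mod ?R r" for x
    using that f(2) by (simp add: g_def bij_betw_def)
  have fE: "f x \<in> E" if "x \<in> free_mod ?R r" for x using that f(2) by (auto simp: bij_betw_def)
  have fg: "g x \<in> free_mod ?R r" "f (g x) = x" if "x \<in> E" for x
    using that f(2) inv_into_into[of x f "free_mod ?R r"] f_inv_into_f[of x f "free_mod ?R r"]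
    unfolding g_def bij_betw_def by auto
  have E_sub: "submod ?R E" unfolding E_def q_def by (rule submod_image[OF lin_lcomb submod_free])
  have rowE: "row i \<in> E" if "i < d" for i
  proof -
    have "q (unit_vec i) = row i" unfolding q_def by (rule lcomb_unit_vec[OF that])
    then show ?thesis using unit_vec_free[OF that] unfolding E_def by force
  qed
  define C where "C k = f (unit_vec k)" for k
  define B where "B i = g (row i)" for i
  show ?thesis
  proof (rule exI[of _ r], rule exI[of _ B], rule exI[of _ C], intro conjI allI impI)
    fix i j assume ij: "i < d" "j < d"
    have "(\<Sum>k<r. B i k * C k j) = lcomb r C (B i) j"
      by (simp add: lcomb_def sum_apply vec_simps)
    also have "lcomb r C (B i) = f (B i)"
      unfolding C_def by (rule lin_free_expand[OF f(1), symmetric]) (simp add: B_def fg rowE ij)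
    also have "f (B i) j = P i j" using ij by (simp add: B_def fg rowE) (simp add: row_def)
    finally show "(\<Sum>k<r. B i k * C k j) = P i j" .
  next
    fix k l assume kl: "k < r" "l < r"
    have CE: "C k \<in> E" unfolding C_def by (rule fE[OF unit_vec_free[OF kl(1)]])
    have "(\<Sum>i<d. C k i * B i l) = (\<Sum>i<d. C k i \<odot> g (row i)) l"
      by (simp add: sum_apply vec_simps B_def)
    also have "(\<Sum>i<d. C k i \<odot> g (row i)) = g (\<Sum>i<d. C k i \<odot> row i)"
      by (rule lin_sum[OF g E_sub, symmetric]) (simp add: rowE)
    also have "(\<Sum>i<d. C k i \<odot> row i) = C k"
      using qE[OF CE] by (simp add: q_def lcomb_def)
    also have "g (C k) = unit_vec k" unfolding C_def by (rule gf[OF unit_vec_free[OF kl(1)]])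
    finally show "(\<Sum>i<d. C k i * B i l) = unit_vec k l" .
  qed
qed

section \<open>Bi-orthogonal families in the Hilbert space\<close>

interpretation l2: vector_space "scale_l2 :: complex \<Rightarrow> 'a::euclidean_space l2 \<Rightarrow> 'a l2"
  by (rule vector_space_scale_l2)

lemma cinner_add_left: "cinner_l2 (f + g) h = cinner_l2 f h + cinner_l2 g h"
  by transfer (simp add: ae_equal_def distrib_right square_integrable_mult_cnj)

lemma cinner_scale_left: "cinner_l2 (c *\<^sub>C f) g = c * cinner_l2 f g"
  by transfer (simp add: mult.assoc)

lemma cinner_commute: "cinner_l2 f g = cnj (cinner_l2 g f)"
proof transfer
  fix f g :: "'a \<Rightarrow> complex"
  have "(\<integral>x. f x * cnj (g x) \<partial>lborel) = (\<integral>x. cnj (g x * cnj (f x)) \<partial>lborel)"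
    by (simp add: mult.commute)
  also have "\<dots> = cnj (\<integral>x. g x * cnj (f x) \<partial>lborel)"
    by (rule Bochner_Integration.integral_cnj)
  finally show "(\<integral>x. f x * cnj (g x) \<partial>lborel) = cnj (\<integral>x. g x * cnj (f x) \<partial>lborel)" .
qed

lemma cinner_add_right: "cinner_l2 f (g + h) = cinner_l2 f g + cinner_l2 f h"
  by (subst (1 2 3) cinner_commute) (simp add: cinner_add_left)

lemma cinner_scale_right: "cinner_l2 f (c *\<^sub>C g) = cnj c * cinner_l2 f g"
  by (subst (1 2) cinner_commute) (simp add: cinner_scale_left)

lemma cinner_0 [simp]: "cinner_l2 0 f = 0" "cinner_l2 f 0 = 0"
  using cinner_scale_left[of 0 0 f] cinner_scale_right[of f 0 0] by simp_all

lemma cinner_diff_left: "cinner_l2 (f - g) h = cinner_l2 f h - cinner_l2 g h"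
  using cinner_add_left[of "f - g" g h] by simp

lemma cinner_sum_left: "cinner_l2 (sum f S) h = (\<Sum>i\<in>S. cinner_l2 (f i) h)"
  by (induction S rule: infinite_finite_induct) (auto simp: cinner_add_left)

lemma cinner_self: "cinner_l2 f f = complex_of_real ((norm f)\<^sup>2)"
proof -
  have "Im (cinner_l2 f f) = 0"
    using arg_cong[OF cinner_commute[of f f], of Im] by simp
  moreover have "Re (cinner_l2 f f) = (norm f)\<^sup>2"
    by (simp add: power2_norm_eq_inner inner_l2_def)
  ultimately show ?thesis by (simp add: complex_eq_iff)
qed

lemma translate_l2_simps:
  "translate_l2 a (f + g) = translate_l2 a f + translate_l2 a g"
  "translate_l2 a (c *\<^sub>C f) = c *\<^sub>C translate_l2 a f"
  "translate_l2 a (translate_l2 b f) = translate_l2 (a + b) f"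
  "translate_l2 0 f = f"
  by (transfer; simp add: ae_equal_def square_integrable_add square_integrable_cmult square_integrable_translate diff_diff_eq)+

lemma cinner_translate: "cinner_l2 (translate_l2 a f) (translate_l2 a g) = cinner_l2 f g"
proof transfer
  fix a :: 'a and f g :: "'a \<Rightarrow> complex"
  assume "ae_equal f f" "ae_equal g g"
  then have m: "(\<lambda>x. f x * cnj (g x)) \<in> borel_measurable borel"
    using borel_measurable_integrable[OF square_integrable_mult_cnj[of f g]] by (simp add: ae_equal_def)
  have "(\<integral>x. f x * cnj (g x) \<partial>lborel) = (\<integral>x. f x * cnj (g x) \<partial>(distr lborel borel ((+) (- a))))"
    by (simp add: lborel_distr_plus)
  also have "\<dots> = (\<integral>x. f (x - a) * cnj (g (x - a)) \<partial>lborel)"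
    using m by (subst integral_distr) auto
  finally show "(\<integral>x. f (x - a) * cnj (g (x - a)) \<partial>lborel) = (\<integral>x. f x * cnj (g x) \<partial>lborel)" ..
qed

lemma compactly_supported_0: "compactly_supported 0"
  by transfer (auto intro!: exI[of _ "{}"])

lemma compactly_supported_add: "compactly_supported f \<Longrightarrow> compactly_supported g \<Longrightarrow> compactly_supported (f + g)"
proof transfer
  fix f g :: "'a \<Rightarrow> complex"
  assume "\<exists>S. compact S \<and> (AE x in lborel. x \<notin> S \<longrightarrow> f x = 0)" "\<exists>S. compact S \<and> (AE x in lborel. x \<notin> S \<longrightarrow> g x = 0)"
  then obtain S T where *: "compact S" "AE x in lborel. x \<notin> S \<longrightarrow> f x = 0" "compact T" "AE x in lborel. x \<notin> T \<longrightarrow> g x = 0"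
    by blast
  from *(2,4) have "AE x in lborel. x \<notin> S \<union> T \<longrightarrow> f x + g x = 0" by eventually_elim auto
  then show "\<exists>S. compact S \<and> (AE x in lborel. x \<notin> S \<longrightarrow> f x + g x = 0)"
    using compact_Un[OF *(1,3)] by blast
qed

lemma compactly_supported_scale: "compactly_supported f \<Longrightarrow> compactly_supported (c *\<^sub>C f)"
  by transfer (auto elim: eventually_mono)

lemma compactly_supported_sum: "(\<And>i. i \<in> S \<Longrightarrow> compactly_supported (f i)) \<Longrightarrow> compactly_supported (sum f S)"
  by (induction S rule: infinite_finite_induct) (auto simp: compactly_supported_0 compactly_supported_add)

lemma compactly_supported_translate: "compactly_supported f \<Longrightarrow> compactly_supported (translate_l2 a f)"
proof transfer
  fix f :: "'a \<Rightarrow> complex" and a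
  assume "\<exists>S. compact S \<and> (AE x in lborel. x \<notin> S \<longrightarrow> f x = 0)"
  then obtain S where S: "compact S" "AE x in lborel. x \<notin> S \<longrightarrow> f x = 0" by blast
  from AE_lborel_translate[OF S(2), of a]
  have "AE x in lborel. x \<notin> (+) a ` S \<longrightarrow> f (x - a) = 0"
    by (rule eventually_mono) (auto simp: image_iff)
  then show "\<exists>S. compact S \<and> (AE x in lborel. x \<notin> S \<longrightarrow> f (x - a) = 0)"
    using compact_translation[OF S(1), of a] by blast
qed

text \<open>A large translation separates the two supports.\<close>

lemma cinner_translate_eventually_zero:
  "compactly_supported f \<Longrightarrow> compactly_supported g \<Longrightarrow> \<exists>R. \<forall>a. norm a > R \<longrightarrow> cinner_l2 f (translate_l2 a g) = 0"
proof transfer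
  fix f g :: "'a \<Rightarrow> complex"
  assume "\<exists>S. compact S \<and> (AE x in lborel. x \<notin> S \<longrightarrow> f x = 0)" "\<exists>S. compact S \<and> (AE x in lborel. x \<notin> S \<longrightarrow> g x = 0)"
  then obtain S T where *: "compact S" "AE x in lborel. x \<notin> S \<longrightarrow> f x = 0" "compact T" "AE x in lborel. x \<notin> T \<longrightarrow> g x = 0"
    by blast
  obtain r1 r2 where r: "\<And>x. x \<in> S \<Longrightarrow> norm x \<le> r1" "\<And>x. x \<in> T \<Longrightarrow> norm x \<le> r2"
    using compact_imp_bounded[OF *(1)] compact_imp_bounded[OF *(3)] unfolding bounded_iff by blast
  have "(\<integral>x. f x * cnj (g (x - a)) \<partial>lborel) = 0" if a: "norm a > r1 + r2" for a
  proof (rule integral_eq_zero_AE)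
    from *(2) AE_lborel_translate[OF *(4), of a]
    show "AE x in lborel. f x * cnj (g (x - a)) = 0"
    proof eventually_elim
      case (elim x)
      have "\<not> (x \<in> S \<and> x - a \<in> T)"
        using r(1)[of x] r(2)[of "x - a"] a norm_triangle_ineq4[of x "x - a"] by auto
      then show ?case using elim by auto
    qed
  qed
  then show "\<exists>R. \<forall>a. norm a > R \<longrightarrow> (\<integral>x. f x * cnj (g (x - a)) \<partial>lborel) = 0" by blast
qed

lemma finite_bounded_int_vectors: "finite {g :: int ^ 'n::finite. norm (\<chi> k. real_of_int (g $ k)) \<le> R}"
proof -
  let ?N = "\<lfloor>R\<rfloor>"
  have sub: "vec_nth ` {g :: int ^ 'n. norm (\<chi> k. real_of_int (g $ k)) \<le> R} \<subseteq> PiE UNIV (\<lambda>_. {- ?N..?N})"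
  proof safe
    fix g :: "int ^ 'n" and k :: 'n
    assume "norm (\<chi> k. real_of_int (g $ k)) \<le> R"
    then have "\<bar>real_of_int (g $ k)\<bar> \<le> R"
      using component_le_norm_cart[of "\<chi> k. real_of_int (g $ k)" k] by simp
    then have "real_of_int \<bar>g $ k\<bar> \<le> R" by simp
    then have "\<bar>g $ k\<bar> \<le> ?N" by (simp only: le_floor_iff)
    then show "g $ k \<in> {- ?N..?N}" by auto
  qed auto
  have "finite (vec_nth ` {g :: int ^ 'n. norm (\<chi> k. real_of_int (g $ k)) \<le> R})"
    by (rule finite_subset[OF sub]) (rule finite_PiE, auto)
  then show ?thesis by (rule finite_imageD) (auto simp: inj_on_def vec_nth_inject)
qed

lemma \<nu>_simps:
  "\<nu> g (f + h) = \<nu> g f + \<nu> g h" "\<nu> g (c *\<^sub>C f) = c *\<^sub>C \<nu> g f" "\<nu> g (\<nu> g' f) = \<nu> (g + g') f" "\<nu> 0 f = f"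
proof -
  have "(\<chi> k. real_of_int (g $ k)) + (\<chi> k. real_of_int (g' $ k)) = (\<chi> k. real_of_int ((g + g') $ k))"
    by (simp add: vec_eq_iff)
  then show "\<nu> g (\<nu> g' f) = \<nu> (g + g') f" by (simp add: \<nu>_def translate_l2_simps)
  have "(\<chi> k. real_of_int ((0 :: int ^ 'a) $ k)) = 0" by (simp add: vec_eq_iff)
  then show "\<nu> 0 f = f" unfolding \<nu>_def by (simp only: translate_l2_simps)
qed (simp_all add: \<nu>_def translate_l2_simps)

lemma \<nu>_0 [simp]: "\<nu> g 0 = 0"
  using \<nu>_simps(2)[of g 0 0] by simp

lemma \<nu>_sum: "\<nu> g (sum f S) = (\<Sum>i\<in>S. \<nu> g (f i))"
  by (induction S rule: infinite_finite_induct) (auto simp: \<nu>_simps)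

lemma cinner_\<nu>: "cinner_l2 (\<nu> g f) (\<nu> h f') = cinner_l2 f (\<nu> (h - g) f')"
proof -
  have "\<nu> h f' = \<nu> g (\<nu> (h - g) f')" by (simp add: \<nu>_simps)
  then show ?thesis by (simp only: \<nu>_def cinner_translate)
qed

lemma cinner_\<nu>_left: "cinner_l2 (\<nu> g f) f' = cinner_l2 f (\<nu> (- g) f')"
  using cinner_\<nu>[of g f 0 f'] by (simp add: \<nu>_simps)

lemma compactly_supported_\<nu>: "compactly_supported f \<Longrightarrow> compactly_supported (\<nu> g f)"
  by (simp add: \<nu>_def compactly_supported_translate)

lemma finite_cinner_support:
  assumes "compactly_supported f" "compactly_supported h"
  shows "finite {g. cinner_l2 f (\<nu> g h) \<noteq> 0}"
proof -
  obtain R where "\<And>a. norm a > R \<Longrightarrow> cinner_l2 f (translate_l2 a h) = 0"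
    using cinner_translate_eventually_zero[OF assms] by blast
  then have "{g. cinner_l2 f (\<nu> g h) \<noteq> 0} \<subseteq> {g. norm (\<chi> k. real_of_int (g $ k)) \<le> R}"
    by (auto simp: \<nu>_def not_less[symmetric])
  then show ?thesis by (rule finite_subset[OF _ finite_bounded_int_vectors])
qed

text \<open>Finite partial sums avoid any summability hypothesis; the bound for the infinite sum is their supremum.\<close>

definition bessel_on :: "'a::euclidean_space l2 set \<Rightarrow> 'i set \<Rightarrow> ('i \<Rightarrow> 'a l2) \<Rightarrow> real \<Rightarrow> bool" where
  "bessel_on K I \<xi> B \<longleftrightarrow> (\<forall>v\<in>K. \<forall>F. finite F \<longrightarrow> F \<subseteq> I \<longrightarrow> (\<Sum>i\<in>F. (cmod (cinner_l2 v (\<xi> i)))\<^sup>2) \<le> B * (norm v)\<^sup>2)"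

lemma bessel_onD: "bessel_on K I \<xi> B \<Longrightarrow> v \<in> K \<Longrightarrow> finite F \<Longrightarrow> F \<subseteq> I \<Longrightarrow> (\<Sum>i\<in>F. (cmod (cinner_l2 v (\<xi> i)))\<^sup>2) \<le> B * (norm v)\<^sup>2"
  by (simp add: bessel_on_def)

text \<open>The synthesis map is the adjoint of the analysis map, so it has the same bound.\<close>

lemma bessel_synthesis:
  assumes B: "bessel_on K I \<xi> B" "B \<ge> 0" and K: "l2.subspace K" "\<And>i. i \<in> I \<Longrightarrow> \<xi> i \<in> K" and F: "finite F" "F \<subseteq> I"
  shows "norm (\<Sum>i\<in>F. c i *\<^sub>C \<xi> i) \<le> sqrt B * L2_set (\<lambda>i. cmod (c i)) F"
proof -
  let ?s = "\<Sum>i\<in>F. c i *\<^sub>C \<xi> i"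
  have sK: "?s \<in> K" using F K by (intro l2.subspace_sum l2.subspace_scale) auto
  have "complex_of_real ((norm ?s)\<^sup>2) = (\<Sum>i\<in>F. c i * cinner_l2 (\<xi> i) ?s)"
    unfolding cinner_self[symmetric] by (subst cinner_sum_left) (simp add: cinner_scale_left)
  then have "(norm ?s)\<^sup>2 = cmod (\<Sum>i\<in>F. c i * cinner_l2 (\<xi> i) ?s)"
    by (metis norm_of_real abs_of_nonneg zero_le_power2)
  also have "\<dots> \<le> (\<Sum>i\<in>F. cmod (c i * cinner_l2 (\<xi> i) ?s))" by (rule norm_sum)
  also have "\<dots> = (\<Sum>i\<in>F. \<bar>cmod (c i)\<bar> * \<bar>cmod (cinner_l2 ?s (\<xi> i))\<bar>)"
    by (subst cinner_commute) (simp add: norm_mult)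
  also have "\<dots> \<le> L2_set (\<lambda>i. cmod (c i)) F * L2_set (\<lambda>i. cmod (cinner_l2 ?s (\<xi> i))) F"
    by (rule L2_set_mult_ineq)
  also have "\<dots> \<le> L2_set (\<lambda>i. cmod (c i)) F * (sqrt B * norm ?s)"
  proof (intro mult_left_mono)
    have "L2_set (\<lambda>i. cmod (cinner_l2 ?s (\<xi> i))) F \<le> sqrt (B * (norm ?s)\<^sup>2)"
      unfolding L2_set_def by (intro real_sqrt_le_mono bessel_onD[OF B(1) sK F])
    then show "L2_set (\<lambda>i. cmod (cinner_l2 ?s (\<xi> i))) F \<le> sqrt B * norm ?s"
      by (simp add: real_sqrt_mult)
  qed (rule L2_set_nonneg)
  finally have "norm ?s * norm ?s \<le> (sqrt B * L2_set (\<lambda>i. cmod (c i)) F) * norm ?s"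
    by (simp add: power2_eq_square ac_simps)
  then show ?thesis
    using B(2) by (cases "norm ?s = 0") (simp_all add: L2_set_nonneg)
qed

text \<open>On finite combinations of the \<open>\<xi> i\<close> the expansion is exact by bi-orthogonality. The partial sums are
  bounded uniformly as operators on \<open>K\<close>, so the expansion carries over to limits of such combinations.\<close>

lemma biorthogonal_expansion:
  assumes B: "bessel_on K I \<xi> B" "B \<ge> 0" "bessel_on K I \<xi>' B'" "B' \<ge> 0"
    and K: "l2.subspace K" "\<And>i. i \<in> I \<Longrightarrow> \<xi> i \<in> K"
    and dense: "K \<subseteq> closure (l2.span (\<xi> ` I))"
    and bi: "\<And>i j. i \<in> I \<Longrightarrow> j \<in> I \<Longrightarrow> cinner_l2 (\<xi> i) (\<xi>' j) = (if i = j then 1 else 0)"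
    and v: "v \<in> K"
  shows "((\<lambda>i. cinner_l2 v (\<xi>' i) *\<^sub>C \<xi> i) has_sum v) I"
proof -
  define S where "S F v = (\<Sum>i\<in>F. cinner_l2 v (\<xi>' i) *\<^sub>C \<xi> i)" for F v
  have S_bound: "norm (S F v) \<le> sqrt B * sqrt B' * norm v" if "finite F" "F \<subseteq> I" "v \<in> K" for F v
  proof -
    have "norm (S F v) \<le> sqrt B * L2_set (\<lambda>i. cmod (cinner_l2 v (\<xi>' i))) F"
      unfolding S_def by (rule bessel_synthesis[OF B(1,2) K that(1,2)])
    also have "\<dots> \<le> sqrt B * sqrt (B' * (norm v)\<^sup>2)"
      unfolding L2_set_def using B(2) by (intro mult_left_mono real_sqrt_le_mono bessel_onD[OF B(3)] that) auto
    finally show ?thesis by (simp add: real_sqrt_mult)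
  qed
  have S_diff: "S F (u - w) = S F u - S F w" for F u w
    by (simp add: S_def cinner_diff_left l2.scale_left_diff_distrib sum_subtractf)
  have span: "u \<in> K \<and> (\<exists>F0. finite F0 \<and> F0 \<subseteq> I \<and> (\<forall>F. finite F \<longrightarrow> F0 \<subseteq> F \<longrightarrow> F \<subseteq> I \<longrightarrow> S F u = u))"
    if "u \<in> l2.span (\<xi> ` I)" for u
    using that
  proof (induction rule: l2.span_induct_alt)
    case base
    then show ?case using l2.subspace_0[OF K(1)] by (auto simp: S_def intro!: exI[of _ "{}"])
  next
    case (step c x y)
    then obtain i where i: "i \<in> I" "x = \<xi> i" by blast
    obtain F0 where F0: "finite F0" "F0 \<subseteq> I" "\<And>F. finite F \<Longrightarrow> F0 \<subseteq> F \<Longrightarrow> F \<subseteq> I \<Longrightarrow> S F y = y"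
      using step by blast
    have "S F (c *\<^sub>C x + y) = c *\<^sub>C x + y" if "finite F" "insert i F0 \<subseteq> F" "F \<subseteq> I" for F
    proof -
      have "S F (c *\<^sub>C x + y) = (\<Sum>j\<in>F. (c * cinner_l2 (\<xi> i) (\<xi>' j)) *\<^sub>C \<xi> j) + S F y"
        by (simp add: S_def i(2) cinner_add_left cinner_scale_left l2.scale_left_distrib sum.distrib)
      also have "(\<Sum>j\<in>F. (c * cinner_l2 (\<xi> i) (\<xi>' j)) *\<^sub>C \<xi> j) = (\<Sum>j\<in>F. if j = i then c *\<^sub>C \<xi> j else 0)"
        using that(3) by (intro sum.cong) (auto simp: bi[OF i(1)])
      also have "\<dots> = c *\<^sub>C x" using that by (simp add: i(2))
      finally show ?thesis using F0(3)[of F] that by simp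
    qed
    moreover have "c *\<^sub>C x + y \<in> K"
      using step i K by (intro l2.subspace_add l2.subspace_scale) auto
    ultimately show ?case using F0(1,2) i(1) by (intro conjI exI[of _ "insert i F0"]) auto
  qed
  show ?thesis
    unfolding has_sum_def
  proof (rule tendstoI)
    fix e :: real assume e: "e > 0"
    define M where "M = sqrt B * sqrt B' + 1"
    have M: "M > 0" using B(2,4) by (simp add: M_def add_nonneg_pos)
    obtain u where u: "u \<in> l2.span (\<xi> ` I)" "dist u v < e / M"
      using dense v e M unfolding closure_approachable subset_iff by (meson divide_pos_pos)
    obtain F0 where F0: "u \<in> K" "finite F0" "F0 \<subseteq> I" "\<And>F. finite F \<Longrightarrow> F0 \<subseteq> F \<Longrightarrow> F \<subseteq> I \<Longrightarrow> S F u = u"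
      using span[OF u(1)] by blast
    have "dist (S F v) v < e" if F: "finite F" "F0 \<subseteq> F" "F \<subseteq> I" for F
    proof -
      have "S F v - v = S F (v - u) + (u - v)" using F0(4)[OF F] by (simp add: S_diff)
      then have "norm (S F v - v) \<le> norm (S F (v - u)) + norm (u - v)" by (metis norm_triangle_ineq)
      also have "\<dots> \<le> sqrt B * sqrt B' * norm (v - u) + norm (u - v)"
        using S_bound[OF F(1,3) l2.subspace_diff[OF K(1) v F0(1)]] by simp
      also have "\<dots> = M * norm (u - v)" by (simp add: M_def norm_minus_commute algebra_simps)
      also have "\<dots> < e" using u(2) M by (simp add: dist_norm field_simps)
      finally show ?thesis by (simp add: dist_norm)
    qed
    then show "eventually (\<lambda>F. dist (\<Sum>i\<in>F. cinner_l2 v (\<xi>' i) *\<^sub>C \<xi> i) v < e) (finite_subsets_at_top I)"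
      unfolding eventually_finite_subsets_at_top S_def using F0(2,3) by blast
  qed
qed

text \<open>The lower frame bound comes from the expansion and the bound of the synthesis map with the other
  family.\<close>

lemma is_frame_from_expansion:
  assumes B: "bessel_on K I \<xi> B" "B > 0" "bessel_on K I \<xi>' B'" "B' > 0"
    and K: "l2.subspace K" "\<And>i. i \<in> I \<Longrightarrow> \<xi> i \<in> K" "\<And>i. i \<in> I \<Longrightarrow> \<xi>' i \<in> K" and I: "countable I"
    and expand: "\<And>v. v \<in> K \<Longrightarrow> ((\<lambda>i. cinner_l2 v (\<xi>' i) *\<^sub>C \<xi> i) has_sum v) I"
  shows "is_frame K I \<xi>'"
proof -
  have main: "(\<lambda>i. (cmod (cinner_l2 v (\<xi>' i)))\<^sup>2) summable_on I \<and>
      1 / B * (norm v)\<^sup>2 \<le> (\<Sum>\<^sub>\<infinity>i\<in>I. (cmod (cinner_l2 v (\<xi>' i)))\<^sup>2) \<and>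
      (\<Sum>\<^sub>\<infinity>i\<in>I. (cmod (cinner_l2 v (\<xi>' i)))\<^sup>2) \<le> B' * (norm v)\<^sup>2" if v: "v \<in> K" for v
  proof -
  let ?f = "\<lambda>i. (cmod (cinner_l2 v (\<xi>' i)))\<^sup>2"
  have summ: "?f summable_on I"
    by (rule nonneg_bdd_above_summable_on)
       (auto simp: bdd_above_def intro!: exI[of _ "B' * (norm v)\<^sup>2"] bessel_onD[OF B(3) v])
  have upper: "infsum ?f I \<le> B' * (norm v)\<^sup>2"
    by (rule infsum_le_finite_sums[OF summ]) (rule bessel_onD[OF B(3) v])
  have "norm v \<le> sqrt B * sqrt (infsum ?f I)"
  proof (rule tendsto_upperbound)
    show "((\<lambda>F. norm (\<Sum>i\<in>F. cinner_l2 v (\<xi>' i) *\<^sub>C \<xi> i)) \<longlongrightarrow> norm v) (finite_subsets_at_top I)"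
      using expand[OF v] unfolding has_sum_def by (rule tendsto_norm)
    show "eventually (\<lambda>F. norm (\<Sum>i\<in>F. cinner_l2 v (\<xi>' i) *\<^sub>C \<xi> i) \<le> sqrt B * sqrt (infsum ?f I)) (finite_subsets_at_top I)"
    proof (rule eventually_finite_subsets_at_top_weakI)
      fix F assume F: "finite F" "F \<subseteq> I"
      have "norm (\<Sum>i\<in>F. cinner_l2 v (\<xi>' i) *\<^sub>C \<xi> i) \<le> sqrt B * L2_set (\<lambda>i. cmod (cinner_l2 v (\<xi>' i))) F"
        by (rule bessel_synthesis[OF B(1) _ K(1,2) F]) (use B(2) in auto)
      also have "\<dots> \<le> sqrt B * sqrt (infsum ?f I)"
        unfolding L2_set_def using B(2) summ F
        by (intro mult_left_mono real_sqrt_le_mono finite_sum_le_infsum) auto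
      finally show "norm (\<Sum>i\<in>F. cinner_l2 v (\<xi>' i) *\<^sub>C \<xi> i) \<le> sqrt B * sqrt (infsum ?f I)" .
    qed
  qed simp
  then have "(norm v)\<^sup>2 \<le> (sqrt B * sqrt (infsum ?f I))\<^sup>2" by (rule power_mono) simp
  also have "\<dots> = B * infsum ?f I"
    using B(2) infsum_nonneg[of I ?f] by (simp add: power_mult_distrib)
  finally have "1 / B * (norm v)\<^sup>2 \<le> infsum ?f I" using B(2) by (simp add: field_simps)
  then show ?thesis using summ upper by blast
  qed
  have "0 < 1 / B" using B(2) by simp
  then show ?thesis unfolding is_frame_def using I K(3) B(4) main by blast
qed

theorem biorthogonal_dual_framesI:
  assumes B: "bessel_on K I \<xi> B" "B > 0" "bessel_on K I \<xi>' B'" "B' > 0"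
    and K: "l2.subspace K" "\<And>i. i \<in> I \<Longrightarrow> \<xi> i \<in> K" "\<And>i. i \<in> I \<Longrightarrow> \<xi>' i \<in> K" and I: "countable I"
    and dense: "K \<subseteq> closure (l2.span (\<xi> ` I))" "K \<subseteq> closure (l2.span (\<xi>' ` I))"
    and bi: "\<And>i j. i \<in> I \<Longrightarrow> j \<in> I \<Longrightarrow> cinner_l2 (\<xi> i) (\<xi>' j) = (if i = j then 1 else 0)"
  shows "biorthogonal_dual_frames K I \<xi> \<xi>'"
proof -
  have bi': "cinner_l2 (\<xi>' i) (\<xi> j) = (if i = j then 1 else 0)" if "i \<in> I" "j \<in> I" for i j
    by (subst cinner_commute) (simp add: bi[OF that(2,1)])
  have e: "((\<lambda>i. cinner_l2 v (\<xi>' i) *\<^sub>C \<xi> i) has_sum v) I" if "v \<in> K" for v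
    by (rule biorthogonal_expansion[OF B(1) _ B(3) _ K(1,2) dense(1) bi that]) (use B in auto)
  have e': "((\<lambda>i. cinner_l2 v (\<xi> i) *\<^sub>C \<xi>' i) has_sum v) I" if "v \<in> K" for v
    by (rule biorthogonal_expansion[OF B(3) _ B(1) _ K(1,3) dense(2) bi' that]) (use B in auto)
  have "is_frame K I \<xi>'" by (rule is_frame_from_expansion[OF B K I e])
  moreover have "is_frame K I \<xi>" by (rule is_frame_from_expansion[OF B(3,4,1,2) K(1,3,2) I e'])
  ultimately show ?thesis
    unfolding biorthogonal_dual_frames_def dual_frames_def using e e' bi by blast
qed

section \<open>The group ring acting on compactly supported functions\<close>

text \<open>A ring element acts by the corresponding combination of translations. Its adjoint \<open>coact\<close> is the
  action of the element with conjugated coefficients and inverted exponents.\<close>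

definition act :: "'n::finite group_ring \<Rightarrow> (real ^ 'n) l2 \<Rightarrow> (real ^ 'n) l2" where
  "act r f = (\<Sum>g\<in>keys r. lookup r g *\<^sub>C \<nu> g f)"

definition coact :: "'n::finite group_ring \<Rightarrow> (real ^ 'n) l2 \<Rightarrow> (real ^ 'n) l2" where
  "coact r f = (\<Sum>g\<in>keys r. cnj (lookup r g) *\<^sub>C \<nu> (- g) f)"

text \<open>The inner product with values in the group ring. For compactly supported arguments it is linear over
  the group ring (\<open>bracket_act\<close>, \<open>bracket_coact\<close>).\<close>

definition bracket :: "(real ^ 'n::finite) l2 \<Rightarrow> (real ^ 'n) l2 \<Rightarrow> 'n group_ring" where
  "bracket f h = Abs_poly_mapping (\<lambda>g. cinner_l2 f (\<nu> g h))"

lemma act_superset: "finite S \<Longrightarrow> keys r \<subseteq> S \<Longrightarrow> act r f = (\<Sum>g\<in>S. lookup r g *\<^sub>C \<nu> g f)"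
  unfolding act_def by (intro sum.mono_neutral_left) (auto simp: in_keys_iff)

lemma coact_superset: "finite S \<Longrightarrow> keys r \<subseteq> S \<Longrightarrow> coact r f = (\<Sum>g\<in>S. cnj (lookup r g) *\<^sub>C \<nu> (- g) f)"
  unfolding coact_def by (intro sum.mono_neutral_left) (auto simp: in_keys_iff)

lemma act_add: "act (r + s) f = act r f + act s f"
  using act_superset[of "keys r \<union> keys s" r] act_superset[of "keys r \<union> keys s" s]
    act_superset[of "keys r \<union> keys s" "r + s"] keys_add[of r s]
  by (simp add: lookup_add l2.scale_left_distrib sum.distrib)

lemma coact_add: "coact (r + s) f = coact r f + coact s f"
  using coact_superset[of "keys r \<union> keys s" r] coact_superset[of "keys r \<union> keys s" s]
    coact_superset[of "keys r \<union> keys s" "r + s"] keys_add[of r s]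
  by (simp add: lookup_add l2.scale_left_distrib sum.distrib)

lemma act_monomial: "act (monomial g c) f = c *\<^sub>C \<nu> g f"
  using act_superset[of "{g}" "monomial g c"] by simp

lemma coact_monomial: "coact (monomial g c) f = cnj c *\<^sub>C \<nu> (- g) f"
  using coact_superset[of "{g}" "monomial g c"] by simp

lemma act_add_right: "act r (f + h) = act r f + act r h"
  by (simp add: act_def \<nu>_simps l2.scale_right_distrib sum.distrib)

lemma coact_add_right: "coact r (f + h) = coact r f + coact r h"
  by (simp add: coact_def \<nu>_simps l2.scale_right_distrib sum.distrib)

lemma act_0 [simp]: "act 0 f = 0" "act r 0 = 0" and coact_0 [simp]: "coact 0 f = 0" "coact r 0 = 0"
  by (simp_all add: act_def coact_def)

lemma act_sum: "act (sum r S) f = (\<Sum>i\<in>S. act (r i) f)"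
  and coact_sum: "coact (sum r S) f = (\<Sum>i\<in>S. coact (r i) f)"
  by (induction S rule: infinite_finite_induct; simp add: act_add coact_add)+

lemma act_sum_right: "act r (sum f S) = (\<Sum>i\<in>S. act r (f i))"
  and coact_sum_right: "coact r (sum f S) = (\<Sum>i\<in>S. coact r (f i))"
  by (induction S rule: infinite_finite_induct; simp add: act_add_right coact_add_right)+

lemma act_mult: "act (r * s) f = act r (act s f)"
proof (induction r arbitrary: s rule: group_ring_induct)
  case (single g c)
  show ?case
    by (induction s rule: group_ring_induct)
       (simp_all add: mult_single act_monomial \<nu>_simps distrib_left act_add l2.scale_right_distrib)
qed (simp add: distrib_right act_add)

lemma coact_mult: "coact (r * s) f = coact r (coact s f)"
proof (induction r arbitrary: s rule: group_ring_induct)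
  case (single g c)
  show ?case
    by (induction s rule: group_ring_induct)
       (simp_all add: mult_single coact_monomial \<nu>_simps distrib_left coact_add l2.scale_right_distrib)
qed (simp add: distrib_right coact_add)

lemma compactly_supported_act: "compactly_supported f \<Longrightarrow> compactly_supported (act r f)"
  and compactly_supported_coact: "compactly_supported f \<Longrightarrow> compactly_supported (coact r f)"
  by (simp_all add: act_def coact_def compactly_supported_sum compactly_supported_scale compactly_supported_\<nu>)

lemma lookup_bracket:
  "compactly_supported f \<Longrightarrow> compactly_supported h \<Longrightarrow> lookup (bracket f h) g = cinner_l2 f (\<nu> g h)"
  using finite_cinner_support[of f h] by (simp add: bracket_def)

lemma bracket_add_left:
  "compactly_supported f \<Longrightarrow> compactly_supported f' \<Longrightarrow> compactly_supported h \<Longrightarrow> bracket (f + f') h = bracket f h + bracket f' h"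
  by (rule poly_mapping_eqI) (simp add: lookup_bracket lookup_add cinner_add_left compactly_supported_add)

lemma bracket_add_right:
  "compactly_supported f \<Longrightarrow> compactly_supported h \<Longrightarrow> compactly_supported h' \<Longrightarrow> bracket f (h + h') = bracket f h + bracket f h'"
  by (rule poly_mapping_eqI) (simp add: lookup_bracket lookup_add cinner_add_right compactly_supported_add \<nu>_simps)

lemma bracket_0 [simp]: "bracket 0 h = 0" "bracket f 0 = 0"
  by (simp_all add: bracket_def)

lemma bracket_sum_left:
  assumes "\<And>i. i \<in> S \<Longrightarrow> compactly_supported (f i)" "compactly_supported h"
  shows "bracket (sum f S) h = (\<Sum>i\<in>S. bracket (f i) h)"
  using assms(1) by (induction S rule: infinite_finite_induct)
    (simp_all add: bracket_add_left compactly_supported_sum assms(2))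

lemma bracket_sum_right:
  assumes "\<And>i. i \<in> S \<Longrightarrow> compactly_supported (f i)" "compactly_supported h"
  shows "bracket h (sum f S) = (\<Sum>i\<in>S. bracket h (f i))"
  using assms(1) by (induction S rule: infinite_finite_induct)
    (simp_all add: bracket_add_right compactly_supported_sum assms(2))

lemma bracket_act:
  assumes "compactly_supported f" "compactly_supported h"
  shows "bracket (act r f) h = r * bracket f h"
proof (induction r rule: group_ring_induct)
  case (single g c)
  show ?case
  proof (rule poly_mapping_eqI)
    fix k
    have "lookup (bracket (act (monomial g c) f) h) k = c * cinner_l2 f (\<nu> (k - g) h)"
      using assms by (simp add: lookup_bracket compactly_supported_act)
        (simp add: act_monomial cinner_scale_left cinner_\<nu>)
    also have "\<dots> = lookup (bracket f h * monomial g c) k"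
      using assms by (simp add: lookup_mult_monomial lookup_bracket)
    finally show "lookup (bracket (act (monomial g c) f) h) k = lookup (monomial g c * bracket f h) k"
      by (simp add: mult.commute)
  qed
next
  case (add r s)
  then show ?case using assms by (simp add: act_add bracket_add_left compactly_supported_act distrib_right)
qed

lemma bracket_coact:
  assumes "compactly_supported f" "compactly_supported h"
  shows "bracket f (coact r h) = r * bracket f h"
proof (induction r rule: group_ring_induct)
  case (single g c)
  show ?case
  proof (rule poly_mapping_eqI)
    fix k
    have "lookup (bracket f (coact (monomial g c) h)) k = c * cinner_l2 f (\<nu> (k - g) h)"
      using assms by (simp add: lookup_bracket compactly_supported_coact)
        (simp add: coact_monomial cinner_scale_right \<nu>_simps)
    also have "\<dots> = lookup (bracket f h * monomial g c) k"
      using assms by (simp add: lookup_mult_monomial lookup_bracket)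
    finally show "lookup (bracket f (coact (monomial g c) h)) k = lookup (monomial g c * bracket f h) k"
      by (simp add: mult.commute)
  qed
next
  case (add r s)
  then show ?case using assms by (simp add: coact_add bracket_add_right compactly_supported_coact distrib_right)
qed

lemma act_coact_closed:
  assumes "P 0" "\<And>f h. P f \<Longrightarrow> P h \<Longrightarrow> P (f + h)" "\<And>c f. P f \<Longrightarrow> P (c *\<^sub>C f)" "\<And>g f. P f \<Longrightarrow> P (\<nu> g f)"
  shows "P f \<Longrightarrow> P (act r f)" "P f \<Longrightarrow> P (coact r f)" "(\<And>i. i \<in> S \<Longrightarrow> P (F i)) \<Longrightarrow> P (sum F S)"
proof -
  show sum: "(\<And>i. i \<in> S \<Longrightarrow> P (F i)) \<Longrightarrow> P (sum F S)" for S :: "'s set" and F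
    by (induction S rule: infinite_finite_induct) (auto simp: assms)
  have sum': "(\<And>i. i \<in> S \<Longrightarrow> P (F i)) \<Longrightarrow> P (sum F S)" for S :: "(int ^ 'a) set" and F
    by (induction S rule: infinite_finite_induct) (auto simp: assms)
  show "P f \<Longrightarrow> P (act r f)" "P f \<Longrightarrow> P (coact r f)"
    unfolding act_def coact_def by (auto intro!: sum' assms)
qed

definition bessel :: "(real ^ 'n::finite) l2 set \<Rightarrow> (real ^ 'n) l2 \<Rightarrow> bool" where
  "bessel K f \<longleftrightarrow> (\<exists>B\<ge>0. bessel_on K UNIV (\<lambda>g. \<nu> g f) B)"

lemma bessel_0: "bessel K 0"
  unfolding bessel_def bessel_on_def by (intro exI[of _ 0]) simp

lemma bessel_add: "bessel K f \<Longrightarrow> bessel K h \<Longrightarrow> bessel K (f + h)"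
proof -
  assume "bessel K f" "bessel K h"
  then obtain B B' where B: "B \<ge> 0" "bessel_on K UNIV (\<lambda>g. \<nu> g f) B" "B' \<ge> 0" "bessel_on K UNIV (\<lambda>g. \<nu> g h) B'"
    by (auto simp: bessel_def)
  have "bessel_on K UNIV (\<lambda>g. \<nu> g (f + h)) (2 * B + 2 * B')"
    unfolding bessel_on_def
  proof (intro ballI allI impI)
    fix v and F :: "(int ^ 'a) set" assume v: "v \<in> K" and F: "finite F"
    have "(cmod (cinner_l2 v (\<nu> g (f + h))))\<^sup>2 \<le> 2 * (cmod (cinner_l2 v (\<nu> g f)))\<^sup>2 + 2 * (cmod (cinner_l2 v (\<nu> g h)))\<^sup>2" for g
    proof -
      let ?a = "cinner_l2 v (\<nu> g f)" and ?b = "cinner_l2 v (\<nu> g h)"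
      have "(cmod (?a + ?b))\<^sup>2 \<le> (cmod ?a + cmod ?b)\<^sup>2" by (intro power_mono norm_triangle_ineq) auto
      also have "\<dots> \<le> 2 * (cmod ?a)\<^sup>2 + 2 * (cmod ?b)\<^sup>2"
        using sum_squares_bound[of "cmod ?a" "cmod ?b"] by (simp add: power2_sum)
      finally show ?thesis by (simp add: \<nu>_simps cinner_add_right)
    qed
    then have "(\<Sum>g\<in>F. (cmod (cinner_l2 v (\<nu> g (f + h))))\<^sup>2)
        \<le> (\<Sum>g\<in>F. 2 * (cmod (cinner_l2 v (\<nu> g f)))\<^sup>2 + 2 * (cmod (cinner_l2 v (\<nu> g h)))\<^sup>2)"
      by (rule sum_mono)
    also have "\<dots> = 2 * (\<Sum>g\<in>F. (cmod (cinner_l2 v (\<nu> g f)))\<^sup>2) + 2 * (\<Sum>g\<in>F. (cmod (cinner_l2 v (\<nu> g h)))\<^sup>2)"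
      by (simp add: sum.distrib sum_distrib_left)
    also have "\<dots> \<le> 2 * (B * (norm v)\<^sup>2) + 2 * (B' * (norm v)\<^sup>2)"
      by (intro add_mono mult_left_mono bessel_onD[OF B(2) v F] bessel_onD[OF B(4) v F]) auto
    finally show "(\<Sum>g\<in>F. (cmod (cinner_l2 v (\<nu> g (f + h))))\<^sup>2) \<le> (2 * B + 2 * B') * (norm v)\<^sup>2"
      by (simp add: algebra_simps)
  qed
  then show "bessel K (f + h)" unfolding bessel_def using B(1,3) by (intro exI[of _ "2 * B + 2 * B'"]) auto
qed

lemma bessel_scale: "bessel K f \<Longrightarrow> bessel K (c *\<^sub>C f)"
proof -
  assume "bessel K f"
  then obtain B where B: "B \<ge> 0" "bessel_on K UNIV (\<lambda>g. \<nu> g f) B" by (auto simp: bessel_def)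
  have "bessel_on K UNIV (\<lambda>g. \<nu> g (c *\<^sub>C f)) ((cmod c)\<^sup>2 * B)"
    unfolding bessel_on_def
  proof (intro ballI allI impI)
    fix v and F :: "(int ^ 'a) set" assume v: "v \<in> K" and F: "finite F"
    have "(\<Sum>g\<in>F. (cmod (cinner_l2 v (\<nu> g (c *\<^sub>C f))))\<^sup>2) = (cmod c)\<^sup>2 * (\<Sum>g\<in>F. (cmod (cinner_l2 v (\<nu> g f)))\<^sup>2)"
      by (simp add: \<nu>_simps cinner_scale_right norm_mult power_mult_distrib sum_distrib_left)
    also have "\<dots> \<le> (cmod c)\<^sup>2 * (B * (norm v)\<^sup>2)"
      by (intro mult_left_mono bessel_onD[OF B(2) v F]) auto
    finally show "(\<Sum>g\<in>F. (cmod (cinner_l2 v (\<nu> g (c *\<^sub>C f))))\<^sup>2) \<le> (cmod c)\<^sup>2 * B * (norm v)\<^sup>2"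
      by (simp add: mult.assoc)
  qed
  then show "bessel K (c *\<^sub>C f)" unfolding bessel_def using B(1) by (intro exI[of _ "(cmod c)\<^sup>2 * B"]) auto
qed

lemma bessel_\<nu>: "bessel K f \<Longrightarrow> bessel K (\<nu> h f)"
proof -
  assume "bessel K f"
  then obtain B where B: "B \<ge> 0" "bessel_on K UNIV (\<lambda>g. \<nu> g f) B" by (auto simp: bessel_def)
  have "bessel_on K UNIV (\<lambda>g. \<nu> g (\<nu> h f)) B"
    unfolding bessel_on_def
  proof (intro ballI allI impI)
    fix v and F :: "(int ^ 'a) set" assume v: "v \<in> K" and F: "finite F"
    have "(\<Sum>g\<in>F. (cmod (cinner_l2 v (\<nu> g (\<nu> h f))))\<^sup>2) = (\<Sum>g\<in>(\<lambda>g. g + h) ` F. (cmod (cinner_l2 v (\<nu> g f)))\<^sup>2)"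
      by (subst sum.reindex) (auto simp: inj_on_def \<nu>_simps)
    also have "\<dots> \<le> B * (norm v)\<^sup>2" by (rule bessel_onD[OF B(2) v]) (use F in auto)
    finally show "(\<Sum>g\<in>F. (cmod (cinner_l2 v (\<nu> g (\<nu> h f))))\<^sup>2) \<le> B * (norm v)\<^sup>2" .
  qed
  then show "bessel K (\<nu> h f)" unfolding bessel_def using B(1) by blast
qed

lemma bessel_from_frame:
  assumes "is_frame K (UNIV \<times> {1..d}) (translates \<zeta>)" "j \<in> {1..d}"
  shows "bessel K (\<zeta> j)"
proof -
  obtain B where B: "B > 0" "\<And>v. v \<in> K \<Longrightarrow> (\<lambda>i. (cmod (cinner_l2 v (translates \<zeta> i)))\<^sup>2) summable_on (UNIV \<times> {1..d})"
      "\<And>v. v \<in> K \<Longrightarrow> (\<Sum>\<^sub>\<infinity>i\<in>UNIV \<times> {1..d}. (cmod (cinner_l2 v (translates \<zeta> i)))\<^sup>2) \<le> B * (norm v)\<^sup>2"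
    using assms(1) unfolding is_frame_def by blast
  have "bessel_on K UNIV (\<lambda>g. \<nu> g (\<zeta> j)) B"
    unfolding bessel_on_def
  proof (intro ballI allI impI)
    fix v and F :: "(int ^ 'a) set" assume v: "v \<in> K" and F: "finite F"
    have "(\<Sum>g\<in>F. (cmod (cinner_l2 v (\<nu> g (\<zeta> j))))\<^sup>2) = (\<Sum>i\<in>(\<lambda>g. (g, j)) ` F. (cmod (cinner_l2 v (translates \<zeta> i)))\<^sup>2)"
      by (subst sum.reindex) (auto simp: inj_on_def translates_def)
    also have "\<dots> \<le> (\<Sum>\<^sub>\<infinity>i\<in>UNIV \<times> {1..d}. (cmod (cinner_l2 v (translates \<zeta> i)))\<^sup>2)"
      using F assms(2) by (intro finite_sum_le_infsum B v) auto
    also have "\<dots> \<le> B * (norm v)\<^sup>2" by (rule B(3)[OF v])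
    finally show "(\<Sum>g\<in>F. (cmod (cinner_l2 v (\<nu> g (\<zeta> j))))\<^sup>2) \<le> B * (norm v)\<^sup>2" .
  qed
  then show ?thesis unfolding bessel_def using B(1) by (intro exI[of _ B]) auto
qed

text \<open>The bounds of finitely many generators add up.\<close>

lemma bessel_translates:
  assumes "\<And>k. k \<in> {1..r} \<Longrightarrow> bessel K (\<eta> k)"
  obtains B where "B > 0" "bessel_on K (UNIV \<times> {1..r}) (translates \<eta>) B"
proof -
  have "\<forall>k\<in>{1..r}. \<exists>B. B \<ge> 0 \<and> bessel_on K UNIV (\<lambda>g. \<nu> g (\<eta> k)) B"
    using assms by (auto simp: bessel_def)
  then obtain b where b: "\<And>k. k \<in> {1..r} \<Longrightarrow> b k \<ge> 0" "\<And>k. k \<in> {1..r} \<Longrightarrow> bessel_on K UNIV (\<lambda>g. \<nu> g (\<eta> k)) (b k)"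
    by metis
  let ?B = "(\<Sum>k\<in>{1..r}. b k) + 1"
  have "bessel_on K (UNIV \<times> {1..r}) (translates \<eta>) ?B"
    unfolding bessel_on_def
  proof (intro ballI allI impI)
    fix v and F :: "((int ^ 'a) \<times> nat) set" assume v: "v \<in> K" and F: "finite F" "F \<subseteq> UNIV \<times> {1..r}"
    have "(\<Sum>i\<in>F. (cmod (cinner_l2 v (translates \<eta> i)))\<^sup>2)
        \<le> (\<Sum>i\<in>fst ` F \<times> {1..r}. (cmod (cinner_l2 v (translates \<eta> i)))\<^sup>2)"
      using F by (intro sum_mono2) (auto simp: rev_image_eqI)
    also have "\<dots> = (\<Sum>g\<in>fst ` F. \<Sum>k\<in>{1..r}. (cmod (cinner_l2 v (\<nu> g (\<eta> k))))\<^sup>2)"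
      by (simp add: sum.cartesian_product translates_def split_def)
    also have "\<dots> = (\<Sum>k\<in>{1..r}. \<Sum>g\<in>fst ` F. (cmod (cinner_l2 v (\<nu> g (\<eta> k))))\<^sup>2)"
      by (rule sum.swap)
    also have "\<dots> \<le> (\<Sum>k\<in>{1..r}. b k * (norm v)\<^sup>2)"
      by (intro sum_mono bessel_onD[OF b(2) v]) (use F in auto)
    also have "\<dots> \<le> ?B * (norm v)\<^sup>2" by (simp add: sum_distrib_right algebra_simps)
    finally show "(\<Sum>i\<in>F. (cmod (cinner_l2 v (translates \<eta> i)))\<^sup>2) \<le> ?B * (norm v)\<^sup>2" .
  qed
  moreover have "?B > 0" using b(1) by (intro add_nonneg_pos sum_nonneg) auto
  ultimately show thesis using that by blast
qed

lemma finite_expansion: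
  fixes d :: nat
  assumes "((\<lambda>(g, j). a g j *\<^sub>C \<nu> g (\<eta> j)) has_sum x) (UNIV \<times> {1..d})" "\<And>j. j \<in> {1..d} \<Longrightarrow> finite (S j)"
    "\<And>g j. j \<in> {1..d} \<Longrightarrow> g \<notin> S j \<Longrightarrow> a g j = 0"
  shows "x = (\<Sum>j\<in>{1..d}. \<Sum>g\<in>S j. a g j *\<^sub>C \<nu> g (\<eta> j))"
proof -
  let ?f = "\<lambda>(g, j). a g j *\<^sub>C \<nu> g (\<eta> j)"
  let ?T = "(\<lambda>(j, g). (g, j)) ` Sigma {1..d} S"
  have T: "finite ?T" by (intro finite_imageI finite_SigmaI) (use assms(2) in auto)
  have sub: "?T \<subseteq> UNIV \<times> {1..d}" by auto
  have neutral: "?f x = 0" if "x \<in> UNIV \<times> {1..d} - ?T" for x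
  proof -
    obtain g j where x: "x = (g, j)" by (cases x)
    then have "j \<in> {1..d}" "g \<notin> S j" using that by force+
    then show ?thesis using assms(3) x by simp
  qed
  have "(?f has_sum s) ?T \<longleftrightarrow> (?f has_sum s) (UNIV \<times> {1..d})" for s
    by (rule has_sum_cong_neutral) (use neutral sub in blast)+
  then have "(?f has_sum (\<Sum>i\<in>?T. ?f i)) (UNIV \<times> {1..d})"
    using has_sum_finite[OF T, of ?f] by blast
  then have "x = (\<Sum>i\<in>?T. ?f i)" using assms(1) has_sum_unique by blast
  also have "\<dots> = (\<Sum>(j, g)\<in>Sigma {1..d} S. a g j *\<^sub>C \<nu> g (\<eta> j))"
    by (subst sum.reindex) (auto simp: inj_on_def split_def)
  also have "\<dots> = (\<Sum>j\<in>{1..d}. \<Sum>g\<in>S j. a g j *\<^sub>C \<nu> g (\<eta> j))"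
    by (rule sum.Sigma[symmetric]) (use assms(2) in auto)
  finally show ?thesis .
qed

theorem theorem4p2:
  fixes K :: "(real ^ 'n) l2 set"
    and d :: nat
    and \<zeta> \<zeta>' :: "nat \<Rightarrow> (real ^ 'n) l2"
  assumes "module.subspace scale_l2 K"
    and "closed K"
    and "\<forall>i\<in>{1..d}. compactly_supported (\<zeta> i) \<and> compactly_supported (\<zeta>' i)"
    and "dual_G_frames K d \<zeta> \<zeta>'"
  shows "\<exists>(r::nat) (\<eta> :: nat \<Rightarrow> (real ^ 'n) l2) (\<eta>' :: nat \<Rightarrow> (real ^ 'n) l2).
           (\<forall>i\<in>{1..r}. \<eta> i \<in> K \<and> \<eta>' i \<in> K \<and>
                       compactly_supported (\<eta> i) \<and> compactly_supported (\<eta>' i)) \<and>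
           biorthogonal_G_frames K r \<eta> \<eta>'"
proof -
  let ?I = "\<lambda>d. (UNIV :: (int ^ 'n) set) \<times> {1..d::nat}"
  have frames: "is_frame K (?I d) (translates \<zeta>)" "is_frame K (?I d) (translates \<zeta>')"
    and expand: "\<And>v. v \<in> K \<Longrightarrow> ((\<lambda>i. cinner_l2 v (translates \<zeta> i) *\<^sub>C translates \<zeta>' i) has_sum v) (?I d)"
      "\<And>v. v \<in> K \<Longrightarrow> ((\<lambda>i. cinner_l2 v (translates \<zeta>' i) *\<^sub>C translates \<zeta> i) has_sum v) (?I d)"
    using assms(4) unfolding dual_G_frames_def dual_frames_def by blast+
  \<comment> \<open>matrices are indexed from zero, the given families from one\<close>
  define z where "z i = \<zeta> (Suc i)" for i
  define z' where "z' i = \<zeta>' (Suc i)" for i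
  have cs: "compactly_supported (z i)" "compactly_supported (z' i)" if "i < d" for i
    using assms(3) that by (auto simp: z_def z'_def)
  have inK: "\<nu> g (z i) \<in> K" "\<nu> g (z' i) \<in> K" if "i < d" for g i
    using frames that unfolding is_frame_def translates_def z_def z'_def by force+
  have zK: "z i \<in> K" "z' i \<in> K" if "i < d" for i
    using inK[OF that, of 0] by (simp_all add: \<nu>_simps)
  have shift: "(\<Sum>j\<in>{1..d}. h j) = (\<Sum>j<d. h (Suc j))" for h :: "nat \<Rightarrow> (real ^ 'n) l2"
    by (simp add: sum.atLeast1_atMost_eq)
  define P where "P i j = bracket (z i) (z' j)" for i j
  have P_lookup: "lookup (P i j) g = cinner_l2 (z i) (\<nu> g (z' j))" if "i < d" "j < d" for i j g
    unfolding P_def by (rule lookup_bracket) (use cs that in auto)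
  \<comment> \<open>the frame expansions of the generators are finite sums, by compactness of the supports\<close>
  have rec: "z i = (\<Sum>j<d. act (P i j) (z j))" if i: "i < d" for i
  proof -
    have "z i = (\<Sum>j\<in>{1..d}. \<Sum>g\<in>keys (P i (j - 1)). cinner_l2 (z i) (\<nu> g (\<zeta>' j)) *\<^sub>C \<nu> g (\<zeta> j))"
    proof (rule finite_expansion)
      show "((\<lambda>(g, j). cinner_l2 (z i) (\<nu> g (\<zeta>' j)) *\<^sub>C \<nu> g (\<zeta> j)) has_sum z i) (?I d)"
        using expand(2)[OF zK(1)[OF i]] by (simp add: translates_def split_def)
      show "cinner_l2 (z i) (\<nu> g (\<zeta>' j)) = 0" if "j \<in> {1..d}" "g \<notin> keys (P i (j - 1))" for g j
        using P_lookup[OF i, of "j - 1" g] that by (cases j) (auto simp: in_keys_iff z'_def)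
    qed simp
    also have "\<dots> = (\<Sum>j<d. act (P i j) (z j))"
      unfolding shift act_def
      by (intro sum.cong) (auto simp: P_lookup i z_def[symmetric] z'_def[symmetric])
    finally show ?thesis .
  qed
  have rec': "z' j = (\<Sum>i<d. coact (P i j) (z' i))" if j: "j < d" for j
  proof -
    have conj: "cinner_l2 (z' j) (\<nu> g (z i)) = cnj (lookup (P i j) (- g))" if "i < d" for g i
      by (subst cinner_commute) (simp add: cinner_\<nu>_left P_lookup that j)
    have "z' j = (\<Sum>i\<in>{1..d}. \<Sum>g\<in>uminus ` keys (P (i - 1) j). cinner_l2 (z' j) (\<nu> g (\<zeta> i)) *\<^sub>C \<nu> g (\<zeta>' i))"
    proof (rule finite_expansion)
      show "((\<lambda>(g, i). cinner_l2 (z' j) (\<nu> g (\<zeta> i)) *\<^sub>C \<nu> g (\<zeta>' i)) has_sum z' j) (?I d)"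
        using expand(1)[OF zK(2)[OF j]] by (simp add: translates_def split_def)
      show "cinner_l2 (z' j) (\<nu> g (\<zeta> i)) = 0" if "i \<in> {1..d}" "g \<notin> uminus ` keys (P (i - 1) j)" for g i
      proof -
        have "- g \<notin> keys (P (i - 1) j)" using that(2) by force
        then show ?thesis using conj[of "i - 1" g] that(1) by (cases i) (auto simp: in_keys_iff z_def)
      qed
    qed simp
    also have "\<dots> = (\<Sum>i<d. coact (P i j) (z' i))"
      unfolding shift coact_def z_def[symmetric] z'_def[symmetric]
    proof (rule sum.cong[OF refl])
      fix i assume "i \<in> {..<d}"
      then show "(\<Sum>g\<in>uminus ` keys (P (Suc i - 1) j). cinner_l2 (z' j) (\<nu> g (z i)) *\<^sub>C \<nu> g (z' i)) =
          (\<Sum>g\<in>keys (P i j). cnj (lookup (P i j) g) *\<^sub>C \<nu> (- g) (z' i))"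
        unfolding diff_Suc_1 by (subst sum.reindex) (auto simp: conj inj_on_def)
    qed
    finally show ?thesis .
  qed
  have idem: "(\<Sum>k<d. P i k * P k j) = P i j" if "i < d" "j < d" for i j
  proof -
    have "P i j = bracket (\<Sum>k<d. act (P i k) (z k)) (z' j)" using rec[OF that(1)] by (simp add: P_def)
    also have "\<dots> = (\<Sum>k<d. P i k * P k j)"
      using cs that by (subst bracket_sum_left) (auto simp: bracket_act compactly_supported_act P_def)
    finally show ?thesis ..
  qed
  have "\<exists>r B C. (\<forall>i<d. \<forall>j<d. (\<Sum>k<r. B i k * C k j) = P i j) \<and>
      (\<forall>k<r. \<forall>l<r. (\<Sum>i<d. C k i * B i l) = unit_vec k l)"
    by (rule idempotent_splits) (rule idem)
  then obtain r B C where "\<forall>i<d. \<forall>j<d. (\<Sum>k<r. B i k * C k j) = P i j"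
      "\<forall>k<r. \<forall>l<r. (\<Sum>i<d. C k i * B i l) = unit_vec k l"
    by (elim exE conjE) (rule that)
  then have BC: "\<And>i j. i < d \<Longrightarrow> j < d \<Longrightarrow> (\<Sum>k<r. B i k * C k j) = P i j"
      and CB: "\<And>k l. k < r \<Longrightarrow> l < r \<Longrightarrow> (\<Sum>i<d. C k i * B i l) = unit_vec k l"
    by simp_all
  define e where "e k = (\<Sum>j<d. act (C k j) (z j))" for k
  define e' where "e' k = (\<Sum>j<d. coact (B j k) (z' j))" for k
  have e_cs: "compactly_supported (e k)" "compactly_supported (e' k)" for k
    unfolding e_def e'_def
    by (intro compactly_supported_sum compactly_supported_act compactly_supported_coact cs; simp)+
  have "bracket (e k) (e' l) = unit_vec k l" if kl: "k < r" "l < r" for k l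
  proof -
    have "bracket (e k) (e' l) = (\<Sum>i<d. C k i * bracket (z i) (e' l))"
      unfolding e_def using cs e_cs by (subst bracket_sum_left) (auto simp: bracket_act compactly_supported_act)
    also have "\<dots> = (\<Sum>i<d. C k i * (\<Sum>j<d. B j l * P i j))"
      unfolding e'_def P_def using cs
      by (intro sum.cong refl, subst bracket_sum_right) (auto simp: bracket_coact compactly_supported_coact)
    also have "\<dots> = (\<Sum>i<d. \<Sum>j<d. \<Sum>m<r. (C k i * B i m) * (C m j * B j l))"
      by (simp add: BC[symmetric] sum_distrib_left ac_simps)
    also have "\<dots> = (\<Sum>i<d. \<Sum>m<r. \<Sum>j<d. (C k i * B i m) * (C m j * B j l))"
      by (intro sum.cong[OF refl] sum.swap)
    also have "\<dots> = (\<Sum>m<r. \<Sum>i<d. \<Sum>j<d. (C k i * B i m) * (C m j * B j l))"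
      by (rule sum.swap)
    also have "\<dots> = (\<Sum>m<r. unit_vec k m * unit_vec m l)"
      by (simp add: CB[symmetric] kl sum_product)
    finally show ?thesis using sum_unit_vec_left[OF kl(1), of "\<lambda>m. unit_vec m l"] by simp
  qed
  then have bi: "cinner_l2 (\<nu> g (e k)) (\<nu> h (e' l)) = (if k = l \<and> g = h then 1 else 0)" if "k < r" "l < r" for g h k l
    using that lookup_bracket[OF e_cs, of k l "h - g"]
    by (cases "k = l"; cases "g = h") (simp_all add: cinner_\<nu> unit_vec_def lookup_one)
  \<comment> \<open>the old generators are combinations of translates of the new ones, so the latter span \<open>K\<close> as well\<close>
  have span: "z i = (\<Sum>k<r. act (B i k) (e k))" if i: "i < d" for i
  proof -
    have "(\<Sum>k<r. act (B i k) (e k)) = (\<Sum>k<r. \<Sum>j<d. act (B i k * C k j) (z j))"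
      by (simp add: e_def act_sum_right act_mult)
    also have "\<dots> = (\<Sum>j<d. act (\<Sum>k<r. B i k * C k j) (z j))"
      unfolding act_sum by (rule sum.swap)
    also have "\<dots> = z i" using rec[OF i] by (simp add: BC i)
    finally show ?thesis ..
  qed
  have span': "z' j = (\<Sum>k<r. coact (C k j) (e' k))" if j: "j < d" for j
  proof -
    have "(\<Sum>k<r. coact (C k j) (e' k)) = (\<Sum>k<r. \<Sum>i<d. coact (B i k * C k j) (z' i))"
      by (simp add: e'_def coact_sum_right mult.commute[of "B _ _"] coact_mult)
    also have "\<dots> = (\<Sum>i<d. coact (\<Sum>k<r. B i k * C k j) (z' i))"
      unfolding coact_sum by (rule sum.swap)
    also have "\<dots> = z' j" using rec'[OF j] by (simp add: BC j)
    finally show ?thesis ..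
  qed
  define \<eta> where "\<eta> k = e (k - 1)" for k
  define \<eta>' where "\<eta>' k = e' (k - 1)" for k
  note K_closed = l2.subspace_0[OF assms(1)] l2.subspace_add[OF assms(1)] l2.subspace_scale[OF assms(1)]
  have eK: "\<nu> g (e k) \<in> K" "\<nu> g (e' k) \<in> K" for g k
  proof -
    have 1: "\<forall>g. \<nu> g (act a f) \<in> K" "\<forall>g. \<nu> g (coact a f) \<in> K" if "\<forall>g. \<nu> g f \<in> K" for a f
      using act_coact_closed(1,2)[of "\<lambda>f. \<forall>g. \<nu> g f \<in> K" f a] that K_closed by (auto simp: \<nu>_simps)
    show "\<nu> g (e k) \<in> K" "\<nu> g (e' k) \<in> K"
      unfolding e_def e'_def \<nu>_sum using 1 inK by (auto intro!: l2.subspace_sum[OF assms(1)])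
  qed
  have bz: "bessel K (z i)" "bessel K (z' i)" if "i < d" for i
    using bessel_from_frame[OF frames(1), of "Suc i"] bessel_from_frame[OF frames(2), of "Suc i"] that
    by (simp_all add: z_def z'_def)
  note bessel_closed = act_coact_closed[of "bessel K", OF bessel_0 bessel_add bessel_scale bessel_\<nu>]
  have be: "bessel K (e k)" "bessel K (e' k)" for k
    unfolding e_def e'_def by (intro bessel_closed(3) bessel_closed(1,2) bz; simp)+
  obtain b where b: "b > 0" "bessel_on K (?I r) (translates \<eta>) b"
    by (rule bessel_translates[of r K \<eta>]) (use be in \<open>auto simp: \<eta>_def\<close>)
  obtain b' where b': "b' > 0" "bessel_on K (?I r) (translates \<eta>') b'"
    by (rule bessel_translates[of r K \<eta>']) (use be in \<open>auto simp: \<eta>'_def\<close>)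
  have dense: "K \<subseteq> closure (l2.span (translates \<theta> ` ?I r))"
    if expand: "\<And>v. v \<in> K \<Longrightarrow> ((\<lambda>i. a v i *\<^sub>C translates \<xi> i) has_sum v) (?I d)"
      and span: "\<And>g j. j \<in> {1..d} \<Longrightarrow> \<nu> g (\<xi> j) \<in> l2.span (translates \<theta> ` ?I r)" for \<theta> \<xi> a
  proof
    fix v assume "v \<in> K"
    have "eventually (\<lambda>F. (\<Sum>i\<in>F. a v i *\<^sub>C translates \<xi> i) \<in> l2.span (translates \<theta> ` ?I r)) (finite_subsets_at_top (?I d))"
      by (rule eventually_finite_subsets_at_top_weakI)
         (intro l2.span_sum l2.span_scale, use span in \<open>force simp: translates_def\<close>)
    then show "v \<in> closure (l2.span (translates \<theta> ` ?I r))"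
      using expand[OF \<open>v \<in> K\<close>] unfolding has_sum_def
      by (intro Lim_in_closed_set[OF closed_closure _ finite_subsets_at_top_neq_bot])
         (auto elim!: eventually_mono intro: closure_subset[THEN subsetD])
  qed
  have span_inv: "\<nu> g (act a (\<theta> k)) \<in> l2.span (translates \<theta> ` ?I r)" "\<nu> g (coact a (\<theta> k)) \<in> l2.span (translates \<theta> ` ?I r)"
    if "k \<in> {1..r}" for \<theta> g a k
  proof -
    let ?S = "l2.span (translates \<theta> ` ?I r)"
    have base: "\<forall>g. \<nu> g (\<theta> k) \<in> ?S"
    proof
      fix g
      have "translates \<theta> (g, k) \<in> ?S" using that by (intro l2.span_base imageI) simp
      then show "\<nu> g (\<theta> k) \<in> ?S" by (simp add: translates_def)
    qed
    have zero: "\<forall>g. \<nu> g 0 \<in> ?S" by (simp add: l2.span_zero)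
    have add: "\<forall>g. \<nu> g (f + h) \<in> ?S" if "\<forall>g. \<nu> g f \<in> ?S" "\<forall>g. \<nu> g h \<in> ?S" for f h
      using that by (simp add: \<nu>_simps l2.span_add)
    have scale: "\<forall>g. \<nu> g (c *\<^sub>C f) \<in> ?S" if "\<forall>g. \<nu> g f \<in> ?S" for c f
      using that by (simp add: \<nu>_simps l2.span_scale)
    have shift: "\<forall>g. \<nu> g (\<nu> h f) \<in> ?S" if "\<forall>g. \<nu> g f \<in> ?S" for h f
      using that by (simp add: \<nu>_simps)
    have "\<forall>g. \<nu> g (act a (\<theta> k)) \<in> ?S" "\<forall>g. \<nu> g (coact a (\<theta> k)) \<in> ?S"
      by (rule act_coact_closed(1,2)[of "\<lambda>f. \<forall>g. \<nu> g f \<in> ?S", OF zero add scale shift base]; assumption)+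
    then show "\<nu> g (act a (\<theta> k)) \<in> ?S" "\<nu> g (coact a (\<theta> k)) \<in> ?S" by blast+
  qed
  have "K \<subseteq> closure (l2.span (translates \<eta> ` ?I r))"
  proof (rule dense[OF expand(2)])
    fix g j assume "j \<in> {1..d}"
    then have "\<nu> g (\<zeta> j) = (\<Sum>k<r. \<nu> g (act (B (j - 1) k) (\<eta> (Suc k))))"
      using span[of "j - 1"] by (cases j) (auto simp: z_def \<eta>_def \<nu>_sum)
    also have "\<dots> \<in> l2.span (translates \<eta> ` ?I r)" by (intro l2.span_sum span_inv) auto
    finally show "\<nu> g (\<zeta> j) \<in> l2.span (translates \<eta> ` ?I r)" .
  qed
  moreover have "K \<subseteq> closure (l2.span (translates \<eta>' ` ?I r))"
  proof (rule dense[OF expand(1)])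
    fix g j assume "j \<in> {1..d}"
    then have "\<nu> g (\<zeta>' j) = (\<Sum>k<r. \<nu> g (coact (C k (j - 1)) (\<eta>' (Suc k))))"
      using span'[of "j - 1"] by (cases j) (auto simp: z'_def \<eta>'_def \<nu>_sum)
    also have "\<dots> \<in> l2.span (translates \<eta>' ` ?I r)" by (intro l2.span_sum span_inv) auto
    finally show "\<nu> g (\<zeta>' j) \<in> l2.span (translates \<eta>' ` ?I r)" .
  qed
  moreover have "cinner_l2 (translates \<eta> i) (translates \<eta>' j) = (if i = j then 1 else 0)" if "i \<in> ?I r" "j \<in> ?I r" for i j
  proof -
    obtain g k h l where ij: "i = (g, k)" "j = (h, l)" by (cases i, cases j) blast
    then have "k - 1 < r" "l - 1 < r" "k - 1 = l - 1 \<longleftrightarrow> k = l" using that by auto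
    then show ?thesis using bi[of "k - 1" "l - 1" g h] by (auto simp: ij translates_def \<eta>_def \<eta>'_def)
  qed
  ultimately have "biorthogonal_dual_frames K (?I r) (translates \<eta>) (translates \<eta>')"
    by (intro biorthogonal_dual_framesI[OF b(2,1) b'(2,1) assms(1)])
       (auto simp: translates_def \<eta>_def \<eta>'_def eK)
  moreover have "\<eta> i \<in> K \<and> \<eta>' i \<in> K \<and> compactly_supported (\<eta> i) \<and> compactly_supported (\<eta>' i)" for i
    using eK[of 0] e_cs by (simp add: \<eta>_def \<eta>'_def \<nu>_simps)
  ultimately show ?thesis unfolding biorthogonal_G_frames_def by blast
qed

end
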